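(* Suppose Assumptions (A) and (B) (stated in the context) hold, and suppose that either $s_2\ll\sqrt n/(\kappa_n\gamma_n)$, or both Assumption (C) (stated in the context) and $D_n^2/n=o(1)$ hold. Then: (1) if $s_1\ll n/\lambda^2$, then $\sqrt n(\hat{\boldsymbol\beta}_n-\boldsymbol\beta^\star)\to N(0,\sigma^2\boldsymbol\Sigma_X^{-1})$ in distribution; (2) for every constant $b>0$, if $s_1\sim bn/\lambda^2$, then $\sqrt n(\hat{\boldsymbol\beta}_n-\boldsymbol\beta^\star)\to N(0,(b+\sigma^2)\boldsymbol\Sigma_X^{-1})$ in distribution; (3) if $s_1\gg n/\lambda^2$, then $r_n(\hat{\boldsymbol\beta}_n-\boldsymbol\beta^\star)\to N(0,\boldsymbol\Sigma_X^{-1})$ in distribution, where $r_n\sim n/(\lambda\sqrt{s_1})$.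
   Context: Notation: $a_n\ll b_n$ (equivalently $b_n\gg a_n$) means $a_n=o(b_n)$; $a_n\sim b_n$ means $a_n/b_n\to1$; all limits are as $n\to\infty$. Model: $d\ge 1$ is a fixed integer. For each $n$ the data satisfy $Y_i=\mu_i^\star+\boldsymbol X_i^T\boldsymbol\beta^\star+\epsilon_i$, $1\le i\le n$, where $\boldsymbol\beta^\star\in\mathbb R^d$ and $\boldsymbol\mu^\star=(\mu_1^\star,\dots,\mu_n^\star)^T$ are deterministic ($\boldsymbol\mu^\star$ may vary with $n$). The $\boldsymbol X_i$ are i.i.d. copies of a random vector $\boldsymbol X_0\in\mathbb R^d$ with mean zero and positive definite covariance matrix $\boldsymbol\Sigma_X$; they are independent of the $\epsilon_i$, which are i.i.d. copies of a random variable $\epsilon_0$ with mean zero and variance $\sigma^2>0$. $\boldsymbol X$ is the $n\times d$ matrix with rows $\boldsymbol X_i^T$ and $\boldsymbol Y=(Y_1,\dots,Y_n)^T$. Assumption (A): there are positive sequences $\kappa_n\ll\sqrt n$, $\gamma_n\ll\sqrt n$ with $P(\max_{1\le i\le n}\|\boldsymbol X_i\|_2>\kappa_n)\to0$ and $P(\max_{1\le i\le n}|\epsilon_i|>\gamma_n)\to0$. Incidental parameters: with $s=s_1+s_2$ and $s_1+s_2=o(n)$: $|\mu_i^\star|\gg\max\{\kappa_n,\gamma_n\}$ for $1\le i\le s_1$; $0<|\mu_i^\star|\le\gamma_n$ for $s_1+1\le i\le s$; $\mu_i^\star=0$ for $s+1\le i\le n$. Let $\boldsymbol\mu_2^\star=(\mu_{s_1+1}^\star,\dots,\mu_s^\star)^T$,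 $D_n=\|\boldsymbol\mu_2^\star\|_2$ and $\mu^\star=\min_{1\le i\le s_1}|\mu_i^\star|$. It is assumed that the sizes of $\{1\le i\le s_1:\mu_i^\star>0\}$ and $\{1\le i\le s_1:\mu_i^\star<0\}$ are asymptotically equivalent to $as_1$ and $(1-a)s_1$ for a constant $a\in(0,1)$. Assumption (B): the regularization parameter $\lambda=\lambda_n>0$ satisfies $\kappa_n\ll\lambda$, $\alpha\gamma_n\le\lambda$ for a constant $\alpha>2$, and $\lambda\ll\min\{\mu^\star,\sqrt n\}$. Assumption (C): there is a constant $\delta>0$ such that $E\|\boldsymbol X_0\|_2^{2+\delta}<\infty$ and $\|\boldsymbol\mu_2^\star\|_2/\|\boldsymbol\mu_2^\star\|_{2+\delta}\to\infty$, where $\|\boldsymbol\mu_2^\star\|_{2+\delta}=(\sum_{i=s_1+1}^{s}|\mu_i^\star|^{2+\delta})^{1/(2+\delta)}$. Estimator: $\varphi_n(\boldsymbol\beta)=\boldsymbol\beta-(\boldsymbol X^T\boldsymbol X)^{-1}\boldsymbol X^T(\boldsymbol Y-\boldsymbol\mu(\boldsymbol\beta))$, where $\boldsymbol\mu(\boldsymbol\beta)\in\mathbb R^n$ has components $\mu_i(\boldsymbol\beta)=(|Y_i-\boldsymbol X_i^T\boldsymbol\beta|-\lambda)_+\,\mathrm{sign}(Y_i-\boldsymbol X_i^T\boldsymbol\beta)$. $B_C(\boldsymbol\beta^\star)=\{\boldsymbol\beta\in\mathbb R^d:|\beta_j-\beta_j^\star|\le C,\ 1\le j\le d\}$. For a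 fixed $C>0$, $\hat{\boldsymbol\beta}_n$ is the consistent estimator which, with probability tending to one, is the unique element of $B_C(\boldsymbol\beta^\star)$ with $\varphi_n(\hat{\boldsymbol\beta}_n)=0$. *)

theory Defs
  imports "HOL-Probability.Probability" "HOL-Library.Landau_Symbols"
begin

subsection \<open>Probability\<close>

definition iid_copies ::
    "'a measure \<Rightarrow> 'i set \<Rightarrow> ('i \<Rightarrow> 'a \<Rightarrow> 'c::topological_space) \<Rightarrow> 'b measure \<Rightarrow> ('b \<Rightarrow> 'c) \<Rightarrow> bool"
  where "iid_copies M I Z M0 Z0 \<longleftrightarrow>
    prob_space.indep_vars M (\<lambda>_. borel) Z I \<and> (\<forall>i\<in>I. distr M borel (Z i) = distr M0 borel Z0)"

(* Independence of the two random elements (Z i)_i and (W i)_i; the library's indep_var would force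
   both to have the same type. *)
definition indep_families ::
    "'a measure \<Rightarrow> 'i set \<Rightarrow> ('i \<Rightarrow> 'a \<Rightarrow> 'c::topological_space) \<Rightarrow> ('i \<Rightarrow> 'a \<Rightarrow> 'e::topological_space) \<Rightarrow> bool"
  where "indep_families M I Z W \<longleftrightarrow>
    prob_space.indep_set M
      {(\<lambda>\<omega>. \<lambda>i\<in>I. Z i \<omega>) -` A \<inter> space M | A. A \<in> sets (PiM I (\<lambda>_. borel))}
      {(\<lambda>\<omega>. \<lambda>i\<in>I. W i \<omega>) -` B \<inter> space M | B. B \<in> sets (PiM I (\<lambda>_. borel))}"

definition cov_matrix :: "'a measure \<Rightarrow> ('a \<Rightarrow> real ^ 'd) \<Rightarrow> real ^ 'd ^ 'd"
  where "cov_matrix M Z =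
    (\<chi> j k. \<integral>\<omega>. (Z \<omega> $ j - (\<integral>\<eta>. Z \<eta> $ j \<partial>M)) * (Z \<omega> $ k - (\<integral>\<eta>. Z \<eta> $ k \<partial>M)) \<partial>M)"

definition pos_def_matrix :: "real ^ 'd ^ 'd \<Rightarrow> bool"
  where "pos_def_matrix A \<longleftrightarrow> transpose A = A \<and> (\<forall>x. x \<noteq> 0 \<longrightarrow> 0 < x \<bullet> (A *v x))"

(* N(m, V) through its Lebesgue density; meaningful only for positive definite V. *)
definition multivariate_normal :: "real ^ 'd \<Rightarrow> real ^ 'd ^ 'd \<Rightarrow> (real ^ 'd) measure"
  where "multivariate_normal m V = density lborel (\<lambda>x. ennreal
    (exp (- ((x - m) \<bullet> (matrix_inv V *v (x - m))) / 2) / sqrt ((2 * pi) ^ CARD('d) * det V)))"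

(* The random vectors Z n may live on different probability spaces M n. *)
definition converges_in_distribution ::
    "(nat \<Rightarrow> 'a measure) \<Rightarrow> (nat \<Rightarrow> 'a \<Rightarrow> 'c::metric_space) \<Rightarrow> 'c measure \<Rightarrow> bool"
  where "converges_in_distribution M Z N \<longleftrightarrow>
    (\<forall>f::'c \<Rightarrow> real. continuous_on UNIV f \<and> bounded (range f) \<longrightarrow>
      (\<lambda>n. \<integral>x. f x \<partial>distr (M n) borel (Z n)) \<longlonglongrightarrow> (\<integral>x. f x \<partial>N))"

(* "With probability tending to one". The set of all \<omega> with E n \<omega> need not be measurable (below, E
   involves a uniqueness claim), hence the measurable subsets A n. *)
definition with_high_prob :: "(nat \<Rightarrow> 'a measure) \<Rightarrow> (nat \<Rightarrow> 'a \<Rightarrow> bool) \<Rightarrow> bool"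
  where "with_high_prob M E \<longleftrightarrow>
    (\<exists>A. (\<forall>n. A n \<in> sets (M n)) \<and> (\<forall>n. \<forall>\<omega>\<in>A n. E n \<omega>) \<and> (\<lambda>n. measure (M n) (A n)) \<longlonglongrightarrow> 1)"

definition consistent_estimator ::
    "(nat \<Rightarrow> 'a measure) \<Rightarrow> (nat \<Rightarrow> 'a \<Rightarrow> 'c::metric_space) \<Rightarrow> 'c \<Rightarrow> bool"
  where "consistent_estimator M T \<theta> \<longleftrightarrow>
    (\<forall>e>0. (\<lambda>n. measure (M n) {\<omega>\<in>space (M n). e < dist (T n \<omega>) \<theta>}) \<longlonglongrightarrow> 0)"


subsection \<open>The estimating function\<close>

text \<open>
  Observations are indexed by \<open>{1..n}\<close>; \<open>x i\<close> is the i-th row of the \<open>n \<times> d\<close> design matrix, so that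
  \<open>X\<^sup>T X\<close> is \<open>gram n x\<close> and \<open>X\<^sup>T v\<close> is the sum of the vectors \<open>v i *\<^sub>R x i\<close>.
\<close>

definition gram :: "nat \<Rightarrow> (nat \<Rightarrow> real ^ 'd) \<Rightarrow> real ^ 'd ^ 'd"
  where "gram n x = (\<chi> j k. \<Sum>i=1..n. x i $ j * x i $ k)"

definition mu_fun :: "real \<Rightarrow> (nat \<Rightarrow> real ^ 'd) \<Rightarrow> (nat \<Rightarrow> real) \<Rightarrow> real ^ 'd \<Rightarrow> nat \<Rightarrow> real"
  where "mu_fun lam x y b i = max (\<bar>y i - x i \<bullet> b\<bar> - lam) 0 * sgn (y i - x i \<bullet> b)"

(* If gram n x is singular, the value of matrix_inv, and hence of phi, is unspecified. *)
definition phi :: "nat \<Rightarrow> real \<Rightarrow> (nat \<Rightarrow> real ^ 'd) \<Rightarrow> (nat \<Rightarrow> real) \<Rightarrow> real ^ 'd \<Rightarrow> real ^ 'd"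
  where "phi n lam x y b =
    b - matrix_inv (gram n x) *v (\<Sum>i=1..n. (y i - mu_fun lam x y b i) *\<^sub>R x i)"

definition coord_box :: "real \<Rightarrow> real ^ 'd \<Rightarrow> (real ^ 'd) set"
  where "coord_box C b0 = {b. \<forall>j. \<bar>b $ j - b0 $ j\<bar> \<le> C}"


subsection \<open>The incidental parameters and the assumptions\<close>

text \<open>
  \<open>mu n i\<close> is the i-th incidental parameter at sample size \<open>n\<close>. The large ones are
  \<open>i \<in> {1..s1 n}\<close>, the small nonzero ones are \<open>i \<in> {s1 n + 1..s1 n + s2 n}\<close>.
\<close>

(* The relation |mu n i| >> max (kap n) (gam n) is read uniformly in i \<le> s1 n. In the two sign counts,
   asymp_equiv counts 0/0 as 1, so s1 n = 0 is admitted. *)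
definition incidental_parameters ::
    "(nat \<Rightarrow> real) \<Rightarrow> (nat \<Rightarrow> real) \<Rightarrow> (nat \<Rightarrow> nat) \<Rightarrow> (nat \<Rightarrow> nat) \<Rightarrow> real \<Rightarrow> (nat \<Rightarrow> nat \<Rightarrow> real) \<Rightarrow> bool"
  where "incidental_parameters kap gam s1 s2 a mu \<longleftrightarrow>
    (\<forall>n. s1 n + s2 n \<le> n) \<and>
    (\<lambda>n. real (s1 n + s2 n)) \<in> o(\<lambda>n. real n) \<and>
    (\<forall>c>0. \<forall>\<^sub>F n in sequentially. \<forall>i\<in>{1..s1 n}. max (kap n) (gam n) \<le> c * \<bar>mu n i\<bar>) \<and>
    (\<forall>n. \<forall>i\<in>{s1 n + 1..s1 n + s2 n}. 0 < \<bar>mu n i\<bar> \<and> \<bar>mu n i\<bar> \<le> gam n) \<and>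
    (\<forall>n. \<forall>i\<in>{s1 n + s2 n + 1..n}. mu n i = 0) \<and>
    0 < a \<and> a < 1 \<and>
    (\<lambda>n. real (card {i\<in>{1..s1 n}. 0 < mu n i})) \<sim>[sequentially] (\<lambda>n. a * real (s1 n)) \<and>
    (\<lambda>n. real (card {i\<in>{1..s1 n}. mu n i < 0})) \<sim>[sequentially] (\<lambda>n. (1 - a) * real (s1 n))"

definition assumption_A ::
    "(nat \<Rightarrow> 'a measure) \<Rightarrow> (nat \<Rightarrow> nat \<Rightarrow> 'a \<Rightarrow> real ^ 'd) \<Rightarrow> (nat \<Rightarrow> nat \<Rightarrow> 'a \<Rightarrow> real) \<Rightarrow>
      (nat \<Rightarrow> real) \<Rightarrow> (nat \<Rightarrow> real) \<Rightarrow> bool"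
  where "assumption_A M X eps kap gam \<longleftrightarrow>
    (\<forall>n. 0 < kap n) \<and> (\<forall>n. 0 < gam n) \<and>
    kap \<in> o(\<lambda>n. sqrt (real n)) \<and> gam \<in> o(\<lambda>n. sqrt (real n)) \<and>
    (\<lambda>n. measure (M n) {\<omega>\<in>space (M n). (MAX i\<in>{1..n}. norm (X n i \<omega>)) > kap n}) \<longlonglongrightarrow> 0 \<and>
    (\<lambda>n. measure (M n) {\<omega>\<in>space (M n). (MAX i\<in>{1..n}. \<bar>eps n i \<omega>\<bar>) > gam n}) \<longlonglongrightarrow> 0"

(* The minimum of the smallest large |mu n i| and sqrt n is taken over a single finite nonempty set, so
   that the minimum over an empty collection (s1 n = 0) counts as infinite. *)
definition assumption_B ::
    "(nat \<Rightarrow> real) \<Rightarrow> (nat \<Rightarrow> real) \<Rightarrow> (nat \<Rightarrow> nat) \<Rightarrow> (nat \<Rightarrow> nat \<Rightarrow> real) \<Rightarrow> real \<Rightarrow> (nat \<Rightarrow> real) \<Rightarrow> bool"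
  where "assumption_B kap gam s1 mu \<alpha> lam \<longleftrightarrow>
    (\<forall>n. 0 < lam n) \<and> kap \<in> o(lam) \<and> 2 < \<alpha> \<and> (\<forall>n. \<alpha> * gam n \<le> lam n) \<and>
    lam \<in> o(\<lambda>n. Min (insert (sqrt (real n)) ((\<lambda>i. \<bar>mu n i\<bar>) ` {1..s1 n})))"

definition mu2_norm :: "(nat \<Rightarrow> nat) \<Rightarrow> (nat \<Rightarrow> nat) \<Rightarrow> (nat \<Rightarrow> nat \<Rightarrow> real) \<Rightarrow> real \<Rightarrow> nat \<Rightarrow> real"
  where "mu2_norm s1 s2 mu p n = (\<Sum>i=s1 n + 1..s1 n + s2 n. \<bar>mu n i\<bar> powr p) powr (1 / p)"

definition assumption_C ::
    "'b measure \<Rightarrow> ('b \<Rightarrow> real ^ 'd) \<Rightarrow> (nat \<Rightarrow> nat) \<Rightarrow> (nat \<Rightarrow> nat) \<Rightarrow> (nat \<Rightarrow> nat \<Rightarrow> real) \<Rightarrow> bool"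
  where "assumption_C M0 X0 s1 s2 mu \<longleftrightarrow>
    (\<exists>\<delta>>0. integrable M0 (\<lambda>\<omega>. norm (X0 \<omega>) powr (2 + \<delta>)) \<and>
      filterlim (\<lambda>n. mu2_norm s1 s2 mu 2 n / mu2_norm s1 s2 mu (2 + \<delta>) n) at_top sequentially)"

end

theory Submission
  imports Defs
begin

text \<open>
  Where \<open>phi\<close> vanishes, the residuals clipped to \<open>[- lam n, lam n]\<close> are orthogonal to the design. Given
  the bounds of Assumption (A), the observations with a large incidental parameter are clipped to
  \<open>\<plusminus> lam n\<close> and no other observation is clipped, so the equation becomes linear in the error
  \<open>bhat - \<beta>\<close>: the Gram matrix of the unclipped observations times the error is
  \<open>U + V\<close>, where \<open>U\<close> is the sum of independent mean-zero vectors \<open>eps i *\<^sub>R X i\<close> (unclipped) and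
  \<open>(\<plusminus> lam n) *\<^sub>R X i\<close> (clipped), and \<open>V\<close> is the negligible contribution of the small incidental
  parameters. The two kinds of summands in \<open>U\<close> have covariances \<open>\<sigma>\<^sup>2 *\<^sub>R SigmaX\<close> and
  \<open>(lam n)\<^sup>2 *\<^sub>R SigmaX\<close>, so the size of \<open>s1 n * (lam n)\<^sup>2\<close> relative to \<open>n\<close> decides
  which one dominates, and this gives the three regimes.
\<close>

subsection \<open>Convergence in distribution on Euclidean spaces\<close>

text \<open>The limit law is reached through characteristic functions: for fixed \<open>u\<close>
  the scalar \<open>u \<bullet> (c n *\<^sub>R U n \<omega>)\<close> is an independent sum whose
  summands follow only two laws up to deterministic factors, so its characteristic function is a
  product of two blocks. Only second moments are at hand, and the second-order expansion with o(1)
  relative error is just enough. The passage back to bounded continuous test functions in dimension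
  d goes through Gaussian smoothing.

  That the equation becomes linear rests on a crude bound: \<open>bhat\<close> lies in a fixed box,
  so \<open>X i \<bullet> (bhat - \<beta>)\<close> is O(\<open>kap n\<close>) =
  o(\<open>lam n\<close>), while \<alpha> > 2 leaves a fixed fraction of \<open>lam n\<close> once
  \<open>2 * gam n\<close> is spent.

  One scale c serves all regimes, through w1 = lim s1 (c lam)^2 and w2 = lim n c^2: the error times
  n c has limiting covariance w1 + \<sigma>^2 w2 times the inverse of \<open>SigmaX\<close>. Taking
  c = 1/sqrt n gives w2 = 1 and w1 = 0 or b; taking c = r/n gives w1 = 1 and w2 = 0.\<close>

definition std_gaussian :: "'a::euclidean_space measure" where
  "std_gaussian = density lborel (\<lambda>x. ennreal (exp (- (norm x)\<^sup>2 / 2) / sqrt ((2 * pi) ^ DIM('a))))"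

definition mchar :: "'a::euclidean_space measure \<Rightarrow> 'a \<Rightarrow> complex" where
  "mchar \<mu> u = (CLINT x|\<mu>. iexp (u \<bullet> x))"

lemma norm_sq_sum_Basis: "(norm x)\<^sup>2 = (\<Sum>b\<in>Basis. (x \<bullet> b)\<^sup>2)" for x :: "'a::euclidean_space"
  by (subst power2_norm_eq_inner, subst euclidean_inner) (simp add: power2_eq_square)

text \<open>Factorisation along the basis reduces total mass and characteristic function to the
  one-dimensional normal law.\<close>

lemma prod_std_normal_density:
  fixes x :: "'a::euclidean_space"
  shows "(\<Prod>b\<in>Basis. std_normal_density (x \<bullet> b)) = exp (- (norm x)\<^sup>2 / 2) / sqrt ((2 * pi) ^ DIM('a))"
  unfolding real_sqrt_power
  by (simp add: norm_sq_sum_Basis normal_density_def prod_dividef exp_sum[symmetric] sum_negf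
      flip: sum_divide_distrib)

lemma prob_space_std_gaussian: "prob_space (std_gaussian :: 'a::euclidean_space measure)"
proof
  have "emeasure (std_gaussian :: 'a measure) (space std_gaussian)
      = (\<integral>\<^sup>+x. (\<Prod>b\<in>Basis. ennreal (std_normal_density ((x::'a) \<bullet> b))) \<partial>lborel)"
    unfolding std_gaussian_def prod_std_normal_density[symmetric]
    by (subst emeasure_density) (auto simp: prod_ennreal)
  also have "\<dots> = (\<Prod>b\<in>(Basis :: 'a set). \<integral>\<^sup>+x. ennreal (std_normal_density x) \<partial>lborel)"
    by (rule nn_integral_lborel_prod) auto
  also have "(\<integral>\<^sup>+x. ennreal (std_normal_density x) \<partial>lborel) = 1"
    using prob_space.emeasure_space_1[OF prob_space_normal_density[of 1 0]]
    by (simp add: emeasure_density)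
  finally show "emeasure (std_gaussian :: 'a measure) (space std_gaussian) = 1" by simp
qed

lemma sets_std_gaussian [simp, measurable_cong]: "sets std_gaussian = sets borel"
  by (simp add: std_gaussian_def)

lemma space_std_gaussian [simp]: "space std_gaussian = UNIV"
  by (simp add: std_gaussian_def)

lemma integral_lborel_prod:
  fixes g :: "'a::euclidean_space \<Rightarrow> real \<Rightarrow> complex"
  assumes "\<And>b. b \<in> Basis \<Longrightarrow> integrable lborel (g b)"
  shows "(\<integral>x. (\<Prod>b\<in>Basis. g b (x \<bullet> b)) \<partial>lborel) = (\<Prod>b\<in>Basis. \<integral>x. g b x \<partial>lborel)"
proof -
  interpret product_sigma_finite "\<lambda>_::'a. lborel :: real measure" ..
  have [measurable]: "\<And>b. b \<in> Basis \<Longrightarrow> g b \<in> borel_measurable borel"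
    using borel_measurable_integrable[OF assms] by simp
  show ?thesis
    by (subst lborel_eq, subst integral_distr)
       (auto simp: assms intro!: product_integral_prod)
qed

lemma mchar_std_gaussian: "mchar std_gaussian (u::'a::euclidean_space) = exp (- (norm u)\<^sup>2 / 2)"
proof -
  let ?g = "\<lambda>b x. std_normal_density x *\<^sub>R iexp ((u \<bullet> b) * x)"
  have nn: "(\<Prod>b\<in>Basis. std_normal_density ((x::'a) \<bullet> b)) \<ge> 0" for x
    by (intro prod_nonneg) auto
  have int: "integrable lborel (?g b)" for b
    by (rule Bochner_Integration.integrable_bound[OF integrable_normal_density[of 1 0]]) auto
  have "mchar std_gaussian u = (\<integral>x. (\<Prod>b\<in>Basis. std_normal_density (x \<bullet> b)) *\<^sub>R iexp (u \<bullet> x) \<partial>lborel)"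
    unfolding mchar_def std_gaussian_def prod_std_normal_density[symmetric]
    by (rule integral_density) (auto simp: nn)
  also have "\<dots> = (\<integral>x. (\<Prod>b\<in>Basis. ?g b (x \<bullet> b)) \<partial>lborel)"
  proof (rule Bochner_Integration.integral_cong[OF refl])
    fix x :: 'a
    have "iexp (u \<bullet> x) = (\<Prod>b\<in>Basis. iexp ((u \<bullet> b) * (x \<bullet> b)))"
      by (simp add: euclidean_inner[of u x] sum_distrib_left exp_sum)
    then show "(\<Prod>b\<in>Basis. std_normal_density (x \<bullet> b)) *\<^sub>R iexp (u \<bullet> x) = (\<Prod>b\<in>Basis. ?g b (x \<bullet> b))"
      by (simp add: scaleR_conv_of_real prod.distrib of_real_prod)
  qed
  also have "\<dots> = (\<Prod>b\<in>Basis. \<integral>x. ?g b x \<partial>lborel)"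
    by (rule integral_lborel_prod[OF int])
  also have "\<dots> = (\<Prod>b\<in>Basis. char std_normal_distribution (u \<bullet> b))"
    unfolding char_def by (intro prod.cong refl integral_density[symmetric]) auto
  also have "\<dots> = (\<Prod>b\<in>Basis. of_real (exp (- (u \<bullet> b)\<^sup>2 / 2)))"
    by (simp add: char_std_normal_distribution)
  also have "\<dots> = exp (- (norm u)\<^sup>2 / 2)"
    by (simp add: norm_sq_sum_Basis exp_sum[symmetric] sum_negf flip: of_real_prod sum_divide_distrib)
  finally show ?thesis by simp
qed

text \<open>The Gaussian kernel is itself a characteristic function, so its \<open>\<mu>\<close>-averages are determined by \<open>mchar \<mu>\<close>.\<close>

lemma gaussian_average_mchar:
  fixes \<mu> :: "'a::euclidean_space measure"
  assumes "prob_space \<mu>" and [measurable_cong]: "sets \<mu> = sets borel" and h: "h > 0"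
  shows "complex_of_real (\<integral>x. exp (- (norm ((z - x) /\<^sub>R h))\<^sup>2 / 2) \<partial>\<mu>)
       = (\<integral>w. iexp (w \<bullet> z / h) * mchar \<mu> (- w /\<^sub>R h) \<partial>std_gaussian)"
proof -
  interpret \<mu>: prob_space \<mu> by fact
  interpret G: prob_space "std_gaussian :: 'a measure" by (rule prob_space_std_gaussian)
  interpret P: pair_prob_space "std_gaussian :: 'a measure" \<mu> ..
  have "complex_of_real (\<integral>x. exp (- (norm ((z - x) /\<^sub>R h))\<^sup>2 / 2) \<partial>\<mu>)
      = (\<integral>x. mchar std_gaussian ((z - x) /\<^sub>R h) \<partial>\<mu>)"
    by (simp add: mchar_std_gaussian)
  also have "\<dots> = (\<integral>x. (\<integral>w. iexp (w \<bullet> z / h) * iexp ((- w /\<^sub>R h) \<bullet> x) \<partial>std_gaussian) \<partial>\<mu>)"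
    unfolding mchar_def
    by (intro Bochner_Integration.integral_cong refl)
       (simp add: inner_diff_right inner_diff_left inner_commute field_simps flip: exp_add)
  also have "\<dots> = (\<integral>w. (\<integral>x. iexp (w \<bullet> z / h) * iexp ((- w /\<^sub>R h) \<bullet> x) \<partial>\<mu>) \<partial>std_gaussian)"
    by (rule P.Fubini_integral) (rule P.integrable_const_bound[where B=1], auto simp: norm_mult)
  also have "\<dots> = (\<integral>w. iexp (w \<bullet> z / h) * mchar \<mu> (- w /\<^sub>R h) \<partial>std_gaussian)"
    unfolding mchar_def by simp
  finally show ?thesis .
qed

lemma mchar_le_1: "prob_space \<mu> \<Longrightarrow> norm (mchar \<mu> u) \<le> 1"
proof -
  assume "prob_space \<mu>"
  then interpret prob_space \<mu> .
  have "norm (mchar \<mu> u) \<le> (\<integral>x. norm (iexp (u \<bullet> x)) \<partial>\<mu>)"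
    unfolding mchar_def by (rule integral_norm_bound)
  then show ?thesis by (simp add: prob_space)
qed

lemma mchar_measurable [measurable]:
  fixes \<mu> :: "'a::euclidean_space measure"
  assumes "prob_space \<mu>" and [measurable_cong]: "sets \<mu> = sets borel"
  shows "mchar \<mu> \<in> borel_measurable borel"
proof -
  interpret prob_space \<mu> by fact
  show ?thesis unfolding mchar_def by measurable
qed

text \<open>This is weak convergence tested against Gaussian bumps of width \<open>h\<close>. In the
  representation above, \<open>mchar\<close> enters under an integral against a fixed probability
  measure and is bounded by 1, so pointwise convergence suffices.\<close>

lemma gaussian_average_tendsto:
  fixes \<mu> :: "nat \<Rightarrow> 'a::euclidean_space measure"
  assumes p: "\<And>n. prob_space (\<mu> n)" "prob_space \<nu>"
    and s: "\<And>n. sets (\<mu> n) = sets borel" "sets \<nu> = sets borel"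
    and lim: "\<And>u. (\<lambda>n. mchar (\<mu> n) u) \<longlonglongrightarrow> mchar \<nu> u" and h: "h > 0"
  shows "(\<lambda>n. \<integral>x. exp (- (norm ((z - x) /\<^sub>R h))\<^sup>2 / 2) \<partial>\<mu> n)
      \<longlonglongrightarrow> (\<integral>x. exp (- (norm ((z - x) /\<^sub>R h))\<^sup>2 / 2) \<partial>\<nu>)"
proof -
  interpret G: prob_space "std_gaussian :: 'a measure" by (rule prob_space_std_gaussian)
  note [measurable] = mchar_measurable[OF p(1) s(1)] mchar_measurable[OF p(2) s(2)]
  have "(\<lambda>n. complex_of_real (\<integral>x. exp (- (norm ((z - x) /\<^sub>R h))\<^sup>2 / 2) \<partial>\<mu> n))
      \<longlonglongrightarrow> complex_of_real (\<integral>x. exp (- (norm ((z - x) /\<^sub>R h))\<^sup>2 / 2) \<partial>\<nu>)"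
    unfolding gaussian_average_mchar[OF p(1) s(1) h] gaussian_average_mchar[OF p(2) s(2) h]
    by (rule integral_dominated_convergence[where w="\<lambda>_. 1"])
       (auto intro!: tendsto_intros lim simp: norm_mult mchar_le_1[OF p(1)])
  then show ?thesis by (simp only: tendsto_of_real_iff)
qed

text \<open>Substitution \<open>z = x + h *\<^sub>R g\<close>; the Jacobian is the power of
  \<open>h\<close> in the denominator. It moves the dependence on \<open>x\<close> from
  \<open>f\<close> into the kernel.\<close>

lemma gaussian_smoothing:
  fixes f :: "'a::euclidean_space \<Rightarrow> real"
  assumes [measurable]: "f \<in> borel_measurable borel" and h: "h > 0"
  shows "(\<integral>g. f (x + h *\<^sub>R g) \<partial>std_gaussian)
    = (\<integral>z. f z * (exp (- (norm ((z - x) /\<^sub>R h))\<^sup>2 / 2) / (sqrt ((2 * pi) ^ DIM('a)) * h ^ DIM('a))) \<partial>lborel)"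
    (is "?L = (\<integral>z. ?F z \<partial>lborel)")
proof -
  have "(\<integral>z. ?F z \<partial>lborel) = (\<integral>z. ?F z \<partial>density (distr lborel borel (\<lambda>g. x + h *\<^sub>R g)) (\<lambda>_. ennreal (\<bar>h\<bar> ^ DIM('a))))"
    using lborel_affine[of h x] h by simp
  also have "\<dots> = (\<integral>z. \<bar>h\<bar> ^ DIM('a) * ?F z \<partial>distr lborel borel (\<lambda>g. x + h *\<^sub>R g))"
    by (subst integral_density) auto
  also have "\<dots> = (\<integral>g. \<bar>h\<bar> ^ DIM('a) * ?F (x + h *\<^sub>R g) \<partial>lborel)"
    by (subst integral_distr) auto
  also have "\<dots> = (\<integral>g. (exp (- (norm g)\<^sup>2 / 2) / sqrt ((2 * pi) ^ DIM('a))) *\<^sub>R f (x + h *\<^sub>R g) \<partial>lborel)"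
    using h by (intro Bochner_Integration.integral_cong) auto
  also have "\<dots> = ?L"
    unfolding std_gaussian_def by (subst integral_density) auto
  finally show ?thesis by simp
qed

text \<open>By Fubini the integral over the measure falls on the kernel alone, where the previous
  convergence applies for each \<open>z\<close>. Lebesgue integrability of \<open>f\<close> then
  provides the dominating function, which is why compactly supported test functions are treated
  first.\<close>

lemma smoothed_integral_tendsto:
  fixes \<mu> :: "nat \<Rightarrow> 'a::euclidean_space measure" and f :: "'a \<Rightarrow> real"
  assumes p: "\<And>n. prob_space (\<mu> n)" "prob_space \<nu>"
    and s: "\<And>n. sets (\<mu> n) = sets borel" "sets \<nu> = sets borel"
    and lim: "\<And>u. (\<lambda>n. mchar (\<mu> n) u) \<longlonglongrightarrow> mchar \<nu> u" and h: "h > 0"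
    and f: "integrable lborel f"
  shows "(\<lambda>n. \<integral>x. (\<integral>g. f (x + h *\<^sub>R g) \<partial>std_gaussian) \<partial>\<mu> n)
      \<longlonglongrightarrow> (\<integral>x. (\<integral>g. f (x + h *\<^sub>R g) \<partial>std_gaussian) \<partial>\<nu>)"
proof -
  \<comment> \<open>Normalising constant of the Gaussian density with standard deviation
    \<open>h\<close>; the kernel is bounded by \<open>1 / c\<close>.\<close>
  define c where "c = sqrt ((2 * pi) ^ DIM('a)) * h ^ DIM('a)"
  define E where "E z x = exp (- (norm ((z - x) /\<^sub>R h))\<^sup>2 / 2) / c" for z x :: 'a
  have c: "c > 0" using h by (simp add: c_def)
  have E: "0 \<le> E z x" "E z x \<le> 1 / c" for z x
    using c by (auto simp: E_def divide_right_mono)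
  have [measurable]: "f \<in> borel_measurable borel" using f by simp
  have [measurable]: "(\<lambda>(z, x). E z x) \<in> borel_measurable (borel \<Otimes>\<^sub>M borel)"
    unfolding E_def by measurable
  have swap: "(\<integral>x. (\<integral>g. f (x + h *\<^sub>R g) \<partial>std_gaussian) \<partial>\<rho>) = (\<integral>z. f z * (\<integral>x. E z x \<partial>\<rho>) \<partial>lborel)"
    if \<rho>: "prob_space \<rho>" and [measurable_cong]: "sets \<rho> = sets borel" for \<rho> :: "'a measure"
  proof -
    interpret \<rho>: prob_space \<rho> by fact
    interpret pair_sigma_finite \<rho> "lborel :: 'a measure" ..
    have int: "integrable (\<rho> \<Otimes>\<^sub>M lborel) (\<lambda>(x, z). f z * E z x)"
    proof (rule Fubini_integrable)
      show "(\<lambda>(x, z). f z * E z x) \<in> borel_measurable (\<rho> \<Otimes>\<^sub>M lborel)" by measurable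
      have b: "integrable lborel (\<lambda>z. f z * E z x)" for x
      proof (rule Bochner_Integration.integrable_bound)
        show "integrable lborel (\<lambda>z. \<bar>f z\<bar> * (1 / c))" using f by simp
        have "\<bar>f z\<bar> * E z x \<le> \<bar>f z\<bar> * (1 / c)" for z using E by (intro mult_left_mono) auto
        then show "AE z in lborel. norm (f z * E z x) \<le> norm (\<bar>f z\<bar> * (1 / c))"
          using c E by (auto simp: abs_mult)
      qed simp
      then show "AE x in \<rho>. integrable lborel (\<lambda>z. case (x, z) of (x, z) \<Rightarrow> f z * E z x)" by simp
      show "integrable \<rho> (\<lambda>x. \<integral>z. norm (case (x, z) of (x, z) \<Rightarrow> f z * E z x) \<partial>lborel)"
      proof (rule \<rho>.integrable_const_bound[where B="\<integral>z. \<bar>f z\<bar> * (1 / c) \<partial>lborel"])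
        have "(\<integral>z. \<bar>f z * E z x\<bar> \<partial>lborel) \<le> (\<integral>z. \<bar>f z\<bar> * (1 / c) \<partial>lborel)" for x
        proof (rule integral_mono)
          show "integrable lborel (\<lambda>z. \<bar>f z * E z x\<bar>)" using b[of x] by (rule integrable_abs)
          show "\<bar>f z * E z x\<bar> \<le> \<bar>f z\<bar> * (1 / c)" for z
            using mult_left_mono[OF E(2), of "\<bar>f z\<bar>" z x] E(1)[of z x] by (simp add: abs_mult)
        qed (use f in simp)
        then show "AE x in \<rho>. norm (\<integral>z. norm (case (x, z) of (x, z) \<Rightarrow> f z * E z x) \<partial>lborel)
            \<le> (\<integral>z. \<bar>f z\<bar> * (1 / c) \<partial>lborel)" by (auto simp: integral_nonneg_AE)
      qed measurable
    qed
    have "(\<integral>x. (\<integral>g. f (x + h *\<^sub>R g) \<partial>std_gaussian) \<partial>\<rho>) = (\<integral>x. (\<integral>z. f z * E z x \<partial>lborel) \<partial>\<rho>)"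
      unfolding E_def c_def by (subst gaussian_smoothing[OF _ h]) auto
    also have "\<dots> = (\<integral>z. (\<integral>x. f z * E z x \<partial>\<rho>) \<partial>lborel)"
      by (rule Fubini_integral[symmetric, OF int])
    finally show ?thesis by simp
  qed
  show ?thesis
    unfolding swap[OF p(1) s(1)] swap[OF p(2) s(2)]
  proof (rule integral_dominated_convergence[where w="\<lambda>z. \<bar>f z\<bar> * (1 / c)"])
    show "(\<lambda>z. f z * (\<integral>x. E z x \<partial>\<nu>)) \<in> borel_measurable lborel"
    proof -
      interpret prob_space \<nu> by fact
      note [measurable_cong] = s(2)
      show ?thesis by measurable
    qed
    show "(\<lambda>z. f z * (\<integral>x. E z x \<partial>\<mu> n)) \<in> borel_measurable lborel" for n
    proof -
      interpret prob_space "\<mu> n" by fact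
      note [measurable_cong] = s(1)[of n]
      show ?thesis by measurable
    qed
    show "integrable lborel (\<lambda>z. \<bar>f z\<bar> * (1 / c))" using f by simp
    show "AE z in lborel. (\<lambda>n. f z * (\<integral>x. E z x \<partial>\<mu> n)) \<longlonglongrightarrow> f z * (\<integral>x. E z x \<partial>\<nu>)"
      unfolding E_def using gaussian_average_tendsto[OF p s lim h] c
      by (auto intro!: tendsto_intros AE_I2)
    show "AE z in lborel. norm (f z * (\<integral>x. E z x \<partial>\<mu> n)) \<le> \<bar>f z\<bar> * (1 / c)" for n
    proof (rule AE_I2)
      fix z
      interpret prob_space "\<mu> n" by fact
      note [measurable_cong] = s(1)[of n]
      have "(\<integral>x. E z x \<partial>\<mu> n) \<le> (\<integral>x. 1 / c \<partial>\<mu> n)"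
        using E c by (intro integral_mono integrable_const_bound[where B="1 / c"]) auto
      moreover have "0 \<le> (\<integral>x. E z x \<partial>\<mu> n)" by (rule integral_nonneg_AE) (use E in auto)
      ultimately show "norm (f z * (\<integral>x. E z x \<partial>\<mu> n)) \<le> \<bar>f z\<bar> * (1 / c)"
        using mult_left_mono[of "\<integral>x. E z x \<partial>\<mu> n" "1 / c" "\<bar>f z\<bar>"] by (simp add: abs_mult prob_space)
    qed
  qed
qed


section \<open>From smoothed to bounded continuous test functions\<close>

lemma (in prob_space) tail_prob_tendsto_0:
  fixes Z :: "'a \<Rightarrow> 'b::real_normed_vector"
  assumes [measurable]: "Z \<in> borel_measurable M"
  shows "(\<lambda>k. prob {x \<in> space M. real k < norm (Z x)}) \<longlonglongrightarrow> 0"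
proof -
  have "(\<lambda>k. prob {x \<in> space M. real k < norm (Z x)}) \<longlonglongrightarrow> prob (\<Inter>k. {x \<in> space M. real k < norm (Z x)})"
    by (rule finite_Lim_measure_decseq) (auto simp: decseq_def)
  also have "(\<Inter>k. {x \<in> space M. real k < norm (Z x)}) = {}"
  proof -
    have "\<exists>k. \<not> real k < norm (Z x)" for x
      using real_arch_simple[of "norm (Z x)"] by (auto simp: not_less)
    then show ?thesis by auto
  qed
  finally show ?thesis by simp
qed

lemma smoothing_uniform:
  fixes f :: "'a::euclidean_space \<Rightarrow> real"
  assumes f: "uniformly_continuous_on UNIV f" and B: "\<And>x. \<bar>f x\<bar> \<le> B" and e: "e > 0"
  obtains h where "h > 0" "\<And>x. \<bar>(\<integral>g. f (x + h *\<^sub>R g) \<partial>std_gaussian) - f x\<bar> \<le> e"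
proof -
  interpret G: prob_space "std_gaussian :: 'a measure" by (rule prob_space_std_gaussian)
  have [simp]: "G.prob UNIV = 1" using G.prob_space by simp
  have B0: "B \<ge> 0" using B[of 0] by linarith
  obtain d where d: "d > 0" "\<And>x y. dist y x < d \<Longrightarrow> \<bar>f y - f x\<bar> < e / 2"
    using f e unfolding uniformly_continuous_on_def dist_real_def by (metis UNIV_I half_gt_zero)
  have "(\<lambda>k. 2 * B * G.prob {g. real k < norm g}) \<longlonglongrightarrow> 2 * B * 0"
    using G.tail_prob_tendsto_0[of "\<lambda>g. g"] by (intro tendsto_intros) auto
  then have "eventually (\<lambda>k. 2 * B * G.prob {g. real k < norm g} < e / 2) sequentially"
    using e by (intro order_tendstoD(2)[of _ "2 * B * 0"]) auto
  then obtain k where k: "k > 0" "2 * B * G.prob {g. real k < norm g} < e / 2"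
    using eventually_happens[OF eventually_conj[OF _ eventually_gt_at_top[of 0]]] by auto
  \<comment> \<open>For \<open>norm g \<le> k\<close> the displacement \<open>h * norm g\<close> is
    at most \<open>d / 2\<close>, within the modulus of continuity; for larger \<open>g\<close> the
    difference is at most \<open>2 * B\<close>, on an event of small probability.\<close>
  define h where "h = d / (2 * k)"
  have h: "h > 0" using d k by (simp add: h_def)
  have [measurable]: "f \<in> borel_measurable borel"
    by (intro borel_measurable_continuous_onI uniformly_continuous_imp_continuous f)
  show thesis
  proof (rule that[OF h])
    fix x
    have pt: "\<bar>f (x + h *\<^sub>R g) - f x\<bar> \<le> e / 2 + 2 * B * indicator {g. real k < norm g} g" for g
    proof (cases "real k < norm g")
      case True
      then show ?thesis using B[of x] B[of "x + h *\<^sub>R g"] e by simp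
    next
      case False
      then have "h * norm g \<le> d / 2" using k d h unfolding h_def
        by (simp add: field_simps)
      then show ?thesis using d(1) d(2)[of "x + h *\<^sub>R g" x] h False by (simp add: dist_norm)
    qed
    have i1: "integrable std_gaussian (\<lambda>g. f (x + h *\<^sub>R g))"
      using B by (intro G.integrable_const_bound[where B=B]) auto
    have "(\<integral>g. f (x + h *\<^sub>R g) \<partial>std_gaussian) - f x = (\<integral>g. f (x + h *\<^sub>R g) - f x \<partial>std_gaussian)"
      using i1 by (subst Bochner_Integration.integral_diff) (auto simp: G.prob_space)
    also have "\<bar>\<dots>\<bar> \<le> (\<integral>g. \<bar>f (x + h *\<^sub>R g) - f x\<bar> \<partial>std_gaussian)"
      by (rule integral_abs_bound)
    also have "\<dots> \<le> (\<integral>g. e / 2 + 2 * B * indicator {g. real k < norm g} g \<partial>(std_gaussian :: 'a measure))"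
    proof (rule integral_mono)
      show "integrable (std_gaussian :: 'a measure) (\<lambda>g. e / 2 + 2 * B * indicator {g. real k < norm g} g)"
        using e B0 by (intro G.integrable_const_bound[where B="e / 2 + 2 * B"]) (auto split: split_indicator)
    qed (use i1 pt in auto)
    also have "\<dots> = e / 2 + 2 * B * G.prob {g. real k < norm g}"
      by (subst Bochner_Integration.integral_add) (auto simp: G.prob_space intro!: G.integrable_const_bound[where B=1] split: split_indicator)
    finally show "\<bar>(\<integral>g. f (x + h *\<^sub>R g) \<partial>std_gaussian) - f x\<bar> \<le> e" using k by linarith
  qed
qed

text \<open>Compact support makes \<open>f\<close> both uniformly continuous, so that smoothing
  moves it uniformly little, and Lebesgue integrable, so that the smoothed integrals converge. Three
  errors of at most \<open>r / 4\<close> add up: smoothing under \<open>\<mu> n\<close>, smoothing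
  under \<open>\<nu>\<close>, and convergence of the smoothed integrals.\<close>

lemma levy_continuity_compact_support:
  fixes \<mu> :: "nat \<Rightarrow> 'a::euclidean_space measure" and f :: "'a \<Rightarrow> real"
  assumes p: "\<And>n. prob_space (\<mu> n)" "prob_space \<nu>"
    and s: "\<And>n. sets (\<mu> n) = sets borel" "sets \<nu> = sets borel"
    and lim: "\<And>u. (\<lambda>n. mchar (\<mu> n) u) \<longlonglongrightarrow> mchar \<nu> u"
    and f: "continuous_on UNIV f" and supp: "\<And>x. norm x \<ge> R \<Longrightarrow> f x = 0"
  shows "(\<lambda>n. \<integral>x. f x \<partial>\<mu> n) \<longlonglongrightarrow> (\<integral>x. f x \<partial>\<nu>)"
proof (rule LIMSEQ_I)
  fix r :: real assume r: "r > 0"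
  have [measurable]: "f \<in> borel_measurable borel" by (intro borel_measurable_continuous_onI f)
  \<comment> \<open>The extra unit of radius is for uniform continuity: two points at distance below
    1 either both lie in this ball or both have norm at least \<open>R\<close>, where
    \<open>f\<close> vanishes.\<close>
  have "compact (f ` cball 0 (\<bar>R\<bar> + 1))"
    by (intro compact_continuous_image continuous_on_subset[OF f]) auto
  then obtain B0 where B0: "\<And>x. x \<in> cball 0 (\<bar>R\<bar> + 1) \<Longrightarrow> \<bar>f x\<bar> \<le> B0"
    using compact_imp_bounded bounded_iff by (metis imageI real_norm_def)
  define B where "B = max B0 0"
  have B: "\<bar>f x\<bar> \<le> B" for x
    using B0[of x] supp[of x] by (cases "norm x \<ge> R") (force simp: B_def)+
  have "uniformly_continuous_on (cball 0 (\<bar>R\<bar> + 1)) f"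
    by (intro compact_uniformly_continuous continuous_on_subset[OF f]) auto
  have uc: "uniformly_continuous_on UNIV f"
    unfolding uniformly_continuous_on_def
  proof (intro allI impI)
    fix e :: real assume "e > 0"
    then obtain d where d: "d > 0"
        "\<And>x y. norm x \<le> \<bar>R\<bar> + 1 \<Longrightarrow> norm y \<le> \<bar>R\<bar> + 1 \<Longrightarrow> dist y x < d \<Longrightarrow> dist (f y) (f x) < e"
      using \<open>uniformly_continuous_on (cball 0 (\<bar>R\<bar> + 1)) f\<close> unfolding uniformly_continuous_on_def by auto
    have "dist (f y) (f x) < e" if xy: "dist y x < min d 1" for x y
    proof (cases "norm x \<le> \<bar>R\<bar> + 1 \<and> norm y \<le> \<bar>R\<bar> + 1")
      case True
      then show ?thesis using d xy by auto
    next
      case False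
      moreover have "\<bar>norm x - norm y\<bar> < 1"
        using norm_triangle_ineq3[of x y] xy by (simp add: dist_norm norm_minus_commute)
      ultimately have "norm x \<ge> R" "norm y \<ge> R" by auto
      then show ?thesis using supp \<open>e > 0\<close> by simp
    qed
    then show "\<exists>d>0. \<forall>x\<in>UNIV. \<forall>x'\<in>UNIV. dist x' x < d \<longrightarrow> dist (f x') (f x) < e"
      using d(1) by (intro exI[of _ "min d 1"]) auto
  qed
  have fint: "integrable lborel f"
  proof (rule Bochner_Integration.integrable_bound)
    show "integrable lborel (\<lambda>x. B * indicator (cball 0 \<bar>R\<bar>) x :: real)"
      using emeasure_lborel_cball_finite[of 0 "\<bar>R\<bar>"] by (intro integrable_mult_right integrable_real_indicator) auto
    show "AE x in lborel. norm (f x) \<le> norm (B * indicator (cball 0 \<bar>R\<bar>) x)"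
      using B supp by (intro AE_I2) (force simp: B_def split: split_indicator)
  qed simp
  obtain h where h: "h > 0" "\<And>x. \<bar>(\<integral>g. f (x + h *\<^sub>R g) \<partial>std_gaussian) - f x\<bar> \<le> r / 4"
    using smoothing_uniform[OF uc B, of "r / 4"] r by auto
  define F where "F x = (\<integral>g. f (x + h *\<^sub>R g) \<partial>std_gaussian)" for x
  have close: "\<bar>(\<integral>x. F x \<partial>\<rho>) - (\<integral>x. f x \<partial>\<rho>)\<bar> \<le> r / 4"
    if "prob_space \<rho>" and [measurable_cong]: "sets \<rho> = sets borel" for \<rho> :: "'a measure"
  proof -
    interpret \<rho>: prob_space \<rho> by fact
    interpret G: prob_space "std_gaussian :: 'a measure" by (rule prob_space_std_gaussian)
    have Fm[measurable]: "F \<in> borel_measurable borel" unfolding F_def by measurable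
    have "\<bar>F x\<bar> \<le> B + r / 4" for x using h(2)[of x] B[of x] unfolding F_def[symmetric] by linarith
    then have "integrable \<rho> F" by (intro \<rho>.integrable_const_bound[where B="B + r / 4"]) auto
    moreover have "integrable \<rho> f" using B by (intro \<rho>.integrable_const_bound[where B=B]) auto
    ultimately have i: "integrable \<rho> (\<lambda>x. F x - f x)"
      and eq: "(\<integral>x. F x \<partial>\<rho>) - (\<integral>x. f x \<partial>\<rho>) = (\<integral>x. F x - f x \<partial>\<rho>)" by auto
    have "\<bar>\<integral>x. F x - f x \<partial>\<rho>\<bar> \<le> (\<integral>x. \<bar>F x - f x\<bar> \<partial>\<rho>)" by (rule integral_abs_bound)
    also have "\<dots> \<le> (\<integral>x. r / 4 \<partial>\<rho>)"
      using i h(2) by (intro integral_mono) (auto simp: F_def)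
    finally show ?thesis unfolding eq by (simp add: \<rho>.prob_space)
  qed
  have "(\<lambda>n. \<integral>x. F x \<partial>\<mu> n) \<longlonglongrightarrow> (\<integral>x. F x \<partial>\<nu>)"
    unfolding F_def by (rule smoothed_integral_tendsto[OF p s lim h(1) fint])
  from LIMSEQ_D[OF this, of "r / 4"] r
  obtain N where N: "\<And>n. n \<ge> N \<Longrightarrow> \<bar>(\<integral>x. F x \<partial>\<mu> n) - (\<integral>x. F x \<partial>\<nu>)\<bar> < r / 4" by auto
  show "\<exists>no. \<forall>n\<ge>no. norm ((\<integral>x. f x \<partial>\<mu> n) - (\<integral>x. f x \<partial>\<nu>)) < r"
  proof (intro exI allI impI)
    fix n assume "N \<le> n"
    then show "norm ((\<integral>x. f x \<partial>\<mu> n) - (\<integral>x. f x \<partial>\<nu>)) < r"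
      using N[of n] close[OF p(1)[of n] s(1)] close[OF p(2) s(2)] unfolding real_norm_def by linarith
  qed
qed

text \<open>Tightness comes for free: a continuous cutoff is itself a compactly supported test
  function, so its integral under \<open>\<mu> n\<close> converges to its integral under
  \<open>\<nu>\<close>, which is close to 1. Hence hardly any mass escapes, and multiplying
  \<open>f\<close> by the cutoff reduces to the compactly supported case.\<close>

theorem levy_continuity_euclidean:
  fixes \<mu> :: "nat \<Rightarrow> 'a::euclidean_space measure" and f :: "'a \<Rightarrow> real"
  assumes p: "\<And>n. prob_space (\<mu> n)" "prob_space \<nu>"
    and s: "\<And>n. sets (\<mu> n) = sets borel" "sets \<nu> = sets borel"
    and lim: "\<And>u. (\<lambda>n. mchar (\<mu> n) u) \<longlonglongrightarrow> mchar \<nu> u"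
    and f: "continuous_on UNIV f" and bdd: "bounded (range f)"
  shows "(\<lambda>n. \<integral>x. f x \<partial>\<mu> n) \<longlonglongrightarrow> (\<integral>x. f x \<partial>\<nu>)"
proof (rule LIMSEQ_I)
  fix r :: real assume r: "r > 0"
  interpret \<nu>: prob_space \<nu> by fact
  note [measurable_cong] = s
  have [measurable]: "f \<in> borel_measurable borel" by (intro borel_measurable_continuous_onI f)
  obtain B where B: "B > 0" "\<And>x. \<bar>f x\<bar> \<le> B"
    using bdd unfolding bounded_pos by auto
  \<comment> \<open>Piecewise linear cutoff: 1 on the ball of radius \<open>k\<close>, 0 outside the
    ball of radius \<open>k + 1\<close>.\<close>
  define X where "X k x = max 0 (min 1 (real k + 1 - norm x))" for k and x :: 'a
  have X: "0 \<le> X k x" "X k x \<le> 1" for k x by (auto simp: X_def)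
  have Xc: "continuous_on UNIV (X k)" for k unfolding X_def by (intro continuous_intros)
  have [measurable]: "X k \<in> borel_measurable borel" for k by (intro borel_measurable_continuous_onI Xc)
  have "(\<lambda>k. \<integral>x. X k x \<partial>\<nu>) \<longlonglongrightarrow> (\<integral>x. 1 \<partial>\<nu>)"
  proof (rule integral_dominated_convergence[where w="\<lambda>_. 1"])
    show "AE x in \<nu>. (\<lambda>k. X k x) \<longlonglongrightarrow> 1"
    proof (rule AE_I2, rule tendsto_eventually)
      fix x :: 'a
      obtain k0 where "norm x \<le> real k0" using real_arch_simple by blast
      then show "\<forall>\<^sub>F k in sequentially. X k x = 1"
        by (intro eventually_sequentiallyI[of k0]) (auto simp: X_def)
    qed
  qed (use X in auto)
  \<comment> \<open>With this mass the cutoff error, at most \<open>B\<close> times the missing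
    mass, is below \<open>r / 8\<close> under each measure.\<close>
  then have "\<forall>\<^sub>F k in sequentially. (\<integral>x. X k x \<partial>\<nu>) > 1 - r / (8 * B)"
    using r B by (intro order_tendstoD) (auto simp: \<nu>.prob_space)
  then obtain k where k: "(\<integral>x. X k x \<partial>\<nu>) > 1 - r / (8 * B)"
    by (meson eventually_sequentially order_refl)
  have cut: "\<bar>(\<integral>x. f x \<partial>\<rho>) - (\<integral>x. f x * X k x \<partial>\<rho>)\<bar> \<le> B * (1 - (\<integral>x. X k x \<partial>\<rho>))"
    if "prob_space \<rho>" and [measurable_cong]: "sets \<rho> = sets borel" for \<rho> :: "'a measure"
  proof -
    interpret \<rho>: prob_space \<rho> by fact
    have i: "integrable \<rho> f" using B by (intro \<rho>.integrable_const_bound[where B=B]) auto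
    have i': "integrable \<rho> (X k)" using X by (intro \<rho>.integrable_const_bound[where B=1]) auto
    have bb: "\<bar>f x * X k x\<bar> \<le> B" for x
      using B(2)[of x] X[of k x] mult_mono[of "\<bar>f x\<bar>" B "X k x" 1] B(1) by (simp add: abs_mult)
    have j: "integrable \<rho> (\<lambda>x. f x * X k x)"
      using bb by (intro \<rho>.integrable_const_bound[where B=B]) auto
    have "\<bar>(\<integral>x. f x \<partial>\<rho>) - (\<integral>x. f x * X k x \<partial>\<rho>)\<bar> = \<bar>\<integral>x. f x - f x * X k x \<partial>\<rho>\<bar>"
      using i j by simp
    also have "\<dots> \<le> (\<integral>x. \<bar>f x - f x * X k x\<bar> \<partial>\<rho>)" by (rule integral_abs_bound)
    also have "\<dots> \<le> (\<integral>x. B * (1 - X k x) \<partial>\<rho>)"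
    proof (rule integral_mono)
      fix x
      have "\<bar>f x - f x * X k x\<bar> = \<bar>f x\<bar> * (1 - X k x)"
        using X[of k x] abs_mult[of "f x" "1 - X k x"] by (simp add: right_diff_distrib)
      then show "\<bar>f x - f x * X k x\<bar> \<le> B * (1 - X k x)"
        using B X by (simp add: mult_right_mono)
    qed (use i i' j in auto)
    also have "\<dots> = B * (1 - (\<integral>x. X k x \<partial>\<rho>))" using i' by (simp add: \<rho>.prob_space)
    finally show ?thesis .
  qed
  have cs: "X k x = 0" if "norm x \<ge> real k + 1" for x using that by (auto simp: X_def)
  have "(\<lambda>n. \<integral>x. f x * X k x \<partial>\<mu> n) \<longlonglongrightarrow> (\<integral>x. f x * X k x \<partial>\<nu>)"
    by (rule levy_continuity_compact_support[OF p s lim, where R="real k + 1"])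
       (auto intro!: continuous_intros f Xc cs)
  from LIMSEQ_D[OF this, of "r / 4"] r
  obtain N where N: "\<And>n. n \<ge> N \<Longrightarrow> \<bar>(\<integral>x. f x * X k x \<partial>\<mu> n) - (\<integral>x. f x * X k x \<partial>\<nu>)\<bar> < r / 4" by auto
  have "(\<lambda>n. \<integral>x. X k x \<partial>\<mu> n) \<longlonglongrightarrow> (\<integral>x. X k x \<partial>\<nu>)"
    by (rule levy_continuity_compact_support[OF p s lim, where R="real k + 1"]) (auto intro!: Xc cs)
  then have "\<forall>\<^sub>F n in sequentially. (\<integral>x. X k x \<partial>\<mu> n) > 1 - r / (8 * B)"
    using k by (rule order_tendstoD)
  then obtain N' where N': "\<And>n. n \<ge> N' \<Longrightarrow> (\<integral>x. X k x \<partial>\<mu> n) > 1 - r / (8 * B)"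
    unfolding eventually_sequentially by auto
  have small: "B * (1 - t) < r / 8" if "t > 1 - r / (8 * B)" for t
  proof -
    have "1 - t < r / 8 / B" using that by simp
    then show ?thesis using B(1) by (subst (asm) pos_less_divide_eq) (auto simp: mult.commute)
  qed
  show "\<exists>no. \<forall>n\<ge>no. norm ((\<integral>x. f x \<partial>\<mu> n) - (\<integral>x. f x \<partial>\<nu>)) < r"
  proof (intro exI allI impI)
    fix n assume n: "max N N' \<le> n"
    have "B * (1 - (\<integral>x. X k x \<partial>\<mu> n)) < r / 8" "B * (1 - (\<integral>x. X k x \<partial>\<nu>)) < r / 8"
      using n small[OF N'[of n]] small[OF k] by auto
    then show "norm ((\<integral>x. f x \<partial>\<mu> n) - (\<integral>x. f x \<partial>\<nu>)) < r"
      using n N[of n] cut[OF p(1)[of n] s(1)] cut[OF p(2) s(2)] r unfolding real_norm_def by linarith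
  qed
qed

subsection \<open>Multivariate normal distributions\<close>

lemma matrix_inv_right: "invertible A \<Longrightarrow> A ** matrix_inv A = mat 1"
  and matrix_inv_left: "invertible A \<Longrightarrow> matrix_inv A ** A = mat 1"
  unfolding invertible_def matrix_inv_def by (metis (mono_tags, lifting) someI_ex)+

lemma matrix_vector_mult_measurable: "(*v) (A :: real^'n^'m) \<in> borel_measurable borel"
  by (intro borel_measurable_continuous_onI linear_continuous_on matrix_vector_mul_bounded_linear)

lemma inner_matrix_left:
  fixes B :: "real^'n^'m"
  shows "(B *v x) \<bullet> y = x \<bullet> (transpose B *v y)"
  by (metis dot_lmul_matrix inner_commute transpose_matrix_vector)

lemma inner_matrix_sym:
  fixes V :: "real^'d^'d"
  assumes "transpose V = V"
  shows "x \<bullet> (V *v y) = y \<bullet> (V *v x)"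
  by (metis assms dot_lmul_matrix inner_commute transpose_matrix_vector)

text \<open>Gram-Schmidt for the inner product \<open>x \<bullet> (V *v y)\<close>. The induction
  runs over the index set \<open>J\<close>: as long as \<open>J\<close> is not everything, the
  vectors found so far are too few to span the space, and a new direction exists.\<close>

lemma pos_def_orthonormal_family:
  fixes V :: "real^'d^'d" and J :: "'d set"
  assumes V: "pos_def_matrix V"
  shows "\<exists>f :: 'd \<Rightarrow> real^'d. \<forall>i\<in>J. \<forall>j\<in>J. f i \<bullet> (V *v f j) = (if i = j then 1 else 0)"
  using finite[of J]
proof (induction J rule: finite_induct)
  case empty
  then show ?case by simp
next
  case (insert k J)
  then obtain f :: "'d \<Rightarrow> real^'d" where f: "\<And>i j. i \<in> J \<Longrightarrow> j \<in> J \<Longrightarrow> f i \<bullet> (V *v f j) = (if i = j then 1 else 0)"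
    by auto
  have sym: "x \<bullet> (V *v y) = y \<bullet> (V *v x)" for x y
    using V by (intro inner_matrix_sym) (simp add: pos_def_matrix_def)
  have "card J < CARD('d)" using insert by (metis finite_code UNIV_I psubsetI psubset_card_mono subset_UNIV)
  then have "dim (f ` J) < DIM(real^'d)"
    using dim_le_card'[of "f ` J"] card_image_le[of J f] by simp
  then obtain x where x: "x \<notin> span (f ` J)" using dim_eq_full[of "f ` J"] by auto
  \<comment> \<open>The new vector minus its projection, with respect to \<open>V\<close>, onto the
    earlier ones; it is nonzero because \<open>x\<close> lies outside their span.\<close>
  define y where "y = x - (\<Sum>i\<in>J. (f i \<bullet> (V *v x)) *\<^sub>R f i)"
  have "y \<noteq> 0"
  proof
    assume "y = 0"
    then have "x = (\<Sum>i\<in>J. (f i \<bullet> (V *v x)) *\<^sub>R f i)" by (simp add: y_def)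
    also have "\<dots> \<in> span (f ` J)" by (intro span_sum span_scale span_base) auto
    finally show False using x by simp
  qed
  then have pos: "y \<bullet> (V *v y) > 0" using V by (simp add: pos_def_matrix_def)
  have orth: "f j \<bullet> (V *v y) = 0" if "j \<in> J" for j
  proof -
    have "f j \<bullet> (V *v y) = f j \<bullet> (V *v x) - (\<Sum>i\<in>J. (f i \<bullet> (V *v x)) * (f j \<bullet> (V *v f i)))"
      by (simp add: y_def matrix_vector_mult_diff_distrib matrix_vector_right_distrib
          inner_diff_right inner_sum_right linear_sum[OF matrix_vector_mul_linear] o_def matrix_vector_mult_scaleR)
    also have "(\<Sum>i\<in>J. (f i \<bullet> (V *v x)) * (f j \<bullet> (V *v f i))) = (\<Sum>i\<in>J. if i = j then f i \<bullet> (V *v x) else 0)"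
      using f that by (intro sum.cong) auto
    finally show ?thesis using that by simp
  qed
  define z where "z = (1 / sqrt (y \<bullet> (V *v y))) *\<^sub>R y"
  have z1: "z \<bullet> (V *v z) = 1"
    using pos by (simp add: z_def matrix_vector_mult_scaleR field_simps)
  have z0: "f j \<bullet> (V *v z) = 0" "z \<bullet> (V *v f j) = 0" if "j \<in> J" for j
    using orth[OF that] sym[of y "f j"] by (auto simp: z_def matrix_vector_mult_scaleR)
  show ?case
    using insert f z0 z1 by (intro exI[of _ "f(k := z)"]) auto
qed

text \<open>If the columns of \<open>P\<close> are orthonormal for \<open>V\<close>, then
  \<open>transpose P ** V ** P\<close> is the identity, and solving for \<open>V\<close> gives the
  factor \<open>B\<close> as the transposed inverse of \<open>P\<close>.\<close>

lemma pos_def_matrix_factor: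
  fixes V :: "real^'d^'d"
  assumes V: "pos_def_matrix V"
  obtains B :: "real^'d^'d" where "invertible B" "V = B ** transpose B"
proof -
  obtain f :: "'d \<Rightarrow> real^'d" where f: "\<And>i j. f i \<bullet> (V *v f j) = (if i = j then 1 else 0)"
    using pos_def_orthonormal_family[OF V, of UNIV] by auto
  define P where "P = transpose (\<chi> i. f i)"
  have P: "transpose P ** V ** P = mat 1"
  proof -
    have "(transpose P ** (V ** P)) $ i $ j = f i \<bullet> (V *v f j)" for i j
      by (simp add: P_def matrix_matrix_mult_def matrix_vector_mult_def transpose_def inner_vec_def)
    then show ?thesis by (simp add: f vec_eq_iff mat_def flip: matrix_mul_assoc)
  qed
  then have iP: "invertible P"
    using invertible_left_inverse by blast
  define Q where "Q = matrix_inv P"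
  have PQ: "P ** Q = mat 1" "Q ** P = mat 1"
    using iP by (simp_all add: Q_def matrix_inv_left matrix_inv_right)
  have tQP: "transpose Q ** transpose P = mat 1"
    by (simp add: PQ transpose_mat flip: matrix_transpose_mul)
  have "V = (transpose Q ** transpose P) ** V ** (P ** Q)" by (simp add: PQ tQP)
  also have "\<dots> = transpose Q ** (transpose P ** V ** P) ** Q" by (simp add: matrix_mul_assoc)
  finally have "V = transpose Q ** transpose (transpose Q)" by (simp add: P)
  moreover have "invertible (transpose Q)"
    using tQP invertible_def invertible_right_inverse by blast
  ultimately show thesis using that by blast
qed

lemma pos_def_matrix_invertible: "pos_def_matrix V \<Longrightarrow> invertible V"
  using pos_def_matrix_factor[of V] by (metis invertible_mult transpose_invertible)

text \<open>The substitution \<open>x = V *v y\<close> turns the quadratic form of the inverse into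
  that of \<open>V\<close>.\<close>

lemma pos_def_matrix_inv:
  assumes V: "pos_def_matrix V"
  shows "pos_def_matrix (matrix_inv V)"
proof -
  have i: "matrix_inv V ** V = mat 1" "V ** matrix_inv V = mat 1"
    using pos_def_matrix_invertible[OF V] by (simp_all add: matrix_inv_left matrix_inv_right)
  have t: "transpose (matrix_inv V) ** V = mat 1"
    using V i(2) matrix_transpose_mul[of V "matrix_inv V"] by (simp add: pos_def_matrix_def transpose_mat)
  have sym: "transpose (matrix_inv V) = matrix_inv V"
    by (metis i(2) t matrix_mul_assoc matrix_mul_lid matrix_mul_rid)
  show ?thesis
    unfolding pos_def_matrix_def
  proof (intro conjI allI impI sym)
    fix x :: "real^'a" assume "x \<noteq> 0"
    define y where "y = matrix_inv V *v x"
    have x: "x = V *v y" by (simp add: y_def matrix_vector_mul_assoc i)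
    then have "y \<noteq> 0" using \<open>x \<noteq> 0\<close> by auto
    then have "0 < y \<bullet> (V *v y)" using V by (simp add: pos_def_matrix_def)
    then show "0 < x \<bullet> (matrix_inv V *v x)" by (simp add: inner_commute flip: x y_def)
  qed
qed

lemma pos_def_matrix_scaleR: "pos_def_matrix V \<Longrightarrow> v > 0 \<Longrightarrow> pos_def_matrix (v *\<^sub>R V)"
  by (simp add: pos_def_matrix_def transpose_scalar scaleR_matrix_vector_assoc[symmetric])

section \<open>Linear images of Lebesgue measure\<close>

text \<open>The library's \<open>measure_linear_image\<close> is restricted to well-ordered index types.\<close>

lemma lmeasurable_matrix_image:
  fixes A :: "real^'d^'d"
  assumes "S \<in> lmeasurable"
  shows "(*v) A ` S \<in> lmeasurable \<and> measure lebesgue ((*v) A ` S) = \<bar>det A\<bar> * measure lebesgue S"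
proof -
  have "\<forall>S\<in>lmeasurable. (*v) A ` S \<in> lmeasurable \<and> measure lebesgue ((*v) A ` S) = \<bar>det A\<bar> * measure lebesgue S"
  proof (induction A rule: induct_matrix_elementary_alt; intro ballI)
    fix A B :: "real^'d^'d" and S :: "(real^'d) set"
    assume "\<forall>S\<in>lmeasurable. (*v) A ` S \<in> lmeasurable \<and> measure lebesgue ((*v) A ` S) = \<bar>det A\<bar> * measure lebesgue S"
      and "\<forall>S\<in>lmeasurable. (*v) B ` S \<in> lmeasurable \<and> measure lebesgue ((*v) B ` S) = \<bar>det B\<bar> * measure lebesgue S"
      and "S \<in> lmeasurable"
    moreover have "(*v) (A ** B) ` S = (*v) A ` (*v) B ` S"
      by (simp add: image_image matrix_vector_mul_assoc)
    ultimately show "(*v) (A ** B) ` S \<in> lmeasurable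
        \<and> measure lebesgue ((*v) (A ** B) ` S) = \<bar>det (A ** B)\<bar> * measure lebesgue S"
      by (simp add: det_mul abs_mult)
  next
    fix A :: "real^'d^'d" and i and S :: "(real^'d) set"
    assume "row i A = 0"
    then have d: "det A = 0" using det_zero_row(2) by blast
    then have "\<not> inj ((*v) A)" using det_nz_iff_inj[OF matrix_vector_mul_linear[of A]] by (simp add: matrix_of_matrix_vector_mul)
    then have "negligible ((*v) A ` S)"
      by (intro negligible_linear_singular_image matrix_vector_mul_linear)
    then show "(*v) A ` S \<in> lmeasurable \<and> measure lebesgue ((*v) A ` S) = \<bar>det A\<bar> * measure lebesgue S"
      by (simp add: d negligible_imp_measurable negligible_imp_measure0)
  next
    fix A :: "real^'d^'d" and S :: "(real^'d) set"
    assume A: "\<And>i j. i \<noteq> j \<Longrightarrow> A $ i $ j = 0" and S: "S \<in> lmeasurable"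
    have "(*v) A = (\<lambda>x. \<chi> k. A $ k $ k * x $ k)"
    proof (intro ext, subst vec_eq_iff, intro allI)
      fix x k
      have "(A *v x) $ k = (\<Sum>j\<in>UNIV. if j = k then A $ k $ k * x $ k else 0)"
        unfolding matrix_vector_mult_def vec_lambda_beta using A by (intro sum.cong) auto
      then show "(A *v x) $ k = (\<chi> k. A $ k $ k * x $ k) $ k" by simp
    qed
    then show "(*v) A ` S \<in> lmeasurable \<and> measure lebesgue ((*v) A ` S) = \<bar>det A\<bar> * measure lebesgue S"
      using measurable_stretch[OF S] measure_stretch[OF S] det_diagonal[of A] A by simp
  next
    fix m n :: 'd and S :: "(real^'d) set"
    assume mn: "m \<noteq> n" and S: "S \<in> lmeasurable"
    let ?t = "Transposition.transpose m n"
    let ?A = "(\<chi> i j. mat 1 $ i $ ?t j) :: real^'d^'d"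
    have h: "(*v) ?A = (\<lambda>x. \<chi> i. x $ ?t i)"
    proof (intro ext, subst vec_eq_iff, intro allI)
      fix x :: "real^'d" and k
      have "(?A *v x) $ k = (\<Sum>j\<in>UNIV. if j = ?t k then x $ j else 0)"
        unfolding matrix_vector_mult_def vec_lambda_beta mat_def by (intro sum.cong) auto
      then show "(?A *v x) $ k = (\<chi> i. x $ ?t i) $ k" by simp
    qed
    have "measure lebesgue ((*v) ?A ` cbox a b) = 1 * measure lebesgue (cbox a b)" for a b
    proof -
      have im: "(*v) ?A ` cbox a b = cbox (\<chi> i. a $ ?t i) (\<chi> i. b $ ?t i)"
      proof (intro set_eqI iffI)
        fix y assume "y \<in> cbox (\<chi> i. a $ ?t i) (\<chi> i. b $ ?t i)"
        then have "(\<chi> i. y $ ?t i) \<in> cbox a b" by (simp add: mem_box_cart) (metis transpose_involutory)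
        then show "y \<in> (*v) ?A ` cbox a b" unfolding h by (rule rev_image_eqI) (simp add: vec_eq_iff)
      qed (auto simp: h mem_box_cart)
      have "cbox (\<chi> i. a $ ?t i) (\<chi> i. b $ ?t i) = {} \<longleftrightarrow> cbox a b = {}"
        by (metis im image_is_empty)
      moreover have "(\<Prod>i\<in>UNIV. b $ ?t i - a $ ?t i) = (\<Prod>i\<in>UNIV. b $ i - a $ i)"
        using prod.permute[OF permutes_swap_id[of m UNIV n], of "\<lambda>i. b $ i - a $ i"] by (simp add: o_def)
      ultimately show ?thesis
        by (simp add: im content_cbox_if_cart)
    qed
    moreover have "\<bar>det ?A\<bar> = 1"
      using det_permute_columns[of ?t "mat 1 :: real^'d^'d"] mn
      by (simp add: permutes_swap_id sign_swap_id)
    ultimately show "(*v) ?A ` S \<in> lmeasurable \<and> measure lebesgue ((*v) ?A ` S) = \<bar>det ?A\<bar> * measure lebesgue S"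
      using measure_linear_sufficient[OF matrix_vector_mul_linear S, of ?A 1] by simp
  next
    fix m n :: 'd and S :: "(real^'d) set"
    assume mn: "m \<noteq> n" and S: "S \<in> lmeasurable"
    let ?A = "(\<chi> i j. of_bool (i = m \<and> j = n \<or> i = j)) :: real^'d^'d"
    have h: "(*v) ?A = (\<lambda>x. \<chi> i. if i = m then x $ m + x $ n else x $ i)"
    proof (intro ext, subst vec_eq_iff, intro allI)
      fix x :: "real^'d" and k
      have "(?A *v x) $ k = (\<Sum>j\<in>UNIV. (if j = k then x $ k else 0) + (if j = n then if k = m then x $ n else 0 else 0))"
        unfolding matrix_vector_mult_def vec_lambda_beta using mn by (intro sum.cong) auto
      then show "(?A *v x) $ k = (\<chi> i. if i = m then x $ m + x $ n else x $ i) $ k"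
        by (simp add: sum.distrib)
    qed
    have "measure lebesgue ((*v) ?A ` cbox a b) = 1 * measure lebesgue (cbox a b)" for a b
    proof (cases "cbox a b = {}")
      case False
      \<comment> \<open>Translation by \<open>t\<close> puts the lower face of the box in direction
        \<open>n\<close> at 0, since \<open>measure_shear_interval\<close> asks for a nonnegative
        lower bound in that coordinate.\<close>
      define t :: "real^'d" where "t = axis n (- a $ n)"
      have "(*v) ?A ` cbox a b = (+) (?A *v (- t)) ` (*v) ?A ` cbox (t + a) (t + b)"
        unfolding cbox_translation by (simp add: image_image flip: matrix_vector_right_distrib)
      then have "measure lebesgue ((*v) ?A ` cbox a b) = measure lebesgue ((*v) ?A ` cbox (t + a) (t + b))"
        by (simp add: measure_translation)
      also have "\<dots> = measure lebesgue (cbox (t + a) (t + b))"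
        unfolding h using mn False
        by (intro measure_shear_interval) (auto simp: cbox_translation t_def)
      also have "\<dots> = measure lebesgue (cbox a b)"
        unfolding cbox_translation by (rule measure_translation)
      finally show ?thesis by simp
    qed simp
    moreover have "det ?A = 1"
    proof -
      have "?A = (\<chi> k. if k = m then row m (mat 1) + 1 *s row n (mat 1) else row k (mat 1))"
        using mn by (auto simp: vec_eq_iff row_def mat_def)
      then show ?thesis using det_row_operation[OF mn, of "mat 1" 1] by simp
    qed
    ultimately show "(*v) ?A ` S \<in> lmeasurable \<and> measure lebesgue ((*v) ?A ` S) = \<bar>det ?A\<bar> * measure lebesgue S"
      using measure_linear_sufficient[OF matrix_vector_mul_linear S, of ?A 1] by simp
  qed
  then show ?thesis using assms by blast
qed

text \<open>Boxes determine \<open>lborel\<close>. The preimage of a box under \<open>A\<close> is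
  its image under the inverse, whose volume carries the factor \<open>\<bar>det A'\<bar>\<close>;
  the density cancels it.\<close>

lemma lborel_linear_image:
  fixes A :: "real^'d^'d"
  assumes "invertible A"
  shows "lborel = density (distr lborel borel ((*v) A)) (\<lambda>_. ennreal \<bar>det A\<bar>)"
proof (rule lborel_eqI)
  fix l u :: "real^'d" assume le: "\<And>b. b \<in> Basis \<Longrightarrow> l \<bullet> b \<le> u \<bullet> b"
  define A' where "A' = matrix_inv A"
  have AA: "A ** A' = mat 1" "A' ** A = mat 1"
    using assms by (simp_all add: A'_def matrix_inv_left matrix_inv_right)
  have [measurable]: "(*v) A \<in> borel_measurable borel"
    by (rule matrix_vector_mult_measurable)
  have pre: "(*v) A -` box l u = (*v) A' ` box l u"
  proof (intro set_eqI iffI)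
    fix x assume "x \<in> (*v) A -` box l u"
    then show "x \<in> (*v) A' ` box l u"
      by (intro image_eqI[of _ _ "A *v x"]) (auto simp: matrix_vector_mul_assoc AA)
  qed (auto simp: matrix_vector_mul_assoc AA)
  have lm: "box l u \<in> lmeasurable" by simp
  have lm': "(*v) A' ` box l u \<in> lmeasurable"
    using lmeasurable_matrix_image[OF lm] by blast
  have bs: "(*v) A -` box l u \<in> sets borel" using measurable_sets_borel[of "(*v) A" borel "box l u"] by simp
  have "emeasure lborel ((*v) A -` box l u) = emeasure lebesgue ((*v) A' ` box l u)"
    using bs by (simp add: pre)
  also have "\<dots> = ennreal (measure lebesgue ((*v) A' ` box l u))"
    using lm' by (simp add: emeasure_eq_measure2)
  also have "measure lebesgue ((*v) A' ` box l u) = \<bar>det A'\<bar> * (\<Prod>b\<in>Basis. (u - l) \<bullet> b)"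
    using le lmeasurable_matrix_image[OF lm, of A'] by (auto simp: measure_lborel_box_eq)
  finally have "emeasure lborel ((*v) A -` box l u) = ennreal (\<bar>det A'\<bar> * (\<Prod>b\<in>Basis. (u - l) \<bullet> b))" .
  moreover have "\<bar>det A\<bar> * \<bar>det A'\<bar> = 1"
    using det_mul[of A A'] AA by (simp flip: abs_mult)
  ultimately show "emeasure (density (distr lborel borel ((*v) A)) (\<lambda>_. ennreal \<bar>det A\<bar>)) (box l u) = ennreal (\<Prod>b\<in>Basis. (u - l) \<bullet> b)"
    using bs by (simp add: emeasure_density_const emeasure_distr ennreal_mult'[symmetric] flip: mult.assoc)
qed simp

text \<open>Under the substitution \<open>x = B *v g\<close> the exponent becomes
  \<open>(norm g)\<^sup>2\<close> because \<open>transpose B ** matrix_inv V ** B\<close> is the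
  identity, and the Jacobian \<open>\<bar>det B\<bar>\<close> is the square root of
  \<open>det V\<close> in the normalising constant.\<close>

lemma multivariate_normal_eq_distr:
  fixes V B :: "real^'d^'d"
  assumes B: "invertible B" "V = B ** transpose B"
  shows "multivariate_normal 0 V = distr std_gaussian borel ((*v) B)"
proof -
  define p :: "real^'d \<Rightarrow> real" where
    "p x = exp (- (x \<bullet> (matrix_inv V *v x)) / 2) / sqrt ((2 * pi) ^ CARD('d) * det V)" for x
  have Tm[measurable]: "(*v) B \<in> borel_measurable borel"
    by (rule matrix_vector_mult_measurable)
  have pm[measurable]: "p \<in> borel_measurable borel"
  proof -
    have [measurable]: "(*v) (matrix_inv V) \<in> borel_measurable borel"
      by (rule matrix_vector_mult_measurable)
    show ?thesis unfolding p_def by measurable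
  qed
  define B' where "B' = matrix_inv B"
  have BB: "B ** B' = mat 1" "B' ** B = mat 1"
    using B(1) by (simp_all add: B'_def matrix_inv_left matrix_inv_right)
  have V: "invertible V" using B by (metis invertible_mult transpose_invertible)
  have "transpose B ** matrix_inv V ** B = mat 1"
  proof -
    have "B ** (transpose B ** matrix_inv V) = mat 1"
      using V by (simp add: matrix_mul_assoc matrix_inv_right flip: B(2))
    then have "(transpose B ** matrix_inv V) ** B = mat 1"
      using matrix_left_right_inverse by blast
    then show ?thesis .
  qed
  then have quad: "(B *v x) \<bullet> (matrix_inv V *v (B *v x)) = (norm x)\<^sup>2" for x
    unfolding inner_matrix_left by (simp add: power2_norm_eq_inner matrix_vector_mul_assoc matrix_mul_assoc)
  have det: "det V = (det B)\<^sup>2" "det B \<noteq> 0"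
    using B invertible_det_nz by (auto simp: det_mul power2_eq_square)
  have dens: "\<bar>det B\<bar> * p (B *v x) = exp (- (norm x)\<^sup>2 / 2) / sqrt ((2 * pi) ^ DIM(real^'d))" for x
    using det by (simp add: p_def quad real_sqrt_mult)
  have "multivariate_normal 0 V = density lborel (\<lambda>x. ennreal (p x))"
    by (simp add: multivariate_normal_def p_def)
  also have "\<dots> = density (density (distr lborel borel ((*v) B)) (\<lambda>_. ennreal \<bar>det B\<bar>)) (\<lambda>x. ennreal (p x))"
    using lborel_linear_image[OF B(1)] by simp
  also have "\<dots> = density (distr lborel borel ((*v) B)) (\<lambda>x. ennreal (\<bar>det B\<bar> * p x))"
    by (subst density_density_eq) (auto simp: ennreal_mult')
  also have "\<dots> = distr (density lborel (\<lambda>x. ennreal (\<bar>det B\<bar> * p (B *v x)))) borel ((*v) B)"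
    by (subst density_distr) auto
  also have "\<dots> = distr std_gaussian borel ((*v) B)"
    unfolding dens std_gaussian_def ..
  finally show ?thesis .
qed

lemma multivariate_normal_mchar:
  fixes V :: "real^'d^'d"
  assumes V: "pos_def_matrix V"
  shows "prob_space (multivariate_normal 0 V)"
    and "mchar (multivariate_normal 0 V) u = exp (- (u \<bullet> (V *v u)) / 2)"
proof -
  obtain B :: "real^'d^'d" where B: "invertible B" "V = B ** transpose B" using pos_def_matrix_factor[OF V] by auto
  have Tm[measurable]: "(*v) B \<in> borel_measurable borel"
    by (rule matrix_vector_mult_measurable)
  interpret G: prob_space "std_gaussian :: (real^'d) measure" by (rule prob_space_std_gaussian)
  show "prob_space (multivariate_normal 0 V)"
    unfolding multivariate_normal_eq_distr[OF B] by (rule G.prob_space_distr) (use Tm in simp)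
  have "mchar (multivariate_normal 0 V) u = mchar std_gaussian (transpose B *v u)"
    unfolding multivariate_normal_eq_distr[OF B] mchar_def
    by (subst integral_distr) (auto simp: dot_lmul_matrix transpose_matrix_vector)
  also have "\<dots> = exp (- (norm (transpose B *v u))\<^sup>2 / 2)" by (rule mchar_std_gaussian)
  also have "(norm (transpose B *v u))\<^sup>2 = u \<bullet> (V *v u)"
    by (simp add: B(2) power2_norm_eq_inner dot_lmul_matrix transpose_matrix_vector flip: matrix_vector_mul_assoc)
  finally show "mchar (multivariate_normal 0 V) u = exp (- (u \<bullet> (V *v u)) / 2)" by simp
qed

lemma sets_multivariate_normal [simp]: "sets (multivariate_normal m V) = sets borel"
  by (simp add: multivariate_normal_def)

subsection \<open>Independent sums\<close>

text \<open>A finite intersection of conditions on the \<open>X j\<close> is a cylinder event of the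
  whole family, likewise for the \<open>Y j\<close>. Independence of the two families separates the
  two events, and independence inside each family factorises them.\<close>

lemma (in prob_space) indep_families_rectangle:
  fixes X :: "'i \<Rightarrow> 'a \<Rightarrow> 'c::second_countable_topology" and Y :: "'i \<Rightarrow> 'a \<Rightarrow> 'e::second_countable_topology"
  assumes X: "indep_vars (\<lambda>_. borel) X I" and Y: "indep_vars (\<lambda>_. borel) Y I"
    and XY: "indep_families M I X Y"
    and J: "J \<subseteq> I" "J \<noteq> {}" "finite J"
    and A: "\<And>j. j \<in> J \<Longrightarrow> A j \<in> sets borel" and B: "\<And>j. j \<in> J \<Longrightarrow> B j \<in> sets borel"
  shows "prob (\<Inter>j\<in>J. X j -` A j \<inter> Y j -` B j \<inter> space M)
       = (\<Prod>j\<in>J. prob (X j -` A j \<inter> space M) * prob (Y j -` B j \<inter> space M))"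
proof -
  have event: "(\<Inter>j\<in>J. V j -` C j \<inter> space M)
      \<in> {(\<lambda>\<omega>. \<lambda>i\<in>I. V i \<omega>) -` D \<inter> space M | D. D \<in> sets (PiM I (\<lambda>_. borel))}"
    if C: "\<And>j. j \<in> J \<Longrightarrow> C j \<in> sets borel" for V :: "'i \<Rightarrow> 'a \<Rightarrow> 'z::second_countable_topology" and C
  proof -
    have "prod_emb I (\<lambda>_. borel) J (Pi\<^sub>E J C) \<in> sets (PiM I (\<lambda>_. borel))"
      using J C by (intro sets_PiM_I) auto
    moreover have "(\<Inter>j\<in>J. V j -` C j \<inter> space M) = (\<lambda>\<omega>. \<lambda>i\<in>I. V i \<omega>) -` prod_emb I (\<lambda>_. borel) J (Pi\<^sub>E J C) \<inter> space M"
      using J by (auto simp: prod_emb_def PiE_iff subset_eq)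
    ultimately show ?thesis by blast
  qed
  have "(\<Inter>j\<in>J. X j -` A j \<inter> Y j -` B j \<inter> space M)
      = (\<Inter>j\<in>J. X j -` A j \<inter> space M) \<inter> (\<Inter>j\<in>J. Y j -` B j \<inter> space M)"
    using J by auto
  also have "prob \<dots> = prob (\<Inter>j\<in>J. X j -` A j \<inter> space M) * prob (\<Inter>j\<in>J. Y j -` B j \<inter> space M)"
    using XY unfolding indep_families_def by (rule indep_setD) (intro event A B; assumption)+
  also have "prob (\<Inter>j\<in>J. X j -` A j \<inter> space M) = (\<Prod>j\<in>J. prob (X j -` A j \<inter> space M))"
    using X J A unfolding indep_vars_def2 by (intro indep_setsD[where F="\<lambda>i. {X i -` A \<inter> space M |A. A \<in> sets borel}" and I=I]) auto
  also have "prob (\<Inter>j\<in>J. Y j -` B j \<inter> space M) = (\<Prod>j\<in>J. prob (Y j -` B j \<inter> space M))"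
    using Y J B unfolding indep_vars_def2 by (intro indep_setsD[where F="\<lambda>i. {Y i -` A \<inter> space M |A. A \<in> sets borel}" and I=I]) auto
  finally show ?thesis by (simp add: prod.distrib)
qed

text \<open>The score depends on design and error of the same observation jointly, so independence
  is needed for the pairs. Rectangle events form an intersection-stable generator of the
  sigma-algebra of each pair, and on rectangles the product formula is already known.\<close>

lemma (in prob_space) indep_vars_Pair:
  fixes X :: "'i \<Rightarrow> 'a \<Rightarrow> 'c::second_countable_topology" and Y :: "'i \<Rightarrow> 'a \<Rightarrow> 'e::second_countable_topology"
  assumes X: "indep_vars (\<lambda>_. borel) X I" and Y: "indep_vars (\<lambda>_. borel) Y I"
    and XY: "indep_families M I X Y"
  shows "indep_vars (\<lambda>_. borel \<Otimes>\<^sub>M borel) (\<lambda>i \<omega>. (X i \<omega>, Y i \<omega>)) I"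
proof -
  have [measurable]: "X i \<in> borel_measurable M" "Y i \<in> borel_measurable M" if "i \<in> I" for i
    using X Y that by (auto simp: indep_vars_def2)
  define E where "E i = {X i -` A \<inter> Y i -` B \<inter> space M | A B. A \<in> sets borel \<and> B \<in> sets borel}" for i
  have "indep_sets E I"
  proof (rule indep_setsI)
    fix i assume i: "i \<in> I"
    show "E i \<subseteq> events"
    proof
      fix S assume "S \<in> E i"
      then obtain A B where S: "S = X i -` A \<inter> Y i -` B \<inter> space M" "A \<in> sets borel" "B \<in> sets borel"
        by (auto simp: E_def)
      have "S = (X i -` A \<inter> space M) \<inter> (Y i -` B \<inter> space M)" using S by auto
      then show "S \<in> events" using S i by (auto intro!: measurable_sets)
    qed
  next
    fix F J assume J: "J \<noteq> {}" "J \<subseteq> I" "finite J" and "\<forall>j\<in>J. F j \<in> E j"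
    then obtain A B where F: "\<And>j. j \<in> J \<Longrightarrow> F j = X j -` A j \<inter> Y j -` B j \<inter> space M"
        and AB: "\<And>j. j \<in> J \<Longrightarrow> A j \<in> sets borel" "\<And>j. j \<in> J \<Longrightarrow> B j \<in> sets borel"
      unfolding E_def by simp metis
    have "prob (\<Inter>j\<in>J. F j) = prob (\<Inter>j\<in>J. X j -` A j \<inter> Y j -` B j \<inter> space M)"
      using F by simp
    also have "\<dots> = (\<Prod>j\<in>J. prob (X j -` A j \<inter> space M) * prob (Y j -` B j \<inter> space M))"
      by (rule indep_families_rectangle[OF X Y XY]) (use J AB in auto)
    also have "\<dots> = (\<Prod>j\<in>J. prob (F j))"
    proof (rule prod.cong[OF refl])
      fix j assume j: "j \<in> J"
      \<comment> \<open>The singleton case of the rectangle formula identifies each factor as the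
        probability of \<open>F j\<close>.\<close>
      then show "prob (X j -` A j \<inter> space M) * prob (Y j -` B j \<inter> space M) = prob (F j)"
        using indep_families_rectangle[OF X Y XY, of "{j}" A B] J AB F[OF j] by auto
    qed
    finally show "prob (\<Inter>j\<in>J. F j) = (\<Prod>j\<in>J. prob (F j))" .
  qed
  moreover have "Int_stable (E i)" for i
  proof (rule Int_stableI)
    fix S T assume "S \<in> E i" "T \<in> E i"
    then obtain A B A' B' where "S = X i -` A \<inter> Y i -` B \<inter> space M" "T = X i -` A' \<inter> Y i -` B' \<inter> space M"
      "A \<in> sets borel" "B \<in> sets borel" "A' \<in> sets borel" "B' \<in> sets borel"
      by (auto simp: E_def)
    then have "S \<inter> T = X i -` (A \<inter> A') \<inter> Y i -` (B \<inter> B') \<inter> space M" "A \<inter> A' \<in> sets borel" "B \<inter> B' \<in> sets borel"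
      by auto
    then show "S \<inter> T \<in> E i" unfolding E_def by blast
  qed
  ultimately have ind: "indep_sets (\<lambda>i. sigma_sets (space M) (E i)) I" by (rule indep_sets_sigma)
  have *: "{(\<lambda>\<omega>. (X i \<omega>, Y i \<omega>)) -` D \<inter> space M | D. D \<in> sets (borel \<Otimes>\<^sub>M borel)} = sigma_sets (space M) (E i)" for i
  proof -
    have "{(\<lambda>\<omega>. (X i \<omega>, Y i \<omega>)) -` D \<inter> space M | D. D \<in> sets (borel \<Otimes>\<^sub>M borel)}
      = sigma_sets (space M) {(\<lambda>\<omega>. (X i \<omega>, Y i \<omega>)) -` D \<inter> space M | D. D \<in> {a \<times> b | a b. a \<in> sets borel \<and> b \<in> sets borel}}"
      unfolding sets_pair_measure by (rule sigma_sets_vimage_commute) simp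
    also have "{(\<lambda>\<omega>. (X i \<omega>, Y i \<omega>)) -` D \<inter> space M | D. D \<in> {a \<times> b | a b. a \<in> sets borel \<and> b \<in> sets borel}} = E i"
    proof -
      have "{f D | D. D \<in> {a \<times> b | a b. a \<in> sets borel \<and> b \<in> sets borel}} = {f (a \<times> b) | a b. a \<in> sets borel \<and> b \<in> sets borel}"
        for f :: "('c \<times> 'e) set \<Rightarrow> 'a set" by blast
      moreover have "(\<lambda>\<omega>. (X i \<omega>, Y i \<omega>)) -` (a \<times> b) \<inter> space M = X i -` a \<inter> Y i -` b \<inter> space M" for a b by auto
      ultimately show ?thesis unfolding E_def by (simp only:)
    qed
    finally show ?thesis .
  qed
  show ?thesis
    unfolding indep_vars_def2 *
  proof (intro conjI ballI ind)
    show "(\<lambda>\<omega>. (X i \<omega>, Y i \<omega>)) \<in> M \<rightarrow>\<^sub>M borel \<Otimes>\<^sub>M borel" if "i \<in> I" for i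
      using that by measurable
  qed
qed

lemma (in prob_space) distr_Pair_indep_families:
  fixes X :: "'i \<Rightarrow> 'a \<Rightarrow> 'c::second_countable_topology" and Y :: "'i \<Rightarrow> 'a \<Rightarrow> 'e::second_countable_topology"
  assumes X: "indep_vars (\<lambda>_. borel) X I" and Y: "indep_vars (\<lambda>_. borel) Y I"
    and XY: "indep_families M I X Y" and i: "i \<in> I"
  shows "distr M (borel \<Otimes>\<^sub>M borel) (\<lambda>\<omega>. (X i \<omega>, Y i \<omega>)) = distr M borel (X i) \<Otimes>\<^sub>M distr M borel (Y i)"
proof -
  have m[measurable]: "X i \<in> borel_measurable M" "Y i \<in> borel_measurable M"
    using X Y i by (auto simp: indep_vars_def2)
  interpret DX: prob_space "distr M borel (X i)" by (rule prob_space_distr) simp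
  interpret DY: prob_space "distr M borel (Y i)" by (rule prob_space_distr) simp
  have "distr M borel (X i) \<Otimes>\<^sub>M distr M borel (Y i) = distr M (borel \<Otimes>\<^sub>M borel) (\<lambda>\<omega>. (X i \<omega>, Y i \<omega>))"
  proof (rule pair_measure_eqI)
    fix A B assume A: "A \<in> sets (distr M borel (X i))" and B: "B \<in> sets (distr M borel (Y i))"
    have "prob (X i -` A \<inter> Y i -` B \<inter> space M) = prob (X i -` A \<inter> space M) * prob (Y i -` B \<inter> space M)"
      using indep_families_rectangle[OF X Y XY, of "{i}" "\<lambda>_. A" "\<lambda>_. B"] i A B by simp
    moreover have "(\<lambda>\<omega>. (X i \<omega>, Y i \<omega>)) -` (A \<times> B) \<inter> space M = X i -` A \<inter> Y i -` B \<inter> space M" by auto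
    ultimately show "emeasure (distr M borel (X i)) A * emeasure (distr M borel (Y i)) B
        = emeasure (distr M (borel \<Otimes>\<^sub>M borel) (\<lambda>\<omega>. (X i \<omega>, Y i \<omega>))) (A \<times> B)"
      using A B by (simp add: emeasure_distr emeasure_eq_measure ennreal_mult'')
  qed (auto simp: DX.sigma_finite_measure_axioms DY.sigma_finite_measure_axioms intro!: sets_pair_measure_cong)
  then show ?thesis by simp
qed

text \<open>Split off one summand: its cross term with the rest has mean zero, by independence and
  centring.\<close>

lemma (in prob_space) expectation_sum_squared:
  fixes Z :: "'i \<Rightarrow> 'a \<Rightarrow> real"
  assumes "finite I" "indep_vars (\<lambda>_. borel) Z I"
    and "\<And>i. i \<in> I \<Longrightarrow> integrable M (\<lambda>\<omega>. (Z i \<omega>)\<^sup>2)" and "\<And>i. i \<in> I \<Longrightarrow> expectation (Z i) = 0"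
  shows "integrable M (\<lambda>\<omega>. (\<Sum>i\<in>I. Z i \<omega>)\<^sup>2)
    \<and> expectation (\<lambda>\<omega>. (\<Sum>i\<in>I. Z i \<omega>)\<^sup>2) = (\<Sum>i\<in>I. expectation (\<lambda>\<omega>. (Z i \<omega>)\<^sup>2))"
  using assms
proof (induction I rule: finite_induct)
  case empty
  then show ?case by simp
next
  case (insert k I)
  have [measurable]: "Z i \<in> borel_measurable M" if "i \<in> insert k I" for i
    using insert.prems(1) that by (auto simp: indep_vars_def2)
  have "integrable M (\<lambda>\<omega>. (\<Sum>i\<in>I. Z i \<omega>)\<^sup>2)
    \<and> expectation (\<lambda>\<omega>. (\<Sum>i\<in>I. Z i \<omega>)\<^sup>2) = (\<Sum>i\<in>I. expectation (\<lambda>\<omega>. (Z i \<omega>)\<^sup>2))"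
  proof (rule insert.IH)
    show "indep_vars (\<lambda>_. borel) Z I" by (rule indep_vars_subset[OF insert.prems(1)]) auto
  qed (simp_all add: insert.prems)
  then have IH: "integrable M (\<lambda>\<omega>. (\<Sum>i\<in>I. Z i \<omega>)\<^sup>2)"
    "expectation (\<lambda>\<omega>. (\<Sum>i\<in>I. Z i \<omega>)\<^sup>2) = (\<Sum>i\<in>I. expectation (\<lambda>\<omega>. (Z i \<omega>)\<^sup>2))"
    by (rule conjunct1, rule conjunct2)
  have iZ: "integrable M (Z i)" if "i \<in> insert k I" for i
    by (rule square_integrable_imp_integrable[OF _ insert.prems(2)[OF that]]) (use that in measurable)
  have iS: "integrable M (\<lambda>\<omega>. \<Sum>i\<in>I. Z i \<omega>)" using iZ by auto
  have ind: "indep_var borel (Z k) borel (\<lambda>\<omega>. \<Sum>i\<in>I. Z i \<omega>)"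
    using insert.hyps insert.prems(1) by (intro indep_vars_sum) auto
  have cross: "integrable M (\<lambda>\<omega>. Z k \<omega> * (\<Sum>i\<in>I. Z i \<omega>))" "expectation (\<lambda>\<omega>. Z k \<omega> * (\<Sum>i\<in>I. Z i \<omega>)) = 0"
    using indep_var_integrable[OF ind] indep_var_lebesgue_integral[OF ind] iZ iS insert.prems(3) by auto
  have eq: "(\<Sum>i\<in>insert k I. Z i \<omega>)\<^sup>2 = (Z k \<omega>)\<^sup>2 + 2 * (Z k \<omega> * (\<Sum>i\<in>I. Z i \<omega>)) + (\<Sum>i\<in>I. Z i \<omega>)\<^sup>2" for \<omega>
    using insert.hyps by (simp add: power2_sum algebra_simps)
  show ?case
    unfolding eq using IH cross insert.prems(2)[of k] insert.hyps by simp
qed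

lemma (in prob_space) expectation_norm_sum_squared:
  fixes Z :: "'i \<Rightarrow> 'a \<Rightarrow> 'v::euclidean_space"
  assumes fin: "finite I" and ind: "indep_vars (\<lambda>_. borel) Z I"
    and sq: "\<And>i. i \<in> I \<Longrightarrow> integrable M (\<lambda>\<omega>. (norm (Z i \<omega>))\<^sup>2)" and z: "\<And>i. i \<in> I \<Longrightarrow> expectation (Z i) = 0"
  shows "integrable M (\<lambda>\<omega>. (norm (\<Sum>i\<in>I. Z i \<omega>))\<^sup>2)
    \<and> expectation (\<lambda>\<omega>. (norm (\<Sum>i\<in>I. Z i \<omega>))\<^sup>2) = (\<Sum>i\<in>I. expectation (\<lambda>\<omega>. (norm (Z i \<omega>))\<^sup>2))"
proof -
  have Zm[measurable]: "Z i \<in> borel_measurable M" if "i \<in> I" for i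
    using ind that by (auto simp: indep_vars_def2)
  have isq: "integrable M (\<lambda>\<omega>. (Z i \<omega> \<bullet> b)\<^sup>2)" if "i \<in> I" "b \<in> Basis" for i b
  proof (rule Bochner_Integration.integrable_bound[OF sq[OF that(1)]])
    have "(z \<bullet> b)\<^sup>2 \<le> (norm z)\<^sup>2" for z :: 'v
      using Basis_le_norm[OF that(2), of z] by (metis abs_le_square_iff abs_norm_cancel)
    then show "AE \<omega> in M. norm ((Z i \<omega> \<bullet> b)\<^sup>2) \<le> norm ((norm (Z i \<omega>))\<^sup>2)"
      by simp
  qed (use Zm[OF that(1)] in measurable)
  have iZ: "integrable M (Z i)" if "i \<in> I" for i
    using square_integrable_imp_integrable[of "\<lambda>\<omega>. norm (Z i \<omega>)"] sq[OF that] Zm[OF that] by (simp add: integrable_norm_iff)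
  have *: "integrable M (\<lambda>\<omega>. (\<Sum>i\<in>I. Z i \<omega> \<bullet> b)\<^sup>2)
    \<and> expectation (\<lambda>\<omega>. (\<Sum>i\<in>I. Z i \<omega> \<bullet> b)\<^sup>2) = (\<Sum>i\<in>I. expectation (\<lambda>\<omega>. (Z i \<omega> \<bullet> b)\<^sup>2))" if b: "b \<in> Basis" for b
  proof (rule expectation_sum_squared[OF fin])
    show "indep_vars (\<lambda>_. borel) (\<lambda>i \<omega>. Z i \<omega> \<bullet> b) I"
      by (rule indep_vars_compose2[OF ind, where Y="\<lambda>_ z. z \<bullet> b"]) auto
  qed (use isq b iZ z in auto)
  have "(norm (\<Sum>i\<in>I. Z i \<omega>))\<^sup>2 = (\<Sum>b\<in>Basis. (\<Sum>i\<in>I. Z i \<omega> \<bullet> b)\<^sup>2)" for \<omega>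
    by (simp add: norm_sq_sum_Basis inner_sum_left)
  then show ?thesis
    using * isq by (simp add: norm_sq_sum_Basis sum.swap[of _ Basis I])
qed

lemma (in prob_space) prob_norm_gt_le:
  fixes Z :: "'a \<Rightarrow> 'v::euclidean_space"
  assumes "Z \<in> borel_measurable M" "integrable M (\<lambda>\<omega>. (norm (Z \<omega>))\<^sup>2)" "K > 0"
  shows "prob {\<omega> \<in> space M. norm (Z \<omega>) > K} \<le> expectation (\<lambda>\<omega>. (norm (Z \<omega>))\<^sup>2) / K\<^sup>2"
proof -
  note [measurable] = assms(1)
  have "prob {\<omega> \<in> space M. norm (Z \<omega>) > K} \<le> prob {\<omega> \<in> space M. (norm (Z \<omega>))\<^sup>2 \<ge> K\<^sup>2}"
    using assms(3) by (intro finite_measure_mono) (auto intro: power_mono)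
  also have "\<dots> \<le> expectation (\<lambda>\<omega>. (norm (Z \<omega>))\<^sup>2) / K\<^sup>2"
    using integral_Markov_inequality_measure[OF assms(2), of "{}" "K\<^sup>2"] assms(3) by simp
  finally show ?thesis .
qed

text \<open>Each summand is cut at level \<open>K\<close>. The centred bounded parts are orthogonal
  with variance at most \<open>K\<^sup>2\<close>, which yields the square root of
  \<open>card I\<close>; the tails and their mean are simply added in absolute value, which yields
  the factor 2.\<close>

lemma (in prob_space) expectation_abs_sum_truncated:
  fixes Z :: "'i \<Rightarrow> 'a \<Rightarrow> real"
  assumes fin: "finite I" and ind: "indep_vars (\<lambda>_. borel) Z I"
    and D: "\<And>i. i \<in> I \<Longrightarrow> distr M borel (Z i) = D" and int: "integrable D (\<lambda>z. z)" and K: "K \<ge> 0"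
  shows "integrable M (\<lambda>\<omega>. \<Sum>i\<in>I. Z i \<omega> - (\<integral>z. z \<partial>D))
    \<and> expectation (\<lambda>\<omega>. \<bar>\<Sum>i\<in>I. Z i \<omega> - (\<integral>z. z \<partial>D)\<bar>)
      \<le> K * sqrt (card I) + 2 * card I * (\<integral>z. \<bar>z\<bar> * indicator {z. \<bar>z\<bar> > K} z \<partial>D)"
proof (cases "I = {}")
  case False
  have Zm[measurable]: "Z i \<in> borel_measurable M" if "i \<in> I" for i
    using ind that by (auto simp: indep_vars_def2)
  obtain i0 where i0: "i0 \<in> I" using False by auto
  have sD[measurable_cong]: "sets D = sets borel" using D[OF i0] by auto
  interpret D: prob_space D using prob_space_distr[OF Zm[OF i0]] D[OF i0] by simp
  define f where "f z = z * indicator {z. \<bar>z\<bar> \<le> K} z" for z :: real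
  define g where "g z = z * indicator {z. \<bar>z\<bar> > K} z" for z :: real
  have fg: "z = f z + g z" for z by (auto simp: f_def g_def split: split_indicator)
  have [measurable]: "f \<in> borel_measurable borel" unfolding f_def[abs_def] by measurable
  have [measurable]: "g \<in> borel_measurable borel" unfolding g_def[abs_def] by measurable
  have fb: "\<bar>f z\<bar> \<le> K" for z using K by (auto simp: f_def split: split_indicator)
  have fi: "integrable D f" using fb by (intro D.integrable_const_bound[where B=K]) auto
  have gi: "integrable D g"
    by (rule Bochner_Integration.integrable_bound[OF int]) (auto simp: g_def split: split_indicator)
  have dist: "integrable M (\<lambda>\<omega>. h (Z i \<omega>))" "expectation (\<lambda>\<omega>. h (Z i \<omega>)) = (\<integral>z. h z \<partial>D)"
    if "i \<in> I" "integrable D h" for i and h :: "real \<Rightarrow> real"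
  proof -
    have [measurable]: "h \<in> borel_measurable borel" using that(2) sD by (auto dest: borel_measurable_integrable)
    show "integrable M (\<lambda>\<omega>. h (Z i \<omega>))" "expectation (\<lambda>\<omega>. h (Z i \<omega>)) = (\<integral>z. h z \<partial>D)"
      using that(2) Zm[OF that(1)] unfolding D[OF that(1), symmetric] by (auto simp: integrable_distr_eq integral_distr)
  qed
  define m where "m = (\<integral>z. f z \<partial>D)"
  define U where "U \<omega> = (\<Sum>i\<in>I. f (Z i \<omega>) - m)" for \<omega>
  define V where "V \<omega> = (\<Sum>i\<in>I. g (Z i \<omega>) - (\<integral>z. g z \<partial>D))" for \<omega>
  have mean: "(\<integral>z. z \<partial>D) = m + (\<integral>z. g z \<partial>D)"
  proof -
    have "(\<integral>z. z \<partial>D) = (\<integral>z. f z + g z \<partial>D)" by (simp flip: fg)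
    then show ?thesis unfolding m_def using fi gi by simp
  qed
  have split: "(\<Sum>i\<in>I. Z i \<omega> - (\<integral>z. z \<partial>D)) = U \<omega> + V \<omega>" for \<omega>
    unfolding U_def V_def mean sum.distrib[symmetric]
  proof (rule sum.cong[OF refl])
    fix i show "Z i \<omega> - (m + (\<integral>z. g z \<partial>D)) = f (Z i \<omega>) - m + (g (Z i \<omega>) - (\<integral>z. g z \<partial>D))"
      using fg[of "Z i \<omega>"] by linarith
  qed
  have Usq: "integrable M (\<lambda>\<omega>. (U \<omega>)\<^sup>2) \<and> expectation (\<lambda>\<omega>. (U \<omega>)\<^sup>2) = (\<Sum>i\<in>I. expectation (\<lambda>\<omega>. (f (Z i \<omega>) - m)\<^sup>2))"
    unfolding U_def
  proof (rule expectation_sum_squared[OF fin])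
    show "indep_vars (\<lambda>_. borel) (\<lambda>i \<omega>. f (Z i \<omega>) - m) I"
      by (rule indep_vars_compose2[OF ind, where Y="\<lambda>_ z. f z - m"]) auto
    show "integrable M (\<lambda>\<omega>. (f (Z i \<omega>) - m)\<^sup>2)" if i: "i \<in> I" for i
    proof (rule integrable_const_bound[where B="(K + \<bar>m\<bar>)\<^sup>2"])
      have "\<bar>f z - m\<bar> \<le> \<bar>K + \<bar>m\<bar>\<bar>" for z using fb[of z] K by linarith
      then show "AE \<omega> in M. norm ((f (Z i \<omega>) - m)\<^sup>2) \<le> (K + \<bar>m\<bar>)\<^sup>2"
        by (simp add: abs_le_square_iff)
    qed (use Zm[OF i] in measurable)
    show "expectation (\<lambda>\<omega>. f (Z i \<omega>) - m) = 0" if "i \<in> I" for i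
      using dist[OF that fi] by (simp add: m_def prob_space)
  qed
  have "expectation (\<lambda>\<omega>. (f (Z i \<omega>) - m)\<^sup>2) \<le> K\<^sup>2" if i: "i \<in> I" for i
  proof -
    have f2: "integrable D (\<lambda>z. (f z)\<^sup>2)" "(\<integral>z. (f z)\<^sup>2 \<partial>D) \<le> K\<^sup>2"
    proof -
      have b: "(f z)\<^sup>2 \<le> K\<^sup>2" for z using fb[of z] K by (metis abs_le_square_iff abs_of_nonneg)
      then show i: "integrable D (\<lambda>z. (f z)\<^sup>2)" by (intro D.integrable_const_bound[where B="K\<^sup>2"]) auto
      have "(\<integral>z. (f z)\<^sup>2 \<partial>D) \<le> (\<integral>z. K\<^sup>2 \<partial>D)" using b i by (intro integral_mono) auto
      then show "(\<integral>z. (f z)\<^sup>2 \<partial>D) \<le> K\<^sup>2" by (simp add: D.prob_space)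
    qed
    have e: "(\<lambda>z. (f z - m)\<^sup>2) = (\<lambda>z. (f z)\<^sup>2 - 2 * m * f z + m\<^sup>2)" by (auto simp: power2_diff)
    have i2: "integrable D (\<lambda>z. (f z - m)\<^sup>2)" unfolding e using f2(1) fi by simp
    have "(\<integral>z. (f z - m)\<^sup>2 \<partial>D) = (\<integral>z. (f z)\<^sup>2 \<partial>D) - m\<^sup>2"
      unfolding e using f2(1) fi by (simp add: D.prob_space m_def[symmetric] power2_eq_square)
    also have "\<dots> \<le> K\<^sup>2" using f2(2) zero_le_power2[of m] by linarith
    finally show ?thesis using dist(2)[OF i i2] by simp
  qed
  then have "expectation (\<lambda>\<omega>. (U \<omega>)\<^sup>2) \<le> card I * K\<^sup>2"
    using Usq sum_bounded_above[of I "\<lambda>i. expectation (\<lambda>\<omega>. (f (Z i \<omega>) - m)\<^sup>2)" "K\<^sup>2"] by simp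
  \<comment> \<open>Jensen's inequality, obtained as nonnegativity of the variance of
    \<open>\<bar>U \<omega>\<bar>\<close>.\<close>
  moreover have "(expectation (\<lambda>\<omega>. \<bar>U \<omega>\<bar>))\<^sup>2 \<le> expectation (\<lambda>\<omega>. (U \<omega>)\<^sup>2)"
  proof -
    have Um: "U \<in> borel_measurable M" unfolding U_def by measurable
    have iU: "integrable M (\<lambda>\<omega>. \<bar>U \<omega>\<bar>)"
      using square_integrable_imp_integrable[OF Um] Usq by simp
    have "0 \<le> variance (\<lambda>\<omega>. \<bar>U \<omega>\<bar>)" by (rule variance_positive)
    then show ?thesis using variance_eq[OF iU] Usq by simp
  qed
  ultimately have "(expectation (\<lambda>\<omega>. \<bar>U \<omega>\<bar>))\<^sup>2 \<le> (K * sqrt (card I))\<^sup>2"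
    by (simp add: power_mult_distrib mult.commute)
  then have EU: "expectation (\<lambda>\<omega>. \<bar>U \<omega>\<bar>) \<le> K * sqrt (card I)"
    by (rule power2_le_imp_le) (simp add: K)
  have Ui: "integrable M U"
    unfolding U_def using dist(1)[OF _ fi] by auto
  have Vi: "integrable M V"
    unfolding V_def using dist(1)[OF _ gi] by auto
  define t where "t = (\<integral>z. \<bar>g z\<bar> \<partial>D)"
  have "expectation (\<lambda>\<omega>. \<bar>V \<omega>\<bar>) \<le> expectation (\<lambda>\<omega>. \<Sum>i\<in>I. \<bar>g (Z i \<omega>)\<bar> + t)"
  proof (rule integral_mono)
    fix \<omega>
    have "\<bar>V \<omega>\<bar> \<le> (\<Sum>i\<in>I. \<bar>g (Z i \<omega>) - (\<integral>z. g z \<partial>D)\<bar>)" unfolding V_def by (rule sum_abs)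
    also have "\<dots> \<le> (\<Sum>i\<in>I. \<bar>g (Z i \<omega>)\<bar> + t)"
    proof (rule sum_mono)
      have "\<bar>\<integral>z. g z \<partial>D\<bar> \<le> t" unfolding t_def by (rule integral_abs_bound)
      then show "\<bar>g (Z i \<omega>) - (\<integral>z. g z \<partial>D)\<bar> \<le> \<bar>g (Z i \<omega>)\<bar> + t" for i
        using abs_triangle_ineq4[of "g (Z i \<omega>)" "\<integral>z. g z \<partial>D"] by linarith
    qed
    finally show "\<bar>V \<omega>\<bar> \<le> (\<Sum>i\<in>I. \<bar>g (Z i \<omega>)\<bar> + t)" .
  qed (use Vi dist(1)[OF _ integrable_abs[OF gi]] in auto)
  also have "\<dots> = 2 * card I * t"
    using dist[OF _ integrable_abs[OF gi]] by (simp add: prob_space t_def)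
  finally have EV: "expectation (\<lambda>\<omega>. \<bar>V \<omega>\<bar>) \<le> 2 * card I * t" .
  have tt: "t = (\<integral>z. \<bar>z\<bar> * indicator {z. \<bar>z\<bar> > K} z \<partial>D)"
    unfolding t_def g_def by (intro Bochner_Integration.integral_cong) (auto simp: abs_mult split: split_indicator)
  have "expectation (\<lambda>\<omega>. \<bar>U \<omega> + V \<omega>\<bar>) \<le> expectation (\<lambda>\<omega>. \<bar>U \<omega>\<bar> + \<bar>V \<omega>\<bar>)"
    using Ui Vi by (intro integral_mono) auto
  also have "\<dots> = expectation (\<lambda>\<omega>. \<bar>U \<omega>\<bar>) + expectation (\<lambda>\<omega>. \<bar>V \<omega>\<bar>)" using Ui Vi by simp
  also have "\<dots> \<le> K * sqrt (card I) + 2 * card I * t" using EU EV by simp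
  finally have "expectation (\<lambda>\<omega>. \<bar>U \<omega> + V \<omega>\<bar>) \<le> K * sqrt (card I) + 2 * card I * t" .
  then show ?thesis unfolding split tt[symmetric] using Ui Vi by (intro conjI Bochner_Integration.integrable_add)
qed simp

subsection \<open>Triangular arrays\<close>

lemma exp_minus_approx:
  fixes y :: real assumes "y \<ge> 0"
  shows "\<bar>exp (- y) - (1 - y)\<bar> \<le> y\<^sup>2 / 2"
proof -
  have 1: "1 - y \<le> exp (- y)" using exp_ge_add_one_self[of "- y"] by simp
  have "exp (- y) \<le> 1 - y + y\<^sup>2 / 2"
  proof (rule DERIV_nonneg_imp_nondecreasing[OF assms, of "\<lambda>y. 1 - y + y\<^sup>2 / 2 - exp (- y)", simplified])
    fix x :: real assume "0 \<le> x"
    have "((\<lambda>y. 1 - y + y\<^sup>2 / 2 - exp (- y)) has_real_derivative (- 1 + x + exp (- x))) (at x)"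
      by (auto intro!: derivative_eq_intros)
    moreover have "- 1 + x + exp (- x) \<ge> 0" using exp_ge_add_one_self[of "- x"] by simp
    ultimately show "\<exists>D. ((\<lambda>y. 1 - y + y\<^sup>2 / 2 - exp (- y)) has_real_derivative D) (at x) \<and> 0 \<le> D" by blast
  qed
  with 1 show ?thesis by simp
qed

text \<open>With a finite second moment only, the Taylor remainder is \<open>t\<^sup>2\<close> times
  a quantity tending to 0, with no rate. The function \<open>g\<close> packages this quantity; it
  depends on \<open>\<bar>t\<bar>\<close> alone, so that arguments differing in sign share one
  bound.\<close>

lemma (in real_distribution) char_gaussian_approx:
  assumes int1: "expectation (\<lambda>x. x) = 0" and int2: "integrable M (\<lambda>x. x\<^sup>2)" and v: "expectation (\<lambda>x. x\<^sup>2) = v"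
  obtains g where "\<And>t. cmod (char M t - exp (- v * t\<^sup>2 / 2)) \<le> t\<^sup>2 * g \<bar>t\<bar>"
    "\<And>t. t \<longlonglongrightarrow> 0 \<Longrightarrow> (\<lambda>n. g \<bar>t n\<bar>) \<longlonglongrightarrow> 0"
proof -
  define h where "h t = expectation (\<lambda>x. min (6 * x\<^sup>2) (t * \<bar>x\<bar> ^ 3))" for t
  \<comment> \<open>The first term is the remainder in the expansion of the characteristic function,
    the second is \<open>(t\<^sup>2 * v / 2)\<^sup>2 / 2\<close> from the exponential, each divided
    by \<open>t\<^sup>2\<close>.\<close>
  define g where "g t = h t / 6 + v\<^sup>2 * t\<^sup>2 / 8" for t
  have int: "integrable M (\<lambda>x. x)" by (rule square_integrable_imp_integrable[OF _ int2]) simp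
  have v0: "v \<ge> 0" unfolding v[symmetric] by simp
  show thesis
  proof (rule that[of g])
    fix t
    have "cmod (char M t - (1 - t\<^sup>2 * v / 2)) \<le> t\<^sup>2 / 6 * h \<bar>t\<bar>"
      unfolding h_def using int int1 int2 v by (intro char_approx3) auto
    moreover have "cmod (exp (- v * t\<^sup>2 / 2) - (1 - t\<^sup>2 * v / 2)) \<le> (t\<^sup>2 * v / 2)\<^sup>2 / 2"
    proof -
      have d: "- v * t\<^sup>2 / 2 = - (t\<^sup>2 * v / 2)" by simp
      show ?thesis unfolding d of_real_diff[symmetric] norm_of_real by (rule exp_minus_approx) (simp add: v0)
    qed
    ultimately have "cmod (char M t - exp (- v * t\<^sup>2 / 2)) \<le> t\<^sup>2 / 6 * h \<bar>t\<bar> + (t\<^sup>2 * v / 2)\<^sup>2 / 2"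
      using norm_triangle_le_diff[of "char M t - (1 - t\<^sup>2 * v / 2)" "exp (- v * t\<^sup>2 / 2) - (1 - t\<^sup>2 * v / 2)"] by simp
    also have "\<dots> = t\<^sup>2 * g \<bar>t\<bar>"
      by (simp add: g_def power2_eq_square field_simps)
    finally show "cmod (char M t - exp (- v * t\<^sup>2 / 2)) \<le> t\<^sup>2 * g \<bar>t\<bar>" .
  next
    fix t :: "nat \<Rightarrow> real" assume t: "t \<longlonglongrightarrow> 0"
    have a: "(\<lambda>n. \<bar>t n\<bar>) \<longlonglongrightarrow> 0" using t by (simp add: tendsto_rabs_zero)
    have "(\<lambda>n. h \<bar>t n\<bar>) \<longlonglongrightarrow> expectation (\<lambda>x. 0)"
      unfolding h_def
    \<comment> \<open>The truncation by \<open>6 * x\<^sup>2\<close> inside \<open>h\<close> serves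
      as the dominating function, so no third moment is involved.\<close>
    proof (rule integral_dominated_convergence[where w="\<lambda>x. 6 * x\<^sup>2"])
      show "AE x in M. (\<lambda>n. min (6 * x\<^sup>2) (\<bar>t n\<bar> * \<bar>x\<bar> ^ 3)) \<longlonglongrightarrow> 0"
      proof (rule AE_I2)
        fix x
        have "(\<lambda>n. min (6 * x\<^sup>2) (\<bar>t n\<bar> * \<bar>x\<bar> ^ 3)) \<longlonglongrightarrow> min (6 * x\<^sup>2) (0 * \<bar>x\<bar> ^ 3)"
          by (intro tendsto_intros a)
        then show "(\<lambda>n. min (6 * x\<^sup>2) (\<bar>t n\<bar> * \<bar>x\<bar> ^ 3)) \<longlonglongrightarrow> 0" by simp
      qed
    qed (use int2 in auto)
    then have "(\<lambda>n. h \<bar>t n\<bar> / 6 + v\<^sup>2 * \<bar>t n\<bar>\<^sup>2 / 8) \<longlonglongrightarrow> 0 / 6 + v\<^sup>2 * 0\<^sup>2 / 8"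
      by (intro tendsto_intros a) simp_all
    then show "(\<lambda>n. g \<bar>t n\<bar>) \<longlonglongrightarrow> 0" by (simp add: g_def)
  qed
qed

text \<open>A central limit theorem for one block: replacing the factors by Gaussian ones costs at
  most the sum of the individual errors, \<open>card (I n) * (t n)\<^sup>2\<close> times o(1). The
  arguments may vary in sign with \<open>i\<close>, as the signs of the incidental parameters
  require.\<close>

lemma (in real_distribution) prod_char_tendsto:
  fixes \<tau> :: "nat \<Rightarrow> 'i \<Rightarrow> real" and t :: "nat \<Rightarrow> real" and w :: real
  assumes int1: "expectation (\<lambda>x. x) = 0" and int2: "integrable M (\<lambda>x. x\<^sup>2)" and v: "expectation (\<lambda>x. x\<^sup>2) = v"
    and \<tau>: "\<And>n i. i \<in> I n \<Longrightarrow> (\<tau> n i)\<^sup>2 = (t n)\<^sup>2" and t: "t \<longlonglongrightarrow> 0"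
    and w: "(\<lambda>n. card (I n) * (t n)\<^sup>2) \<longlonglongrightarrow> w"
  shows "(\<lambda>n. \<Prod>i\<in>I n. char M (\<tau> n i)) \<longlonglongrightarrow> complex_of_real (exp (- v * w / 2))"
proof -
  have v0: "v \<ge> 0" unfolding v[symmetric] by simp
  obtain g where g: "\<And>t. cmod (char M t - exp (- v * t\<^sup>2 / 2)) \<le> t\<^sup>2 * g \<bar>t\<bar>"
    and g0: "\<And>t. t \<longlonglongrightarrow> 0 \<Longrightarrow> (\<lambda>n. g \<bar>t n\<bar>) \<longlonglongrightarrow> 0"
    by (rule char_gaussian_approx[OF int1 int2 v]) (rule that)
  have bnd: "cmod ((\<Prod>i\<in>I n. char M (\<tau> n i)) - (\<Prod>i\<in>I n. complex_of_real (exp (- v * (\<tau> n i)\<^sup>2 / 2))))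
      \<le> (card (I n) * (t n)\<^sup>2) * g \<bar>t n\<bar>" for n
  proof -
    have "cmod ((\<Prod>i\<in>I n. char M (\<tau> n i)) - (\<Prod>i\<in>I n. complex_of_real (exp (- v * (\<tau> n i)\<^sup>2 / 2))))
        \<le> (\<Sum>i\<in>I n. cmod (char M (\<tau> n i) - exp (- v * (\<tau> n i)\<^sup>2 / 2)))"
      using v0 by (intro norm_prod_diff) (auto simp: cmod_char_le_1 simp flip: exp_of_real)
    also have "\<dots> \<le> (\<Sum>i\<in>I n. (t n)\<^sup>2 * g \<bar>t n\<bar>)"
    proof (rule sum_mono)
      fix i assume i: "i \<in> I n"
      have "\<bar>\<tau> n i\<bar> = \<bar>t n\<bar>" using \<tau>[OF i] by (simp add: power2_eq_iff abs_eq_iff)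
      then show "cmod (char M (\<tau> n i) - exp (- v * (\<tau> n i)\<^sup>2 / 2)) \<le> (t n)\<^sup>2 * g \<bar>t n\<bar>"
        using g[of "\<tau> n i"] \<tau>[OF i] by simp
    qed
    finally show ?thesis by simp
  qed
  have lim0: "(\<lambda>n. (card (I n) * (t n)\<^sup>2) * g \<bar>t n\<bar>) \<longlonglongrightarrow> 0"
    using tendsto_mult[OF w g0[OF t]] by simp
  have 1: "(\<lambda>n. (\<Prod>i\<in>I n. char M (\<tau> n i)) - (\<Prod>i\<in>I n. complex_of_real (exp (- v * (\<tau> n i)\<^sup>2 / 2)))) \<longlonglongrightarrow> 0"
    by (rule Lim_null_comparison[OF always_eventually lim0]) (use bnd in blast)
  have "(\<Prod>i\<in>I n. complex_of_real (exp (- v * (\<tau> n i)\<^sup>2 / 2))) = complex_of_real (exp (- v * (card (I n) * (t n)\<^sup>2) / 2))" for n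
  proof -
    have "(\<Prod>i\<in>I n. complex_of_real (exp (- v * (\<tau> n i)\<^sup>2 / 2))) = (\<Prod>i\<in>I n. complex_of_real (exp (- v * (t n)\<^sup>2 / 2)))"
      using \<tau> by (intro prod.cong) auto
    also have "\<dots> = complex_of_real (exp (- v * (t n)\<^sup>2 / 2) ^ card (I n))" by simp
    also have "exp (- v * (t n)\<^sup>2 / 2) ^ card (I n) = exp (- v * (card (I n) * (t n)\<^sup>2) / 2)"
      by (simp add: exp_of_nat_mult[symmetric] algebra_simps)
    finally show ?thesis .
  qed
  moreover have "(\<lambda>n. complex_of_real (exp (- v * (card (I n) * (t n)\<^sup>2) / 2))) \<longlonglongrightarrow> complex_of_real (exp (- v * w / 2))"
    by (intro tendsto_intros w) simp
  ultimately have 2: "(\<lambda>n. \<Prod>i\<in>I n. complex_of_real (exp (- v * (\<tau> n i)\<^sup>2 / 2))) \<longlonglongrightarrow> complex_of_real (exp (- v * w / 2))"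
    by simp
  show ?thesis using tendsto_add[OF 1 2] by simp
qed

lemma cmod_iexp_diff_le: "cmod (iexp a - iexp b) \<le> \<bar>a - b\<bar>"
proof -
  have "iexp a - iexp b = iexp b * (iexp (a - b) - 1)"
    by (simp add: right_diff_distrib exp_diff exp_minus field_simps flip: exp_add)
  then have "cmod (iexp a - iexp b) = cmod (iexp (a - b) - 1)" by (simp add: norm_mult)
  also have "\<dots> \<le> \<bar>a - b\<bar>" using iexp_approx1[of "a - b" 0] by simp
  finally show ?thesis .
qed

text \<open>Slutsky's argument for characteristic functions. A single \<open>e\<close> bounds both
  the distance on the good event and the probability of its complement, and the event may depend on
  \<open>e\<close>.\<close>

lemma mchar_tendsto_perturb:
  fixes Z W :: "nat \<Rightarrow> 'a \<Rightarrow> 'v::euclidean_space"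
  assumes P: "\<And>n. prob_space (M n)"
    and Z: "\<And>n. Z n \<in> borel_measurable (M n)" and W: "\<And>n. W n \<in> borel_measurable (M n)"
    and close: "\<And>e. e > 0 \<Longrightarrow> \<exists>A. \<forall>\<^sub>F n in sequentially. A n \<in> sets (M n) \<and> measure (M n) (A n) \<ge> 1 - e
          \<and> (\<forall>\<omega>\<in>A n. norm (Z n \<omega> - W n \<omega>) \<le> e)"
    and lim: "(\<lambda>n. mchar (distr (M n) borel (W n)) u) \<longlonglongrightarrow> l"
  shows "(\<lambda>n. mchar (distr (M n) borel (Z n)) u) \<longlonglongrightarrow> l"
proof -
  have "(\<lambda>n. mchar (distr (M n) borel (Z n)) u - mchar (distr (M n) borel (W n)) u) \<longlonglongrightarrow> 0"
  proof (rule tendstoI)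
    fix r :: real assume r: "r > 0"
    \<comment> \<open>The good event costs \<open>norm u * e\<close>, its complement at most
      \<open>2 * e\<close>; the 3 instead of 2 makes the final inequality strict.\<close>
    define e where "e = r / (norm u + 3)"
    have e: "e > 0" using r by (simp add: e_def add_nonneg_pos)
    from close[OF e] obtain A where A: "\<forall>\<^sub>F n in sequentially. A n \<in> sets (M n) \<and> measure (M n) (A n) \<ge> 1 - e
          \<and> (\<forall>\<omega>\<in>A n. norm (Z n \<omega> - W n \<omega>) \<le> e)" by blast
    then show "\<forall>\<^sub>F n in sequentially. dist (mchar (distr (M n) borel (Z n)) u - mchar (distr (M n) borel (W n)) u) 0 < r"
    proof (rule eventually_mono)
      fix n assume n: "A n \<in> sets (M n) \<and> measure (M n) (A n) \<ge> 1 - e \<and> (\<forall>\<omega>\<in>A n. norm (Z n \<omega> - W n \<omega>) \<le> e)"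
      interpret prob_space "M n" by (rule P)
      note [measurable] = Z[of n] W[of n] and nA[measurable] = n[THEN conjunct1]
      have i: "integrable (M n) (\<lambda>\<omega>. iexp (u \<bullet> Z n \<omega>))" "integrable (M n) (\<lambda>\<omega>. iexp (u \<bullet> W n \<omega>))"
        by (intro integrable_const_bound[where B=1]; simp)+
      have "mchar (distr (M n) borel (Z n)) u - mchar (distr (M n) borel (W n)) u
          = (\<integral>\<omega>. iexp (u \<bullet> Z n \<omega>) - iexp (u \<bullet> W n \<omega>) \<partial>M n)"
        unfolding mchar_def using i by (simp add: integral_distr)
      also have "cmod \<dots> \<le> (\<integral>\<omega>. cmod (iexp (u \<bullet> Z n \<omega>) - iexp (u \<bullet> W n \<omega>)) \<partial>M n)"
        by (rule integral_norm_bound)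
      also have "\<dots> \<le> (\<integral>\<omega>. norm u * e + 2 * indicator (space (M n) - A n) \<omega> \<partial>M n)"
      proof (rule integral_mono)
        fix \<omega> assume \<omega>: "\<omega> \<in> space (M n)"
        show "cmod (iexp (u \<bullet> Z n \<omega>) - iexp (u \<bullet> W n \<omega>)) \<le> norm u * e + 2 * indicator (space (M n) - A n) \<omega>"
        proof (cases "\<omega> \<in> A n")
          case True
          have "cmod (iexp (u \<bullet> Z n \<omega>) - iexp (u \<bullet> W n \<omega>)) \<le> \<bar>u \<bullet> (Z n \<omega> - W n \<omega>)\<bar>"
            using cmod_iexp_diff_le by (simp add: inner_diff_right)
          also have "\<dots> \<le> norm u * norm (Z n \<omega> - W n \<omega>)" by (rule Cauchy_Schwarz_ineq2)
          also have "\<dots> \<le> norm u * e" using n True by (intro mult_left_mono) auto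
          finally show ?thesis using True by simp
        next
          case False
          have "cmod (iexp (u \<bullet> Z n \<omega>) - iexp (u \<bullet> W n \<omega>)) \<le> 2"
            using norm_triangle_ineq4[of "iexp (u \<bullet> Z n \<omega>)" "iexp (u \<bullet> W n \<omega>)"] by simp
          moreover have "0 \<le> norm u * e" using e by simp
          ultimately show ?thesis using False \<omega> by simp
        qed
      next
        show "integrable (M n) (\<lambda>\<omega>. norm u * e + 2 * indicator (space (M n) - A n) \<omega>)"
          by (intro Bochner_Integration.integrable_add integrable_mult_right integrable_const integrable_real_indicator)
             (auto simp: less_top[symmetric])
      qed (use i in auto)
      also have "\<dots> = norm u * e + 2 * prob (space (M n) - A n)"
        by (subst Bochner_Integration.integral_add)
           (auto simp: prob_space intro!: integrable_const_bound[where B=1] split: split_indicator)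
      also have "\<dots> \<le> norm u * e + 2 * e" using n prob_compl[OF nA] by simp
      also have "\<dots> < (norm u + 3) * e" using e by (simp add: algebra_simps)
      also have "\<dots> = r" by (simp add: e_def add_nonneg_pos[THEN less_imp_neq, symmetric])
      finally show "dist (mchar (distr (M n) borel (Z n)) u - mchar (distr (M n) borel (W n)) u) 0 < r" by simp
    qed
  qed
  from tendsto_add[OF this lim] show ?thesis by simp
qed

section \<open>Events of probability tending to one\<close>

lemma with_high_prob_mono:
  assumes P: "\<And>n. prob_space (M n)" and E: "with_high_prob M E"
    and le: "\<forall>\<^sub>F n in sequentially. \<forall>\<omega>\<in>space (M n). E n \<omega> \<longrightarrow> E' n \<omega>"
  shows "with_high_prob M E'"
proof -
  obtain A where A: "\<And>n. A n \<in> sets (M n)" "\<And>n \<omega>. \<omega> \<in> A n \<Longrightarrow> E n \<omega>" "(\<lambda>n. measure (M n) (A n)) \<longlonglongrightarrow> 1"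
    using E unfolding with_high_prob_def by blast
  \<comment> \<open>\<open>with_high_prob\<close> asks for the conclusion at every \<open>n\<close>,
    while the implication is only known eventually; at the remaining indices the event is taken
    empty.\<close>
  define B where "B n = (if \<forall>\<omega>\<in>space (M n). E n \<omega> \<longrightarrow> E' n \<omega> then A n else {})" for n
  have "\<forall>\<^sub>F n in sequentially. measure (M n) (A n) = measure (M n) (B n)"
    using le by (rule eventually_mono) (simp add: B_def)
  then have "(\<lambda>n. measure (M n) (B n)) \<longlonglongrightarrow> 1" using A(3) by (simp cong: tendsto_cong)
  moreover have "B n \<in> sets (M n)" for n using A(1) by (simp add: B_def)
  moreover have "E' n \<omega>" if "\<omega> \<in> B n" for n \<omega>
    using that A(2)[of \<omega> n] sets.sets_into_space[OF A(1), of n] unfolding B_def by (auto split: if_splits)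
  ultimately show ?thesis unfolding with_high_prob_def by blast
qed

lemma with_high_prob_conj:
  assumes P: "\<And>n. prob_space (M n)" and E: "with_high_prob M E" and F: "with_high_prob M F"
  shows "with_high_prob M (\<lambda>n \<omega>. E n \<omega> \<and> F n \<omega>)"
proof -
  obtain A where A: "\<And>n. A n \<in> sets (M n)" "\<And>n \<omega>. \<omega> \<in> A n \<Longrightarrow> E n \<omega>" "(\<lambda>n. measure (M n) (A n)) \<longlonglongrightarrow> 1"
    using E unfolding with_high_prob_def by blast
  obtain B where B: "\<And>n. B n \<in> sets (M n)" "\<And>n \<omega>. \<omega> \<in> B n \<Longrightarrow> F n \<omega>" "(\<lambda>n. measure (M n) (B n)) \<longlonglongrightarrow> 1"
    using F unfolding with_high_prob_def by blast
  have "(\<lambda>n. measure (M n) (A n \<inter> B n)) \<longlonglongrightarrow> 1"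
  proof (rule tendsto_sandwich)
    have "measure (M n) (A n) + measure (M n) (B n) - 1 \<le> measure (M n) (A n \<inter> B n)" for n
    proof -
      interpret prob_space "M n" by (rule P)
      have "prob (A n \<union> B n) = prob (A n) + prob (B n) - prob (A n \<inter> B n)"
        using A(1) B(1) finite_measure_Union'[of "A n" "B n"] finite_measure_Diff'[of "B n" "A n"] by (simp add: Int_commute)
      then show ?thesis using prob_le_1[of "A n \<union> B n"] by linarith
    qed
    then show "\<forall>\<^sub>F n in sequentially. measure (M n) (A n) + measure (M n) (B n) - 1 \<le> measure (M n) (A n \<inter> B n)" by simp
    show "\<forall>\<^sub>F n in sequentially. measure (M n) (A n \<inter> B n) \<le> 1"
      using P by (simp add: prob_space.prob_le_1)
    have "(\<lambda>n. measure (M n) (A n) + measure (M n) (B n) - 1) \<longlonglongrightarrow> 1 + 1 - 1"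
      by (intro tendsto_intros A B)
    then show "(\<lambda>n. measure (M n) (A n) + measure (M n) (B n) - 1) \<longlonglongrightarrow> 1" by simp
  qed simp
  moreover have "A n \<inter> B n \<in> sets (M n)" for n using A(1) B(1) by blast
  ultimately show ?thesis unfolding with_high_prob_def using A(2) B(2) by (intro exI[of _ "\<lambda>n. A n \<inter> B n"]) auto
qed

lemma with_high_prob_True:
  assumes "\<And>n. prob_space (M n)"
  shows "with_high_prob M (\<lambda>_ _. True)"
  unfolding with_high_prob_def using assms
  by (intro exI[of _ "\<lambda>n. space (M n)"]) (auto simp: prob_space.prob_space)

lemma with_high_prob_ball:
  assumes P: "\<And>n. prob_space (M n)" and "finite J" and "\<And>j. j \<in> J \<Longrightarrow> with_high_prob M (E j)"
  shows "with_high_prob M (\<lambda>n \<omega>. \<forall>j\<in>J. E j n \<omega>)"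
  using assms(2,3)
proof (induction J rule: finite_induct)
  case empty
  then show ?case using with_high_prob_True[OF P] by simp
next
  case (insert j J)
  then have "with_high_prob M (\<lambda>n \<omega>. E j n \<omega> \<and> (\<forall>j\<in>J. E j n \<omega>))"
    by (intro with_high_prob_conj P) auto
  then show ?case by simp
qed

lemma with_high_probI:
  assumes P: "\<And>n. prob_space (M n)" and B: "\<And>n. B n \<in> sets (M n)" and lim: "(\<lambda>n. measure (M n) (B n)) \<longlonglongrightarrow> 0"
    and E: "\<And>n \<omega>. \<omega> \<in> space (M n) \<Longrightarrow> \<omega> \<notin> B n \<Longrightarrow> E n \<omega>"
  shows "with_high_prob M E"
  unfolding with_high_prob_def
proof (intro exI conjI allI ballI)
  show "space (M n) - B n \<in> sets (M n)" for n using B by auto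
  show "E n \<omega>" if "\<omega> \<in> space (M n) - B n" for n \<omega> using that E by auto
  have "(\<lambda>n. 1 - measure (M n) (B n)) \<longlonglongrightarrow> 1 - 0" by (intro tendsto_intros lim)
  then show "(\<lambda>n. measure (M n) (space (M n) - B n)) \<longlonglongrightarrow> 1"
    using P B by (simp add: prob_space.prob_compl)
qed

lemma with_high_prob_markov:
  fixes Z :: "nat \<Rightarrow> 'a \<Rightarrow> real"
  assumes P: "\<And>n. prob_space (M n)" and int: "\<And>n. integrable (M n) (Z n)" and nn: "\<And>n \<omega>. Z n \<omega> \<ge> 0"
    and lim: "(\<lambda>n. \<integral>\<omega>. Z n \<omega> \<partial>M n) \<longlonglongrightarrow> 0" and e: "e > 0"
  shows "with_high_prob M (\<lambda>n \<omega>. Z n \<omega> \<le> e)"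
proof (rule with_high_probI[OF P])
  have m[measurable]: "Z n \<in> borel_measurable (M n)" for n using int by auto
  show "{\<omega> \<in> space (M n). Z n \<omega> \<ge> e} \<in> sets (M n)" for n by measurable
  show "(\<lambda>n. measure (M n) {\<omega> \<in> space (M n). Z n \<omega> \<ge> e}) \<longlonglongrightarrow> 0"
  proof (rule tendsto_sandwich[of "\<lambda>_. 0"])
    have "measure (M n) {\<omega> \<in> space (M n). Z n \<omega> \<ge> e} \<le> (\<integral>\<omega>. Z n \<omega> \<partial>M n) / e" for n
      using integral_Markov_inequality_measure[OF int, of "{}" n e] nn e by simp
    then show "\<forall>\<^sub>F n in sequentially. measure (M n) {\<omega> \<in> space (M n). Z n \<omega> \<ge> e} \<le> (\<integral>\<omega>. Z n \<omega> \<partial>M n) / e" by simp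
    show "(\<lambda>n. (\<integral>\<omega>. Z n \<omega> \<partial>M n) / e) \<longlonglongrightarrow> 0" using tendsto_divide[OF lim tendsto_const[of e]] e by simp
  qed auto
qed auto

lemma with_high_prob_Max:
  fixes Z :: "nat \<Rightarrow> nat \<Rightarrow> 'a \<Rightarrow> real"
  assumes P: "\<And>n. prob_space (M n)" and Z: "\<And>n i. i \<in> {1..n} \<Longrightarrow> Z n i \<in> borel_measurable (M n)"
    and lim: "(\<lambda>n. measure (M n) {\<omega> \<in> space (M n). (MAX i\<in>{1..n}. Z n i \<omega>) > k n}) \<longlonglongrightarrow> 0"
  shows "with_high_prob M (\<lambda>n \<omega>. \<forall>i\<in>{1..n}. Z n i \<omega> \<le> k n)"
proof (rule with_high_probI[OF P])
  let ?B = "\<lambda>n. \<Union>i\<in>{1..n}. {\<omega> \<in> space (M n). Z n i \<omega> > k n}"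
  show "?B n \<in> sets (M n)" for n
  proof (rule sets.finite_UN)
    fix i assume "i \<in> {1..n}"
    note [measurable] = Z[OF this]
    show "{\<omega> \<in> space (M n). Z n i \<omega> > k n} \<in> sets (M n)" by measurable
  qed simp
  \<comment> \<open>For \<open>n = 0\<close> the maximum is over the empty set and carries no
    information, so the events are compared only for positive \<open>n\<close>.\<close>
  have "\<forall>\<^sub>F n in sequentially. {\<omega> \<in> space (M n). (MAX i\<in>{1..n}. Z n i \<omega>) > k n} = ?B n"
    using eventually_gt_at_top[of 0]
  proof (rule eventually_mono)
    fix n :: nat assume n: "0 < n"
    then have "(MAX i\<in>{1..n}. Z n i \<omega>) > k n \<longleftrightarrow> (\<exists>i\<in>{1..n}. Z n i \<omega> > k n)" for \<omega>
      by (subst Max_gr_iff) auto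
    then show "{\<omega> \<in> space (M n). (MAX i\<in>{1..n}. Z n i \<omega>) > k n} = ?B n" by auto
  qed
  then have "\<forall>\<^sub>F n in sequentially. measure (M n) {\<omega> \<in> space (M n). (MAX i\<in>{1..n}. Z n i \<omega>) > k n} = measure (M n) (?B n)"
    by (rule eventually_mono) simp
  then show "(\<lambda>n. measure (M n) (?B n)) \<longlonglongrightarrow> 0" using lim by (rule Lim_transform_eventually[rotated])
  show "\<forall>i\<in>{1..n}. Z n i \<omega> \<le> k n" if "\<omega> \<in> space (M n)" "\<omega> \<notin> ?B n" for n \<omega>
    using that by (auto simp: not_less)
qed

section \<open>A law of large numbers in mean\<close>

text \<open>Only a first moment is assumed, hence the truncation behind \<open>expectation_abs_sum_truncated\<close>.\<close>

lemma weak_law_of_large_numbers_L1: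
  fixes Z :: "nat \<Rightarrow> nat \<Rightarrow> 'a \<Rightarrow> real"
  assumes P: "\<And>n. prob_space (M n)"
    and J: "\<And>n. J n \<subseteq> {1..n}" "(\<lambda>n. card (J n) / n) \<longlonglongrightarrow> 1"
    and ind: "\<And>n. prob_space.indep_vars (M n) (\<lambda>_. borel) (Z n) (J n)"
    and D: "\<And>n i. i \<in> J n \<Longrightarrow> distr (M n) borel (Z n i) = D" and pD: "prob_space D" "sets D = sets borel"
    and int: "integrable D (\<lambda>z. z)"
  shows "(\<lambda>n. \<integral>\<omega>. \<bar>(\<Sum>i\<in>J n. Z n i \<omega>) / n - (\<integral>z. z \<partial>D)\<bar> \<partial>M n) \<longlonglongrightarrow> 0"
    and "integrable (M n) (\<lambda>\<omega>. \<bar>(\<Sum>i\<in>J n. Z n i \<omega>) / n - (\<integral>z. z \<partial>D)\<bar>)"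
proof -
  interpret D: prob_space D by fact
  note [measurable_cong] = pD(2)
  define m where "m = (\<integral>z. z \<partial>D)"
  define T where "T K = (\<integral>z. \<bar>z\<bar> * indicator {z. \<bar>z\<bar> > K} z \<partial>D)" for K :: real
  have fin: "finite (J n)" for n using J(1) finite_subset by blast
  have cJ: "card (J n) \<le> n" for n using card_mono[OF _ J(1)[of n]] by simp
  have tr: "integrable (M n) (\<lambda>\<omega>. \<Sum>i\<in>J n. Z n i \<omega> - m)"
    "(\<integral>\<omega>. \<bar>\<Sum>i\<in>J n. Z n i \<omega> - m\<bar> \<partial>M n) \<le> K * sqrt (card (J n)) + 2 * card (J n) * T K" if "K \<ge> 0" for n K
    using prob_space.expectation_abs_sum_truncated[OF P fin ind D int that] unfolding m_def T_def by auto
  \<comment> \<open>The sum has \<open>card (J n)\<close> terms but is divided by \<open>n\<close>;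
    the second term is the resulting bias, which vanishes since the ratio tends to 1.\<close>
  have eq: "(\<Sum>i\<in>J n. Z n i \<omega>) / n - m = (\<Sum>i\<in>J n. Z n i \<omega> - m) / n + (card (J n) / n - 1) * m" for n \<omega>
    by (simp add: sum_subtractf diff_divide_distrib left_diff_distrib)
  have int1: "integrable (M n) (\<lambda>\<omega>. (\<Sum>i\<in>J n. Z n i \<omega>) / n - m)" for n
  proof -
    interpret prob_space "M n" by (rule P)
    show ?thesis unfolding eq using tr(1)[of 0 n] by auto
  qed
  then show "integrable (M n) (\<lambda>\<omega>. \<bar>(\<Sum>i\<in>J n. Z n i \<omega>) / n - (\<integral>z. z \<partial>D)\<bar>)" unfolding m_def by auto
  have bound: "(\<integral>\<omega>. \<bar>(\<Sum>i\<in>J n. Z n i \<omega>) / n - m\<bar> \<partial>M n)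
      \<le> K * (sqrt n / n) + 2 * T K + \<bar>card (J n) / n - 1\<bar> * \<bar>m\<bar>" if K: "K \<ge> 0" for n K
  proof -
    interpret prob_space "M n" by (rule P)
    have T0: "T K \<ge> 0" unfolding T_def by (intro integral_nonneg_AE) auto
    have "(\<integral>\<omega>. \<bar>(\<Sum>i\<in>J n. Z n i \<omega>) / n - m\<bar> \<partial>M n)
        \<le> (\<integral>\<omega>. \<bar>\<Sum>i\<in>J n. Z n i \<omega> - m\<bar> / n + \<bar>card (J n) / n - 1\<bar> * \<bar>m\<bar> \<partial>M n)"
    proof (rule integral_mono)
      show "\<bar>(\<Sum>i\<in>J n. Z n i \<omega>) / n - m\<bar> \<le> \<bar>\<Sum>i\<in>J n. Z n i \<omega> - m\<bar> / n + \<bar>card (J n) / n - 1\<bar> * \<bar>m\<bar>" for \<omega>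
        unfolding eq using abs_triangle_ineq[of "(\<Sum>i\<in>J n. Z n i \<omega> - m) / n" "(card (J n) / n - 1) * m"]
        by (simp add: abs_mult)
    qed (use int1 tr(1)[OF K] in auto)
    also have "\<dots> = (\<integral>\<omega>. \<bar>\<Sum>i\<in>J n. Z n i \<omega> - m\<bar> \<partial>M n) / n + \<bar>card (J n) / n - 1\<bar> * \<bar>m\<bar>"
      using tr(1)[OF K, of n] by (simp add: prob_space)
    also have "(\<integral>\<omega>. \<bar>\<Sum>i\<in>J n. Z n i \<omega> - m\<bar> \<partial>M n) / n \<le> (K * sqrt (card (J n)) + 2 * card (J n) * T K) / n"
      using tr(2)[OF K] by (intro divide_right_mono) auto
    also have "\<dots> \<le> (K * sqrt n + 2 * n * T K) / n"
      using K T0 cJ[of n] by (intro divide_right_mono add_mono mult_left_mono mult_right_mono) auto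
    also have "\<dots> \<le> K * (sqrt n / n) + 2 * T K"
      using T0 by (cases "n = 0") (auto simp: add_divide_distrib)
    finally show ?thesis by simp
  qed
  have "(\<lambda>k. T (real k)) \<longlonglongrightarrow> (\<integral>z. 0 \<partial>D)"
    unfolding T_def
  proof (rule integral_dominated_convergence[where w="\<lambda>z. \<bar>z\<bar>"])
    show "AE z in D. (\<lambda>k. \<bar>z\<bar> * indicator {z. \<bar>z\<bar> > real k} z) \<longlonglongrightarrow> 0"
    proof (rule AE_I2, rule tendsto_eventually)
      fix z :: real
      obtain k0 where "\<bar>z\<bar> \<le> real k0" using real_arch_simple by blast
      then show "\<forall>\<^sub>F k in sequentially. \<bar>z\<bar> * indicator {z. \<bar>z\<bar> > real k} z = 0"
        by (intro eventually_sequentiallyI[of k0]) auto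
    qed
    show "integrable D (\<lambda>z. \<bar>z\<bar>)" using int by (rule integrable_abs)
    show "AE z in D. norm (\<bar>z\<bar> * indicator {z. \<bar>z\<bar> > real k} z) \<le> \<bar>z\<bar>" for k
      by (rule AE_I2) (simp add: indicator_def)
    show "(\<lambda>z. \<bar>z\<bar> * indicator {z. \<bar>z\<bar> > real k} z) \<in> borel_measurable D" for k
      by measurable
  qed simp
  then have T: "(\<lambda>k. T (real k)) \<longlonglongrightarrow> 0" by simp
  show "(\<lambda>n. \<integral>\<omega>. \<bar>(\<Sum>i\<in>J n. Z n i \<omega>) / n - (\<integral>z. z \<partial>D)\<bar> \<partial>M n) \<longlonglongrightarrow> 0"
    unfolding m_def[symmetric]
  proof (rule tendstoI)
    fix r :: real assume r: "r > 0"
    \<comment> \<open>The truncation level is fixed first: its tail term does not depend on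
      \<open>n\<close>, and the term growing with the level is killed by \<open>n\<close>
      afterwards.\<close>
    have "\<forall>\<^sub>F k in sequentially. T (real k) < r / 4" using T r by (intro order_tendstoD) auto
    then obtain k where k: "T (real k) < r / 4" by (meson eventually_sequentially order_refl)
    have "(\<lambda>n. sqrt (real n) / n) \<longlonglongrightarrow> 0"
      unfolding sqrt_divide_self_eq[OF of_nat_0_le_iff]
      by (rule tendsto_inverse_0_at_top[OF filterlim_compose[OF sqrt_at_top filterlim_real_sequentially]])
    then have "(\<lambda>n. real k * (sqrt n / n) + \<bar>card (J n) / n - 1\<bar> * \<bar>m\<bar>) \<longlonglongrightarrow> real k * 0 + \<bar>1 - 1\<bar> * \<bar>m\<bar>"
      by (intro tendsto_intros J(2))
    then have "\<forall>\<^sub>F n in sequentially. real k * (sqrt n / n) + \<bar>card (J n) / n - 1\<bar> * \<bar>m\<bar> < r / 2"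
      using r by (intro order_tendstoD) auto
    then show "\<forall>\<^sub>F n in sequentially. dist (\<integral>\<omega>. \<bar>(\<Sum>i\<in>J n. Z n i \<omega>) / n - m\<bar> \<partial>M n) 0 < r"
    proof (rule eventually_mono)
      fix n assume "real k * (sqrt n / n) + \<bar>card (J n) / n - 1\<bar> * \<bar>m\<bar> < r / 2"
      moreover have "0 \<le> (\<integral>\<omega>. \<bar>(\<Sum>i\<in>J n. Z n i \<omega>) / n - m\<bar> \<partial>M n)" by simp
      ultimately show "dist (\<integral>\<omega>. \<bar>(\<Sum>i\<in>J n. Z n i \<omega>) / n - m\<bar> \<partial>M n) 0 < r"
        using bound[OF of_nat_0_le_iff, of n k] k unfolding dist_real_def by linarith
    qed
  qed
qed

lemma tendsto_zero_of_mult_square: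
  fixes c :: "nat \<Rightarrow> real"
  assumes "(\<lambda>n. real n * (c n)\<^sup>2) \<longlonglongrightarrow> w"
  shows "c \<longlonglongrightarrow> 0"
proof -
  have "(\<lambda>n. (real n * (c n)\<^sup>2) * inverse (real n)) \<longlonglongrightarrow> w * 0"
    by (intro tendsto_mult assms lim_inverse_n)
  moreover have "\<forall>\<^sub>F n in sequentially. (real n * (c n)\<^sup>2) * inverse (real n) = (c n)\<^sup>2"
    using eventually_gt_at_top[of 0] by (rule eventually_mono) simp
  ultimately have "(\<lambda>n. (c n)\<^sup>2) \<longlonglongrightarrow> 0" by (simp add: tendsto_cong)
  then have "(\<lambda>n. sqrt ((c n)\<^sup>2)) \<longlonglongrightarrow> sqrt 0" by (rule tendsto_real_sqrt)
  then show ?thesis by (simp add: tendsto_rabs_zero_iff)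
qed

subsection \<open>The estimating equation\<close>

text \<open>Row subsets are needed because clipped observations contribute no term linear in the
  estimation error.\<close>

definition gram_on :: "nat set \<Rightarrow> (nat \<Rightarrow> real^'d) \<Rightarrow> real^'d^'d" where
  "gram_on J x = (\<chi> j k. \<Sum>i\<in>J. x i $ j * x i $ k)"

lemma gram_eq_gram_on: "gram n x = gram_on {1..n} x"
  by (simp add: gram_def gram_on_def)

lemma gram_on_mult: "gram_on J x *v v = (\<Sum>i\<in>J. (x i \<bullet> v) *\<^sub>R x i)"
proof (subst vec_eq_iff, intro allI)
  fix j
  have "(gram_on J x *v v) $ j = (\<Sum>k\<in>UNIV. \<Sum>i\<in>J. x i $ k * v $ k * x i $ j)"
    by (simp add: gram_on_def matrix_vector_mult_def sum_distrib_right sum_distrib_left mult_ac)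
  also have "\<dots> = (\<Sum>i\<in>J. \<Sum>k\<in>UNIV. x i $ k * v $ k * x i $ j)" by (rule sum.swap)
  also have "\<dots> = (\<Sum>i\<in>J. (x i \<bullet> v) *\<^sub>R x i) $ j"
    by (simp add: inner_vec_def sum_distrib_right)
  finally show "(gram_on J x *v v) $ j = (\<Sum>i\<in>J. (x i \<bullet> v) *\<^sub>R x i) $ j" .
qed

text \<open>Multiplying the fixed point equation by the Gram matrix cancels
  \<open>matrix_inv\<close>, which has no known value at singular matrices. The residual minus its
  soft threshold is the clipped residual.\<close>

lemma phi_zero_imp_normal_equations:
  fixes x :: "nat \<Rightarrow> real^'d"
  assumes "invertible (gram n x)" "phi n lam x y b = 0"
  shows "(\<Sum>i=1..n. (y i - x i \<bullet> b - mu_fun lam x y b i) *\<^sub>R x i) = 0"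
proof -
  have "b = matrix_inv (gram n x) *v (\<Sum>i=1..n. (y i - mu_fun lam x y b i) *\<^sub>R x i)"
    using assms(2) by (simp add: phi_def)
  then have "gram n x *v b = gram n x *v (matrix_inv (gram n x) *v (\<Sum>i=1..n. (y i - mu_fun lam x y b i) *\<^sub>R x i))"
    by simp
  also have "\<dots> = (\<Sum>i=1..n. (y i - mu_fun lam x y b i) *\<^sub>R x i)"
    using assms(1) by (simp only: matrix_vector_mul_assoc matrix_inv_right matrix_vector_mul_lid)
  finally have "(\<Sum>i=1..n. (x i \<bullet> b) *\<^sub>R x i) = (\<Sum>i=1..n. (y i - mu_fun lam x y b i) *\<^sub>R x i)"
    by (simp add: gram_eq_gram_on gram_on_mult)
  moreover have "(\<Sum>i=1..n. (y i - x i \<bullet> b - mu_fun lam x y b i) *\<^sub>R x i)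
      = (\<Sum>i=1..n. (y i - mu_fun lam x y b i) *\<^sub>R x i) - (\<Sum>i=1..n. (x i \<bullet> b) *\<^sub>R x i)"
    unfolding sum_subtractf[symmetric] by (intro sum.cong refl) (simp add: algebra_simps)
  ultimately show ?thesis by simp
qed

lemma residual_clip_small: "\<bar>y i - x i \<bullet> b\<bar> \<le> lam \<Longrightarrow> y i - x i \<bullet> b - mu_fun lam x y b i = y i - x i \<bullet> b"
  by (simp add: mu_fun_def)

text \<open>The residual stays so close to \<open>m\<close> that it lies beyond the threshold on the
  side given by the sign of \<open>m\<close>.\<close>

lemma residual_clip_large:
  assumes "\<bar>y i - x i \<bullet> b - m\<bar> + lam < \<bar>m\<bar>" "lam > 0"
  shows "y i - x i \<bullet> b - mu_fun lam x y b i = lam * sgn m"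
proof -
  define r where "r = y i - x i \<bullet> b"
  show ?thesis
  proof (cases "m > 0")
    case True
    then have "r > lam" using assms by (simp flip: r_def)
    then show ?thesis using True assms by (simp add: mu_fun_def flip: r_def)
  next
    case False
    then have "m < 0" "r < - lam" using assms by (auto simp flip: r_def)
    then show ?thesis using assms by (simp add: mu_fun_def flip: r_def)
  qed
qed

text \<open>The budget \<open>2 * gam + kap * R \<le> lam\<close> settles both cases. An unclipped
  residual consists of a parameter and an error of size at most \<open>gam\<close> each and a design
  term of size at most \<open>kap * R\<close>. For a clipped one, error and design term together
  stay within \<open>lam\<close>, while the parameter exceeds \<open>2 * lam\<close>.\<close>

lemma score_equation:
  fixes x :: "nat \<Rightarrow> real^'d"
  assumes inv: "invertible (gram n x)" and zero: "phi n lam x y b = 0"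
    and y: "\<And>i. i \<in> {1..n} \<Longrightarrow> y i = m i + x i \<bullet> \<beta> + e i"
    and xk: "\<And>i. i \<in> {1..n} \<Longrightarrow> norm (x i) \<le> kap" and eg: "\<And>i. i \<in> {1..n} \<Longrightarrow> \<bar>e i\<bar> \<le> gam"
    and R: "norm (b - \<beta>) \<le> R" "2 * gam + kap * R \<le> lam" and lam: "lam > 0" "gam > 0" "kap > 0"
    and s: "s1 + s2 \<le> n" and large: "\<And>i. i \<in> {1..s1} \<Longrightarrow> 2 * lam < \<bar>m i\<bar>"
    and small: "\<And>i. i \<in> {s1 + 1..s1 + s2} \<Longrightarrow> \<bar>m i\<bar> \<le> gam"
    and none: "\<And>i. i \<in> {s1 + s2 + 1..n} \<Longrightarrow> m i = 0"
  shows "gram_on {s1 + 1..n} x *v (b - \<beta>)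
    = (\<Sum>i=1..n. (if i \<le> s1 then lam * sgn (m i) else e i) *\<^sub>R x i) + (\<Sum>i=s1 + 1..s1 + s2. m i *\<^sub>R x i)"
proof -
  define D where "D = b - \<beta>"
  have res: "y i - x i \<bullet> b = m i + e i - x i \<bullet> D" if "i \<in> {1..n}" for i
    using y[OF that] by (simp add: D_def inner_diff_right)
  have xD: "\<bar>x i \<bullet> D\<bar> \<le> kap * R" if "i \<in> {1..n}" for i
  proof -
    have "\<bar>x i \<bullet> D\<bar> \<le> norm (x i) * norm D" by (rule Cauchy_Schwarz_ineq2)
    also have "\<dots> \<le> kap * R" using xk[OF that] R(1) lam by (intro mult_mono) (auto simp: D_def)
    finally show ?thesis .
  qed
  have R0: "kap * R \<ge> 0" using R(1) lam norm_ge_zero[of "b - \<beta>"] by (intro mult_nonneg_nonneg) linarith+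
  have split: "(y i - x i \<bullet> b - mu_fun lam x y b i)
      = (if i \<le> s1 then lam * sgn (m i) else e i) + (if i \<in> {s1 + 1..s1 + s2} then m i else 0)
        - (if i \<in> {s1 + 1..n} then x i \<bullet> D else 0)" if i: "i \<in> {1..n}" for i
  proof (cases "i \<le> s1")
    case True
    have "\<bar>e i - x i \<bullet> D\<bar> \<le> lam" using eg[OF i] xD[OF i] R(2) lam by linarith
    then have "y i - x i \<bullet> b - mu_fun lam x y b i = lam * sgn (m i)"
      using large[of i] True i lam res[OF i] by (intro residual_clip_large) auto
    then show ?thesis using True by simp
  next
    case False
    have mi: "\<bar>m i\<bar> \<le> gam" using small[of i] none[of i] False i lam by (cases "i \<le> s1 + s2") auto
    have "\<bar>y i - x i \<bullet> b\<bar> \<le> lam" unfolding res[OF i] using mi eg[OF i] xD[OF i] R(2) by linarith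
    then have "y i - x i \<bullet> b - mu_fun lam x y b i = m i + e i - x i \<bullet> D"
      using res[OF i] residual_clip_small[of y i x b lam] by simp
    then show ?thesis using False i none[of i] by auto
  qed
  have "(\<Sum>i=1..n. (y i - x i \<bullet> b - mu_fun lam x y b i) *\<^sub>R x i)
      = (\<Sum>i=1..n. (if i \<le> s1 then lam * sgn (m i) else e i) *\<^sub>R x i
          + (if i \<in> {s1 + 1..s1 + s2} then m i *\<^sub>R x i else 0) - (if i \<in> {s1 + 1..n} then (x i \<bullet> D) *\<^sub>R x i else 0))"
    by (intro sum.cong refl, subst split) (auto simp: algebra_simps)
  also have "\<dots> = (\<Sum>i=1..n. (if i \<le> s1 then lam * sgn (m i) else e i) *\<^sub>R x i)
      + (\<Sum>i\<in>{1..n}. if i \<in> {s1 + 1..s1 + s2} then m i *\<^sub>R x i else 0)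
      - (\<Sum>i\<in>{1..n}. if i \<in> {s1 + 1..n} then (x i \<bullet> D) *\<^sub>R x i else 0)"
    by (simp only: sum_subtractf sum.distrib)
  also have "(\<Sum>i\<in>{1..n}. if i \<in> {s1 + 1..s1 + s2} then m i *\<^sub>R x i else 0) = (\<Sum>i=s1 + 1..s1 + s2. m i *\<^sub>R x i)"
    using s by (subst sum.inter_restrict[symmetric]) (auto intro!: sum.cong)
  also have "(\<Sum>i\<in>{1..n}. if i \<in> {s1 + 1..n} then (x i \<bullet> D) *\<^sub>R x i else 0) = (\<Sum>i=s1 + 1..n. (x i \<bullet> D) *\<^sub>R x i)"
    by (subst sum.inter_restrict[symmetric]) (auto intro!: sum.cong)
  finally show ?thesis
    using phi_zero_imp_normal_equations[OF inv zero] by (simp add: gram_on_mult D_def)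
qed

section \<open>Stability of linear systems\<close>

lemma norm_matrix_vector_mult_le:
  fixes A :: "real^'d^'d"
  assumes "\<And>j k. \<bar>A $ j $ k\<bar> \<le> \<eta> / (real CARD('d))\<^sup>2"
  shows "norm (A *v x) \<le> \<eta> * norm x"
proof -
  have "norm (A *v x) \<le> (\<Sum>j\<in>UNIV. \<bar>(A *v x) $ j\<bar>)" by (rule norm_le_l1_cart)
  also have "\<dots> \<le> (\<Sum>j\<in>(UNIV::'d set). \<Sum>k\<in>(UNIV::'d set). \<eta> / (real CARD('d))\<^sup>2 * norm x)"
  proof (rule sum_mono)
    fix j
    have "\<bar>(A *v x) $ j\<bar> \<le> (\<Sum>k\<in>UNIV. \<bar>A $ j $ k * x $ k\<bar>)"
      unfolding matrix_vector_mult_def by (simp add: sum_abs)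
    also have "\<dots> \<le> (\<Sum>k\<in>(UNIV::'d set). \<eta> / (real CARD('d))\<^sup>2 * norm x)"
      unfolding abs_mult using assms component_le_norm_cart
      by (intro sum_mono mult_mono) (auto intro: order_trans[OF abs_ge_zero])
    finally show "\<bar>(A *v x) $ j\<bar> \<le> (\<Sum>k\<in>(UNIV::'d set). \<eta> / (real CARD('d))\<^sup>2 * norm x)" .
  qed
  also have "\<dots> = \<eta> * norm x" by (simp add: power2_eq_square)
  finally show ?thesis .
qed

lemma invertible_bounded_below:
  fixes A :: "real^'d^'d"
  assumes "invertible A"
  obtains m where "m > 0" "\<And>x. m * norm x \<le> norm (A *v x)"
proof -
  have "inj ((*v) A)" using assms by (simp add: invertible_eq_bij bij_is_inj)
  then show thesis
    using linear_inj_bounded_below_pos[OF matrix_vector_mul_linear, of A] that by blast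
qed

text \<open>On a kernel vector of \<open>B\<close> the difference acts as \<open>A\<close>, which
  expands it by more than \<eta> allows.\<close>

lemma invertible_of_close:
  fixes A B :: "real^'d^'d"
  assumes m: "\<And>x. m * norm x \<le> norm (A *v x)" and close: "\<And>x. norm ((A - B) *v x) \<le> \<eta> * norm x" and "\<eta> < m"
  shows "invertible B"
proof -
  have "x = 0" if "B *v x = 0" for x
  proof -
    have "m * norm x \<le> \<eta> * norm x"
      using m[of x] close[of x] that by (simp add: matrix_vector_mult_diff_rdistrib)
    then show "x = 0" using \<open>\<eta> < m\<close> by (simp add: mult_le_cancel_right)
  qed
  then show ?thesis
    by (simp add: invertible_left_inverse matrix_left_invertible_ker)
qed

text \<open>From \<open>A *v (Z - T) = (A - S) *v Z + V\<close>, with \<open>Z\<close> split into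
  \<open>Z - T\<close> and \<open>T\<close>: the part with \<open>Z - T\<close> is absorbed on the
  left because \<eta> is at most \<open>m / 2\<close>, and the other two parts contribute at most
  \<open>m * e / 4\<close> each. Thus no bound on \<open>Z\<close> itself is required.\<close>

lemma perturbed_solution_close:
  fixes A S :: "real^'d^'d"
  assumes m: "m > 0" "\<And>x. m * norm x \<le> norm (A *v x)" and close: "\<And>x. norm ((A - S) *v x) \<le> \<eta> * norm x"
    and eta: "0 \<le> \<eta>" "\<eta> \<le> m / 2" "\<eta> * K \<le> m\<^sup>2 * e / 4" "r \<le> m * e / 4"
    and Z: "S *v Z = U + V" and T: "A *v T = U" and U: "norm U \<le> K" and V: "norm V \<le> r"
  shows "norm (Z - T) \<le> e"
proof -
  have "A *v (Z - T) = (A - S) *v Z + V"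
    using Z T by (simp add: matrix_vector_mult_diff_distrib matrix_vector_mult_diff_rdistrib)
  then have "m * norm (Z - T) \<le> \<eta> * norm Z + r"
    using m(2)[of "Z - T"] close[of Z] V norm_triangle_ineq[of "(A - S) *v Z" V] by simp
  also have "\<eta> * norm Z \<le> \<eta> * norm (Z - T) + \<eta> * norm T"
    using norm_triangle_ineq[of "Z - T" T] eta(1) by (simp flip: distrib_left add: mult_left_mono)
  also have "\<eta> * norm (Z - T) \<le> m / 2 * norm (Z - T)" using eta by (intro mult_right_mono) auto
  finally have 1: "m * norm (Z - T) \<le> m / 2 * norm (Z - T) + \<eta> * norm T + r" by simp
  have "m * norm T \<le> K" using m(2)[of T] T U by simp
  then have "m * (\<eta> * norm T) \<le> \<eta> * K" using eta(1) mult_left_mono[of "m * norm T" K \<eta>] by (simp add: mult_ac)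
  also have "\<dots> \<le> m * (m * e / 4)" using eta(3) by (simp add: power2_eq_square)
  finally have "\<eta> * norm T \<le> m * e / 4" using m(1) by simp
  then have "m / 2 * norm (Z - T) \<le> m / 2 * e" using 1 eta(4) by simp
  then show ?thesis using m(1) by simp
qed

lemma coord_box_norm:
  fixes b b0 :: "real^'d"
  assumes "b \<in> coord_box C b0"
  shows "norm (b - b0) \<le> real CARD('d) * C"
proof -
  have "norm (b - b0) \<le> (\<Sum>j\<in>UNIV. \<bar>(b - b0) $ j\<bar>)" by (rule norm_le_l1_cart)
  also have "\<dots> \<le> (\<Sum>j\<in>(UNIV :: 'd set). C)" using assms by (intro sum_mono) (simp add: coord_box_def)
  finally show ?thesis by simp
qed

subsection \<open>The regression model\<close>

lemma (in pair_prob_space) integral_pair_scaleR: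
  fixes f :: "'a \<Rightarrow> 'v::{banach, second_countable_topology}" and g :: "'b \<Rightarrow> real"
  assumes f: "integrable M1 f" and g: "integrable M2 g"
  shows "integrable (M1 \<Otimes>\<^sub>M M2) (\<lambda>(x, y). g y *\<^sub>R f x)"
    and "(\<integral>(x, y). g y *\<^sub>R f x \<partial>(M1 \<Otimes>\<^sub>M M2)) = (\<integral>y. g y \<partial>M2) *\<^sub>R (\<integral>x. f x \<partial>M1)"
proof -
  have [measurable]: "f \<in> borel_measurable M1" "g \<in> borel_measurable M2" using f g by auto
  show 1: "integrable (M1 \<Otimes>\<^sub>M M2) (\<lambda>(x, y). g y *\<^sub>R f x)"
  proof (rule Fubini_integrable)
    have "(\<lambda>x. \<integral>y. norm (case (x, y) of (x, y) \<Rightarrow> g y *\<^sub>R f x) \<partial>M2) = (\<lambda>x. (\<integral>y. \<bar>g y\<bar> \<partial>M2) * norm (f x))"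
      by auto
    then show "integrable M1 (\<lambda>x. \<integral>y. norm (case (x, y) of (x, y) \<Rightarrow> g y *\<^sub>R f x) \<partial>M2)"
      using f by simp
  qed (use g in auto)
  show "(\<integral>(x, y). g y *\<^sub>R f x \<partial>(M1 \<Otimes>\<^sub>M M2)) = (\<integral>y. g y \<partial>M2) *\<^sub>R (\<integral>x. f x \<partial>M1)"
    using integral_fst'[OF 1] f g by simp
qed

locale incidental_regression =
  fixes M :: "nat \<Rightarrow> 'a measure" and M0 :: "'b measure"
    and X :: "nat \<Rightarrow> nat \<Rightarrow> 'a \<Rightarrow> real ^ 'd" and X0 :: "'b \<Rightarrow> real ^ 'd"
    and eps :: "nat \<Rightarrow> nat \<Rightarrow> 'a \<Rightarrow> real" and eps0 :: "'b \<Rightarrow> real"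
    and Y :: "nat \<Rightarrow> nat \<Rightarrow> 'a \<Rightarrow> real"
    and mu :: "nat \<Rightarrow> nat \<Rightarrow> real" and \<beta> :: "real ^ 'd" and SigmaX :: "real ^ 'd ^ 'd"
    and kap gam lam :: "nat \<Rightarrow> real" and s1 s2 :: "nat \<Rightarrow> nat"
    and \<sigma> a \<alpha> C :: real and bhat :: "nat \<Rightarrow> 'a \<Rightarrow> real ^ 'd"
  assumes prob_M0: "prob_space M0" and prob_M: "\<And>n. prob_space (M n)"
    and X0_rv: "X0 \<in> borel_measurable M0"
    and X0_sq_int: "integrable M0 (\<lambda>\<omega>. (norm (X0 \<omega>))\<^sup>2)"
    and X0_mean: "(\<integral>\<omega>. X0 \<omega> \<partial>M0) = 0"
    and X0_cov: "SigmaX = cov_matrix M0 X0" "pos_def_matrix SigmaX"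
    and eps0_rv: "eps0 \<in> borel_measurable M0"
    and eps0_sq_int: "integrable M0 (\<lambda>\<omega>. (eps0 \<omega>)\<^sup>2)"
    and eps0_mean: "(\<integral>\<omega>. eps0 \<omega> \<partial>M0) = 0"
    and eps0_var: "prob_space.variance M0 eps0 = \<sigma>\<^sup>2"
    and X_iid: "\<And>n. iid_copies (M n) {1..n} (X n) M0 X0"
    and eps_iid: "\<And>n. iid_copies (M n) {1..n} (eps n) M0 eps0"
    and X_eps_indep: "\<And>n. indep_families (M n) {1..n} (X n) (eps n)"
    and model: "\<And>n i \<omega>. i \<in> {1..n} \<Longrightarrow> \<omega> \<in> space (M n) \<Longrightarrow>
                  Y n i \<omega> = mu n i + X n i \<omega> \<bullet> \<beta> + eps n i \<omega>"
    and mu: "incidental_parameters kap gam s1 s2 a mu"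
    and A: "assumption_A M X eps kap gam"
    and B: "assumption_B kap gam s1 mu \<alpha> lam"
    and bhat_rv: "\<And>n. bhat n \<in> borel_measurable (M n)"
    and bhat_zero: "with_high_prob M (\<lambda>n \<omega>. bhat n \<omega> \<in> coord_box C \<beta> \<and>
          phi n (lam n) (\<lambda>i. X n i \<omega>) (\<lambda>i. Y n i \<omega>) (bhat n \<omega>) = 0)"
    and small_mu: "(\<lambda>n. real (s2 n)) \<in> o(\<lambda>n. sqrt (real n) / (kap n * gam n)) \<or>
          (\<lambda>n. (mu2_norm s1 s2 mu 2 n)\<^sup>2 / real n) \<longlonglongrightarrow> 0"
begin

sublocale M0: prob_space M0 by (rule prob_M0)

section \<open>The laws of one observation and their moments\<close>

definition "LX = distr M0 borel X0"
definition "Leps = distr M0 borel eps0"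

lemma prob_LX: "prob_space LX" unfolding LX_def by (rule M0.prob_space_distr) (rule X0_rv)
lemma prob_Leps: "prob_space Leps" unfolding Leps_def by (rule M0.prob_space_distr) (rule eps0_rv)

sublocale L: pair_prob_space LX Leps
  using prob_LX prob_Leps
  by (simp add: pair_prob_space_def pair_sigma_finite_def prob_space_imp_sigma_finite)

lemma sets_L [simp, measurable_cong]: "sets LX = sets borel" "sets Leps = sets borel"
  by (simp_all add: LX_def Leps_def)

lemma LX_eq:
  fixes f :: "real^'d \<Rightarrow> 'v::{banach, second_countable_topology}"
  assumes "f \<in> borel_measurable borel"
  shows "integrable LX f \<longleftrightarrow> integrable M0 (\<lambda>\<omega>. f (X0 \<omega>))" "(\<integral>x. f x \<partial>LX) = (\<integral>\<omega>. f (X0 \<omega>) \<partial>M0)"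
  using assms X0_rv by (auto simp: LX_def integrable_distr_eq integral_distr)

lemma Leps_eq:
  fixes f :: "real \<Rightarrow> 'v::{banach, second_countable_topology}"
  assumes "f \<in> borel_measurable borel"
  shows "integrable Leps f \<longleftrightarrow> integrable M0 (\<lambda>\<omega>. f (eps0 \<omega>))" "(\<integral>x. f x \<partial>Leps) = (\<integral>\<omega>. f (eps0 \<omega>) \<partial>M0)"
  using assms eps0_rv by (auto simp: Leps_def integrable_distr_eq integral_distr)

lemma Leps_moments:
  "integrable Leps (\<lambda>e. e)" "(\<integral>e. e \<partial>Leps) = 0" "integrable Leps (\<lambda>e. e\<^sup>2)" "(\<integral>e. e\<^sup>2 \<partial>Leps) = \<sigma>\<^sup>2"
proof -
  have "integrable M0 eps0" by (rule M0.square_integrable_imp_integrable[OF eps0_rv eps0_sq_int])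
  then show "integrable Leps (\<lambda>e. e)" "(\<integral>e. e \<partial>Leps) = 0" "integrable Leps (\<lambda>e. e\<^sup>2)" "(\<integral>e. e\<^sup>2 \<partial>Leps) = \<sigma>\<^sup>2"
    using eps0_mean eps0_sq_int eps0_var by (simp_all add: Leps_eq)
qed

lemma LX_norm_sq: "integrable LX (\<lambda>x. (norm x)\<^sup>2)"
  using X0_sq_int by (simp add: LX_eq)

lemma LX_mean: "integrable LX (\<lambda>x. x)" "(\<integral>x. x \<partial>LX) = 0"
proof -
  have "integrable M0 (\<lambda>\<omega>. norm (X0 \<omega>))"
    by (rule M0.square_integrable_imp_integrable[OF _ X0_sq_int]) (use X0_rv in measurable)
  then have "integrable M0 X0" using X0_rv by (simp add: integrable_norm_iff)
  then show "integrable LX (\<lambda>x. x)" "(\<integral>x. x \<partial>LX) = 0" using X0_mean by (simp_all add: LX_eq)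
qed

lemma LX_prod_int: "integrable LX (\<lambda>x. (x \<bullet> u) * (x \<bullet> v))"
proof (rule Bochner_Integration.integrable_bound)
  show "integrable LX (\<lambda>x. norm u * norm v * (norm x)\<^sup>2)" using LX_norm_sq by simp
  have "\<bar>x \<bullet> u\<bar> * \<bar>x \<bullet> v\<bar> \<le> (norm x * norm u) * (norm x * norm v)" for x
    by (intro mult_mono Cauchy_Schwarz_ineq2) auto
  then show "AE x in LX. norm ((x \<bullet> u) * (x \<bullet> v)) \<le> norm (norm u * norm v * (norm x)\<^sup>2)"
    by (intro AE_I2) (simp add: abs_mult power2_eq_square mult_ac)
qed simp

lemma LX_cov: "(\<integral>x. x $ j * x $ k \<partial>LX) = SigmaX $ j $ k" "integrable LX (\<lambda>x. x $ j * x $ k)"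
proof -
  have "integrable M0 X0" using LX_mean(1) by (simp add: LX_eq)
  then have "(\<integral>\<omega>. X0 \<omega> $ j \<partial>M0) = (\<integral>\<omega>. X0 \<omega> \<partial>M0) $ j" for j
    using integral_bounded_linear[OF bounded_linear_vec_nth, of M0 X0 j] by simp
  then have "(\<integral>\<omega>. X0 \<omega> $ j \<partial>M0) = 0" for j by (simp add: X0_mean)
  then show "(\<integral>x. x $ j * x $ k \<partial>LX) = SigmaX $ j $ k" by (simp add: LX_eq X0_cov(1) cov_matrix_def)
  show "integrable LX (\<lambda>x. x $ j * x $ k)"
    using LX_prod_int[of "axis j 1" "axis k 1"] by (simp add: inner_axis)
qed

lemma LX_inner: "(\<integral>x. x \<bullet> u \<partial>LX) = 0" "integrable LX (\<lambda>x. (x \<bullet> u)\<^sup>2)" "(\<integral>x. (x \<bullet> u)\<^sup>2 \<partial>LX) = u \<bullet> (SigmaX *v u)"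
proof -
  show "(\<integral>x. x \<bullet> u \<partial>LX) = 0" using LX_mean by simp
  show "integrable LX (\<lambda>x. (x \<bullet> u)\<^sup>2)" using LX_prod_int[of u u] by (simp add: power2_eq_square)
  have "(x \<bullet> u)\<^sup>2 = (\<Sum>j\<in>UNIV. \<Sum>k\<in>UNIV. u $ j * u $ k * (x $ j * x $ k))" for x
    by (simp add: inner_vec_def power2_eq_square sum_product mult_ac)
  then have "(\<integral>x. (x \<bullet> u)\<^sup>2 \<partial>LX) = (\<Sum>j\<in>UNIV. \<Sum>k\<in>UNIV. u $ j * u $ k * SigmaX $ j $ k)"
    using LX_cov by simp
  also have "\<dots> = u \<bullet> (SigmaX *v u)"
    by (simp add: inner_vec_def matrix_vector_mult_def sum_distrib_left mult_ac)
  finally show "(\<integral>x. (x \<bullet> u)\<^sup>2 \<partial>LX) = u \<bullet> (SigmaX *v u)" .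
qed

lemma X_props: "prob_space.indep_vars (M n) (\<lambda>_. borel) (X n) {1..n}" "i \<in> {1..n} \<Longrightarrow> distr (M n) borel (X n i) = LX"
  using X_iid[of n] by (auto simp: iid_copies_def LX_def)

lemma eps_props: "prob_space.indep_vars (M n) (\<lambda>_. borel) (eps n) {1..n}" "i \<in> {1..n} \<Longrightarrow> distr (M n) borel (eps n i) = Leps"
  using eps_iid[of n] by (auto simp: iid_copies_def Leps_def)

lemma X_measurable [measurable (raw)]: "i \<in> {1..n} \<Longrightarrow> X n i \<in> borel_measurable (M n)"
  using X_props(1)[of n] prob_M[of n] by (simp add: prob_space.indep_vars_def2)

lemma eps_measurable [measurable (raw)]: "i \<in> {1..n} \<Longrightarrow> eps n i \<in> borel_measurable (M n)"
  using eps_props(1)[of n] prob_M[of n] by (simp add: prob_space.indep_vars_def2)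

lemma pair_props:
  shows "prob_space.indep_vars (M n) (\<lambda>_. borel \<Otimes>\<^sub>M borel) (\<lambda>i \<omega>. (X n i \<omega>, eps n i \<omega>)) {1..n}"
    and "i \<in> {1..n} \<Longrightarrow> distr (M n) (borel \<Otimes>\<^sub>M borel) (\<lambda>\<omega>. (X n i \<omega>, eps n i \<omega>)) = LX \<Otimes>\<^sub>M Leps"
  using prob_space.indep_vars_Pair[OF prob_M X_props(1) eps_props(1) X_eps_indep]
    prob_space.distr_Pair_indep_families[OF prob_M X_props(1) eps_props(1) X_eps_indep]
  by (auto simp: X_props(2) eps_props(2))

text \<open>The spaces \<open>M n\<close> vary with \<open>n\<close>; moving integrals to the fixed
  product law leaves constants that depend on neither \<open>n\<close> nor the space.\<close>

lemma pair_transfer: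
  fixes f :: "(real^'d) \<times> real \<Rightarrow> 'v::{banach, second_countable_topology}"
  assumes i: "i \<in> {1..n}" and f[measurable]: "f \<in> borel_measurable (borel \<Otimes>\<^sub>M borel)"
  shows "integrable (M n) (\<lambda>\<omega>. f (X n i \<omega>, eps n i \<omega>)) \<longleftrightarrow> integrable (LX \<Otimes>\<^sub>M Leps) f"
    and "(\<integral>\<omega>. f (X n i \<omega>, eps n i \<omega>) \<partial>M n) = (\<integral>p. f p \<partial>(LX \<Otimes>\<^sub>M Leps))"
proof -
  have "(\<lambda>\<omega>. (X n i \<omega>, eps n i \<omega>)) \<in> M n \<rightarrow>\<^sub>M borel \<Otimes>\<^sub>M borel"
    using i by measurable
  then show "integrable (M n) (\<lambda>\<omega>. f (X n i \<omega>, eps n i \<omega>)) \<longleftrightarrow> integrable (LX \<Otimes>\<^sub>M Leps) f"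
    and "(\<integral>\<omega>. f (X n i \<omega>, eps n i \<omega>) \<partial>M n) = (\<integral>p. f p \<partial>(LX \<Otimes>\<^sub>M Leps))"
    unfolding pair_props(2)[OF i, symmetric] by (simp_all add: integrable_distr_eq integral_distr)
qed

section \<open>The score and the contribution of the small parameters\<close>

text \<open>The score at the truth: observations with a large incidental parameter are clipped to \<open>\<plusminus> lam\<close>.\<close>

definition weight :: "nat \<Rightarrow> nat \<Rightarrow> real \<Rightarrow> real"
  where "weight n i e = (if i \<le> s1 n then lam n * sgn (mu n i) else e)"

definition U :: "nat \<Rightarrow> 'a \<Rightarrow> real^'d"
  where "U n \<omega> = (\<Sum>i=1..n. weight n i (eps n i \<omega>) *\<^sub>R X n i \<omega>)"

definition V :: "nat \<Rightarrow> 'a \<Rightarrow> real^'d"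
  where "V n \<omega> = (\<Sum>i=s1 n + 1..s1 n + s2 n. mu n i *\<^sub>R X n i \<omega>)"

definition EX2 :: real where "EX2 = (\<integral>x. (norm x)\<^sup>2 \<partial>LX)"

lemma weight_measurable [measurable]: "weight n i \<in> borel_measurable borel"
  unfolding weight_def[abs_def] by measurable

lemma weight_sq: "integrable Leps (weight n i)" "integrable Leps (\<lambda>e. (weight n i e)\<^sup>2)"
  "(\<integral>e. (weight n i e)\<^sup>2 \<partial>Leps) = (if i \<le> s1 n then (lam n)\<^sup>2 * (sgn (mu n i))\<^sup>2 else \<sigma>\<^sup>2)"
proof -
  have w: "weight n i = (if i \<le> s1 n then (\<lambda>_. lam n * sgn (mu n i)) else (\<lambda>e. e))"
    by (auto simp: weight_def)
  have p: "measure Leps (space Leps) = 1" by (rule L.M2.prob_space)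
  show "integrable Leps (weight n i)" "integrable Leps (\<lambda>e. (weight n i e)\<^sup>2)"
    "(\<integral>e. (weight n i e)\<^sup>2 \<partial>Leps) = (if i \<le> s1 n then (lam n)\<^sup>2 * (sgn (mu n i))\<^sup>2 else \<sigma>\<^sup>2)"
    unfolding w by (cases "i \<le> s1 n"; simp add: Leps_moments power_mult_distrib p)+
qed

lemma s_le: "s1 n + s2 n \<le> n" using mu by (simp add: incidental_parameters_def)

lemma U_measurable [measurable]: "U n \<in> borel_measurable (M n)"
  unfolding U_def[abs_def] by measurable

lemma V_measurable [measurable]: "V n \<in> borel_measurable (M n)"
  unfolding V_def[abs_def]
proof (rule borel_measurable_sum)
  fix i assume "i \<in> {s1 n + 1..s1 n + s2 n}"
  then have "i \<in> {1..n}" using s_le[of n] by auto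
  then show "(\<lambda>\<omega>. mu n i *\<^sub>R X n i \<omega>) \<in> borel_measurable (M n)" by measurable
qed

text \<open>The summands are independent and centred, so second moments add: at most
  \<open>(lam n)\<^sup>2 * EX2\<close> for a clipped observation,
  \<open>\<sigma>\<^sup>2 * EX2\<close> for any other. The bound is what keeps the rescaled
  \<open>U\<close> tight.\<close>

lemma U_second_moment:
  "integrable (M n) (\<lambda>\<omega>. (norm (U n \<omega>))\<^sup>2)"
  "(\<integral>\<omega>. (norm (U n \<omega>))\<^sup>2 \<partial>M n) \<le> (real (s1 n) * (lam n)\<^sup>2 + real n * \<sigma>\<^sup>2) * EX2"
proof -
  interpret prob_space "M n" by (rule prob_M)
  define G where "G i p = weight n i (snd p) *\<^sub>R fst p" for i and p :: "(real^'d) \<times> real"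
  have [measurable]: "G i \<in> borel_measurable (borel \<Otimes>\<^sub>M borel)" for i unfolding G_def[abs_def] by measurable
  have G2: "integrable (LX \<Otimes>\<^sub>M Leps) (\<lambda>p. (norm (G i p))\<^sup>2)"
    "(\<integral>p. (norm (G i p))\<^sup>2 \<partial>(LX \<Otimes>\<^sub>M Leps)) = (if i \<le> s1 n then (lam n)\<^sup>2 * (sgn (mu n i))\<^sup>2 else \<sigma>\<^sup>2) * EX2" for i
  proof -
    have eq: "(\<lambda>p. (norm (G i p))\<^sup>2) = (\<lambda>(x, e). (weight n i e)\<^sup>2 *\<^sub>R (norm x)\<^sup>2)"
      by (auto simp: G_def power_mult_distrib)
    show "integrable (LX \<Otimes>\<^sub>M Leps) (\<lambda>p. (norm (G i p))\<^sup>2)"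
      "(\<integral>p. (norm (G i p))\<^sup>2 \<partial>(LX \<Otimes>\<^sub>M Leps)) = (if i \<le> s1 n then (lam n)\<^sup>2 * (sgn (mu n i))\<^sup>2 else \<sigma>\<^sup>2) * EX2"
      unfolding eq using L.integral_pair_scaleR[OF LX_norm_sq weight_sq(2)] by (simp_all add: weight_sq(3) EX2_def)
  qed
  have G1: "(\<integral>p. G i p \<partial>(LX \<Otimes>\<^sub>M Leps)) = 0" for i
  proof -
    have eq: "G i = (\<lambda>(x, e). weight n i e *\<^sub>R x)" by (auto simp: G_def)
    show ?thesis unfolding eq using L.integral_pair_scaleR(2)[OF LX_mean(1) weight_sq(1)] by (simp add: LX_mean)
  qed
  have "integrable (M n) (\<lambda>\<omega>. (norm (\<Sum>i\<in>{1..n}. G i (X n i \<omega>, eps n i \<omega>)))\<^sup>2)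
    \<and> expectation (\<lambda>\<omega>. (norm (\<Sum>i\<in>{1..n}. G i (X n i \<omega>, eps n i \<omega>)))\<^sup>2)
      = (\<Sum>i\<in>{1..n}. expectation (\<lambda>\<omega>. (norm (G i (X n i \<omega>, eps n i \<omega>)))\<^sup>2))"
  proof (rule expectation_norm_sum_squared)
    show "indep_vars (\<lambda>_. borel) (\<lambda>i \<omega>. G i (X n i \<omega>, eps n i \<omega>)) {1..n}"
      by (rule indep_vars_compose2[OF pair_props(1), where Y=G]) measurable
    show "integrable (M n) (\<lambda>\<omega>. (norm (G i (X n i \<omega>, eps n i \<omega>)))\<^sup>2)" if "i \<in> {1..n}" for i
      using pair_transfer(1)[OF that, of "\<lambda>p. (norm (G i p))\<^sup>2"] G2(1) by simp
    show "expectation (\<lambda>\<omega>. G i (X n i \<omega>, eps n i \<omega>)) = 0" if "i \<in> {1..n}" for i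
      using pair_transfer(2)[OF that, of "G i"] G1 by simp
  qed simp
  moreover have "expectation (\<lambda>\<omega>. (norm (G i (X n i \<omega>, eps n i \<omega>)))\<^sup>2)
      = (if i \<le> s1 n then (lam n)\<^sup>2 * (sgn (mu n i))\<^sup>2 else \<sigma>\<^sup>2) * EX2" if "i \<in> {1..n}" for i
    using pair_transfer(2)[OF that, of "\<lambda>p. (norm (G i p))\<^sup>2"] G2(2) by simp
  ultimately have *: "integrable (M n) (\<lambda>\<omega>. (norm (U n \<omega>))\<^sup>2)"
    "expectation (\<lambda>\<omega>. (norm (U n \<omega>))\<^sup>2) = (\<Sum>i=1..n. (if i \<le> s1 n then (lam n)\<^sup>2 * (sgn (mu n i))\<^sup>2 else \<sigma>\<^sup>2) * EX2)"
    by (simp_all add: U_def G_def)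
  show "integrable (M n) (\<lambda>\<omega>. (norm (U n \<omega>))\<^sup>2)" by fact
  have EX2: "EX2 \<ge> 0" unfolding EX2_def by simp
  \<comment> \<open>Only an inequality: \<open>sgn (mu n i)\<close> may vanish for small
    \<open>n\<close>, and \<sigma>^2 is counted for all \<open>n\<close> observations.\<close>
  have "(\<Sum>i=1..n. if i \<le> s1 n then (lam n)\<^sup>2 * (sgn (mu n i))\<^sup>2 else \<sigma>\<^sup>2)
      \<le> (\<Sum>i=1..n. (if i \<in> {1..s1 n} then (lam n)\<^sup>2 else 0) + \<sigma>\<^sup>2)"
    by (rule sum_mono) (auto simp: sgn_if)
  also have "\<dots> = real (s1 n) * (lam n)\<^sup>2 + real n * \<sigma>\<^sup>2"
  proof -
    have "{1..n} \<inter> {1..s1 n} = {1..s1 n}" using s_le[of n] by auto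
    moreover have "(\<Sum>i\<in>{1..n}. if i \<in> {1..s1 n} then (lam n)\<^sup>2 else 0) = (\<Sum>i\<in>{1..n} \<inter> {1..s1 n}. (lam n)\<^sup>2)"
      by (rule sum.inter_restrict[symmetric]) simp
    ultimately show ?thesis by (simp only: sum.distrib sum_constant card_atLeastAtMost) simp
  qed
  finally show "expectation (\<lambda>\<omega>. (norm (U n \<omega>))\<^sup>2) \<le> (real (s1 n) * (lam n)\<^sup>2 + real n * \<sigma>\<^sup>2) * EX2"
    unfolding *(2) sum_distrib_right[symmetric] using EX2 by (rule mult_right_mono)
qed

lemma V_second_moment:
  "integrable (M n) (\<lambda>\<omega>. (norm (V n \<omega>))\<^sup>2)"
  "(\<integral>\<omega>. (norm (V n \<omega>))\<^sup>2 \<partial>M n) = (mu2_norm s1 s2 mu 2 n)\<^sup>2 * EX2"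
proof -
  interpret prob_space "M n" by (rule prob_M)
  define I where "I = {s1 n + 1..s1 n + s2 n}"
  have I: "I \<subseteq> {1..n}" using s_le[of n] by (auto simp: I_def)
  have tr: "integrable (M n) (\<lambda>\<omega>. f (X n i \<omega>)) \<longleftrightarrow> integrable LX f" "(\<integral>\<omega>. f (X n i \<omega>) \<partial>M n) = (\<integral>x. f x \<partial>LX)"
    if "i \<in> I" and [measurable]: "f \<in> borel_measurable borel" for i and f :: "real^'d \<Rightarrow> 'v::{banach, second_countable_topology}"
  proof -
    have i: "i \<in> {1..n}" using that I by auto
    have d: "LX = distr (M n) borel (X n i)" using X_props(2)[OF i] by simp
    show "integrable (M n) (\<lambda>\<omega>. f (X n i \<omega>)) \<longleftrightarrow> integrable LX f" "(\<integral>\<omega>. f (X n i \<omega>) \<partial>M n) = (\<integral>x. f x \<partial>LX)"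
      using X_measurable[OF i] unfolding d by (simp_all add: integrable_distr_eq integral_distr)
  qed
  have "integrable (M n) (\<lambda>\<omega>. (norm (\<Sum>i\<in>I. mu n i *\<^sub>R X n i \<omega>))\<^sup>2)
    \<and> expectation (\<lambda>\<omega>. (norm (\<Sum>i\<in>I. mu n i *\<^sub>R X n i \<omega>))\<^sup>2)
      = (\<Sum>i\<in>I. expectation (\<lambda>\<omega>. (norm (mu n i *\<^sub>R X n i \<omega>))\<^sup>2))"
  proof (rule expectation_norm_sum_squared)
    show "indep_vars (\<lambda>_. borel) (\<lambda>i \<omega>. mu n i *\<^sub>R X n i \<omega>) I"
      by (rule indep_vars_compose2[OF indep_vars_subset[OF X_props(1) I], where Y="\<lambda>i x. mu n i *\<^sub>R x"]) measurable
    show "integrable (M n) (\<lambda>\<omega>. (norm (mu n i *\<^sub>R X n i \<omega>))\<^sup>2)" if "i \<in> I" for i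
      using tr(1)[OF that, of "\<lambda>x. (norm (mu n i *\<^sub>R x))\<^sup>2"] LX_norm_sq by (simp add: power_mult_distrib)
    show "expectation (\<lambda>\<omega>. mu n i *\<^sub>R X n i \<omega>) = 0" if "i \<in> I" for i
    proof -
      have "expectation (\<lambda>\<omega>. mu n i *\<^sub>R X n i \<omega>) = (\<integral>x. mu n i *\<^sub>R x \<partial>LX)"
        by (rule tr(2)[OF that]) measurable
      then show ?thesis by (simp only: integral_scaleR_right LX_mean(2) scaleR_zero_right)
    qed
  qed (simp add: I_def)
  moreover have "expectation (\<lambda>\<omega>. (norm (mu n i *\<^sub>R X n i \<omega>))\<^sup>2) = (mu n i)\<^sup>2 * EX2" if "i \<in> I" for i
  proof -
    have "expectation (\<lambda>\<omega>. (norm (mu n i *\<^sub>R X n i \<omega>))\<^sup>2) = (\<integral>x. (norm (mu n i *\<^sub>R x))\<^sup>2 \<partial>LX)"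
      by (rule tr(2)[OF that]) measurable
    then show ?thesis by (simp add: power_mult_distrib EX2_def)
  qed
  moreover have "(mu2_norm s1 s2 mu 2 n)\<^sup>2 = (\<Sum>i\<in>I. (mu n i)\<^sup>2)"
    by (simp add: mu2_norm_def I_def powr_half_sqrt sum_nonneg)
  ultimately show "integrable (M n) (\<lambda>\<omega>. (norm (V n \<omega>))\<^sup>2)"
    "expectation (\<lambda>\<omega>. (norm (V n \<omega>))\<^sup>2) = (mu2_norm s1 s2 mu 2 n)\<^sup>2 * EX2"
    unfolding V_def I_def[symmetric] by (simp_all add: sum_distrib_right)
qed

section \<open>Size relations between the parameters\<close>

lemma s1_over_n: "(\<lambda>n. real (s1 n) / n) \<longlonglongrightarrow> 0"
proof (rule tendsto_sandwich[of "\<lambda>_. 0"])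
  have "(\<lambda>n. real (s1 n + s2 n)) \<in> o(\<lambda>n. real n)" using mu by (simp add: incidental_parameters_def)
  then show "(\<lambda>n. real (s1 n + s2 n) / n) \<longlonglongrightarrow> 0" by (rule smalloD_tendsto)
qed (auto simp: divide_right_mono)

lemma params: "kap n > 0" "gam n > 0" "lam n > 0" "\<alpha> > 2" "\<alpha> * gam n \<le> lam n"
  using A B by (auto simp: assumption_A_def assumption_B_def)

lemma kap_small: "c > 0 \<Longrightarrow> \<forall>\<^sub>F n in sequentially. kap n \<le> c * lam n"
proof -
  assume "c > 0"
  moreover have "kap \<in> o(lam)" using B by (simp add: assumption_B_def)
  ultimately have "\<forall>\<^sub>F n in sequentially. norm (kap n) \<le> c * norm (lam n)" by (rule landau_o.smallD[rotated])
  then show ?thesis by (rule eventually_mono) (use params in \<open>simp add: less_imp_le\<close>)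
qed

text \<open>The minimum is over a finite nonempty set of nonnegative numbers, so the one Landau
  relation unpacks into a bound against each element, uniformly in \<open>i\<close>.\<close>

lemma lam_small:
  assumes "c > 0"
  shows "\<forall>\<^sub>F n in sequentially. lam n \<le> c * sqrt (real n) \<and> (\<forall>i\<in>{1..s1 n}. lam n \<le> c * \<bar>mu n i\<bar>)"
proof -
  let ?S = "\<lambda>n. insert (sqrt (real n)) ((\<lambda>i. \<bar>mu n i\<bar>) ` {1..s1 n})"
  have "lam \<in> o(\<lambda>n. Min (?S n))" using B by (simp add: assumption_B_def)
  from landau_o.smallD[OF this assms] show ?thesis
  proof (rule eventually_mono)
    fix n assume n: "norm (lam n) \<le> c * norm (Min (?S n))"
    have "Min (?S n) \<in> ?S n" by (rule Min_in) auto
    then have "Min (?S n) \<ge> 0" by auto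
    then have "lam n \<le> c * Min (?S n)" using n params(3)[of n] by simp
    moreover have "c * Min (?S n) \<le> c * x" if "x \<in> ?S n" for x
      using assms that by (intro mult_left_mono Min_le) auto
    ultimately have "lam n \<le> c * x" if "x \<in> ?S n" for x using that by (meson order_trans)
    then show "lam n \<le> c * sqrt (real n) \<and> (\<forall>i\<in>{1..s1 n}. lam n \<le> c * \<bar>mu n i\<bar>)" by simp
  qed
qed

lemma mu_large: "\<forall>\<^sub>F n in sequentially. \<forall>i\<in>{1..s1 n}. 2 * lam n < \<bar>mu n i\<bar>"
proof -
  have q: "(0::real) < 1 / 4" by simp
  show ?thesis
  proof (rule eventually_mono[OF lam_small[OF q]], intro ballI)
    fix n i assume "lam n \<le> 1 / 4 * sqrt (real n) \<and> (\<forall>i\<in>{1..s1 n}. lam n \<le> 1 / 4 * \<bar>mu n i\<bar>)" "i \<in> {1..s1 n}"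
    then show "2 * lam n < \<bar>mu n i\<bar>" using params(3)[of n] by fastforce
  qed
qed

text \<open>Tested against \<open>u\<close>, a clipped summand is \<open>x \<bullet> u\<close>
  scaled by \<open>c n * lam n\<close> up to sign, and an unclipped one is
  \<open>e * (x \<bullet> u)\<close> scaled by \<open>c n\<close>. Each kind has one fixed law,
  \<open>F\<close> or \<open>H\<close>, so the characteristic function is a product of two blocks
  with limiting variances \<open>w1 * q\<close> and
  \<open>\<sigma>\<^sup>2 * w2 * q\<close>.\<close>

lemma U_mchar_tendsto:
  assumes cl: "(\<lambda>n. c n * lam n) \<longlonglongrightarrow> 0"
    and w1: "(\<lambda>n. real (s1 n) * (c n * lam n)\<^sup>2) \<longlonglongrightarrow> w1" and w2: "(\<lambda>n. real n * (c n)\<^sup>2) \<longlonglongrightarrow> w2"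
  shows "(\<lambda>n. mchar (distr (M n) borel (\<lambda>\<omega>. c n *\<^sub>R U n \<omega>)) u)
    \<longlonglongrightarrow> complex_of_real (exp (- ((w1 + \<sigma>\<^sup>2 * w2) * (u \<bullet> (SigmaX *v u))) / 2))"
proof -
  define q where "q = u \<bullet> (SigmaX *v u)"
  define F where "F = distr LX borel (\<lambda>x. x \<bullet> u)"
  define H where "H = distr (LX \<Otimes>\<^sub>M Leps) borel (\<lambda>(x, e). e * (x \<bullet> u))"
  \<comment> \<open>Where \<open>mu n i\<close> vanishes the sign is set to 1, so that the square of
    \<open>\<tau> n i\<close> is the same for all \<open>i\<close> and all \<open>n\<close>; for
    large \<open>n\<close> this case does not occur among the first \<open>s1 n\<close>
    indices.\<close>
  define \<tau> where "\<tau> n i = (c n * lam n) * (if mu n i = 0 then 1 else sgn (mu n i))" for n i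
  interpret F: real_distribution F
    unfolding F_def by (rule L.M1.real_distribution_distr) measurable
  interpret H: real_distribution H
    unfolding H_def by (rule L.real_distribution_distr) measurable
  have F: "F.expectation (\<lambda>x. x) = 0" "integrable F (\<lambda>x. x\<^sup>2)" "F.expectation (\<lambda>x. x\<^sup>2) = q"
    using LX_inner[of u] by (simp_all add: F_def integral_distr integrable_distr_eq q_def)
  have H: "H.expectation (\<lambda>x. x) = 0" "integrable H (\<lambda>x. x\<^sup>2)" "H.expectation (\<lambda>x. x\<^sup>2) = \<sigma>\<^sup>2 * q"
  proof -
    have i: "integrable LX (\<lambda>x. x \<bullet> u)" using LX_mean(1) by simp
    have "H.expectation (\<lambda>x. x) = (\<integral>(x, e). e *\<^sub>R (x \<bullet> u) \<partial>(LX \<Otimes>\<^sub>M Leps))"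
      unfolding H_def by (subst integral_distr) (auto simp: case_prod_beta)
    then show "H.expectation (\<lambda>x. x) = 0"
      using L.integral_pair_scaleR(2)[OF i Leps_moments(1)] Leps_moments(2) by simp
    have sq: "(\<lambda>p. (case p of (x, e) \<Rightarrow> e * (x \<bullet> u))\<^sup>2) = (\<lambda>(x, e). e\<^sup>2 *\<^sub>R (x \<bullet> u)\<^sup>2)"
      by (auto simp: power_mult_distrib)
    show "integrable H (\<lambda>x. x\<^sup>2)"
      unfolding H_def using L.integral_pair_scaleR(1)[OF LX_inner(2)[of u] Leps_moments(3)]
      by (subst integrable_distr_eq) (simp_all add: sq)
    have "H.expectation (\<lambda>x. x\<^sup>2) = (\<integral>(x, e). e\<^sup>2 *\<^sub>R (x \<bullet> u)\<^sup>2 \<partial>(LX \<Otimes>\<^sub>M Leps))"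
      unfolding H_def by (subst integral_distr) (simp_all add: sq)
    then show "H.expectation (\<lambda>x. x\<^sup>2) = \<sigma>\<^sup>2 * q"
      using L.integral_pair_scaleR(2)[OF LX_inner(2)[of u] Leps_moments(3)] Leps_moments(4) LX_inner(3)[of u]
      by (simp add: q_def)
  qed
  have c0: "c \<longlonglongrightarrow> 0" by (rule tendsto_zero_of_mult_square[OF w2])
  have "(\<lambda>n. \<Prod>i\<in>{1..s1 n}. char F (\<tau> n i)) \<longlonglongrightarrow> complex_of_real (exp (- q * w1 / 2))"
    by (rule F.prod_char_tendsto[OF F _ cl]) (use w1 in \<open>auto simp: \<tau>_def power_mult_distrib sgn_if\<close>)
  moreover have "(\<lambda>n. \<Prod>i\<in>{s1 n + 1..n}. char H (c n)) \<longlonglongrightarrow> complex_of_real (exp (- (\<sigma>\<^sup>2 * q) * w2 / 2))"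
  proof (rule H.prod_char_tendsto[OF H _ c0])
    \<comment> \<open>The second block has \<open>n - s1 n\<close> factors; removing a vanishing
      fraction of the observations does not change the limit \<open>w2\<close>.\<close>
    have "(\<lambda>n. real n * (c n)\<^sup>2 - (real (s1 n) / n) * (real n * (c n)\<^sup>2)) \<longlonglongrightarrow> w2 - 0 * w2"
      by (intro tendsto_diff tendsto_mult w2 s1_over_n)
    moreover have "\<forall>\<^sub>F n in sequentially. real n * (c n)\<^sup>2 - (real (s1 n) / n) * (real n * (c n)\<^sup>2)
        = real (card {s1 n + 1..n}) * (c n)\<^sup>2"
      using eventually_gt_at_top[of 0]
    proof (rule eventually_mono)
      fix n :: nat assume "0 < n"
      then show "real n * (c n)\<^sup>2 - (real (s1 n) / n) * (real n * (c n)\<^sup>2) = real (card {s1 n + 1..n}) * (c n)\<^sup>2"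
        using s_le[of n] by (simp add: of_nat_diff left_diff_distrib)
    qed
    ultimately show "(\<lambda>n. real (card {s1 n + 1..n}) * (c n)\<^sup>2) \<longlonglongrightarrow> w2"
      using Lim_transform_eventually by fastforce
  qed simp
  ultimately have "(\<lambda>n. (\<Prod>i\<in>{1..s1 n}. char F (\<tau> n i)) * (\<Prod>i\<in>{s1 n + 1..n}. char H (c n)))
      \<longlonglongrightarrow> complex_of_real (exp (- q * w1 / 2)) * complex_of_real (exp (- (\<sigma>\<^sup>2 * q) * w2 / 2))"
    by (rule tendsto_mult)
  also have "complex_of_real (exp (- q * w1 / 2)) * complex_of_real (exp (- (\<sigma>\<^sup>2 * q) * w2 / 2))
      = complex_of_real (exp (- ((w1 + \<sigma>\<^sup>2 * w2) * q) / 2))"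
    by (simp add: algebra_simps add_divide_distrib diff_divide_distrib flip: of_real_mult exp_add)
  finally have lim: "(\<lambda>n. (\<Prod>i\<in>{1..s1 n}. char F (\<tau> n i)) * (\<Prod>i\<in>{s1 n + 1..n}. char H (c n)))
      \<longlonglongrightarrow> complex_of_real (exp (- ((w1 + \<sigma>\<^sup>2 * w2) * q) / 2))" .
  have "\<forall>\<^sub>F n in sequentially. (\<Prod>i\<in>{1..s1 n}. char F (\<tau> n i)) * (\<Prod>i\<in>{s1 n + 1..n}. char H (c n))
      = mchar (distr (M n) borel (\<lambda>\<omega>. c n *\<^sub>R U n \<omega>)) u"
    using mu_large
  proof (rule eventually_mono)
    fix n assume large: "\<forall>i\<in>{1..s1 n}. 2 * lam n < \<bar>mu n i\<bar>"
    interpret Mn: prob_space "M n" by (rule prob_M)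
    define g where "g i p = c n * weight n i (snd p) * (fst p \<bullet> u)" for i and p :: "(real^'d) \<times> real"
    have g[measurable]: "g i \<in> borel_measurable (borel \<Otimes>\<^sub>M borel)" for i unfolding g_def[abs_def] by measurable
    define Z where "Z i \<omega> = g i (X n i \<omega>, eps n i \<omega>)" for i \<omega>
    have Zm: "Z i \<in> borel_measurable (M n)" if "i \<in> {1..n}" for i
    proof -
      note [measurable] = X_measurable[OF that] eps_measurable[OF that]
      show ?thesis unfolding Z_def by measurable
    qed
    have charZ: "char (distr (M n) borel (Z i)) 1 = (\<integral>p. iexp (g i p) \<partial>(LX \<Otimes>\<^sub>M Leps))" if i: "i \<in> {1..n}" for i
    proof -
      have "char (distr (M n) borel (Z i)) 1 = (\<integral>\<omega>. iexp (Z i \<omega>) \<partial>M n)"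
        unfolding char_def using Zm[OF i] by (subst integral_distr) auto
      also have "\<dots> = (\<integral>p. iexp (g i p) \<partial>(LX \<Otimes>\<^sub>M Leps))"
        unfolding Z_def by (rule pair_transfer(2)[OF i]) measurable
      finally show ?thesis .
    qed
    \<comment> \<open>Here \<open>small\<close> and \<open>large\<close> describe the index, so
      \<open>small\<close> concerns the clipped observations. Their weight does not involve the
      error, and the integral over \<open>Leps\<close> is trivial.\<close>
    have small: "char (distr (M n) borel (Z i)) 1 = char F (\<tau> n i)" if i: "i \<in> {1..s1 n}" for i
    proof -
      have i': "i \<in> {1..n}" using i s_le[of n] by auto
      have nz: "mu n i \<noteq> 0" using large i params(3)[of n] by fastforce
      have "(\<integral>p. iexp (g i p) \<partial>(LX \<Otimes>\<^sub>M Leps)) = (\<integral>x. (\<integral>e. iexp (g i (x, e)) \<partial>Leps) \<partial>LX)"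
        by (rule L.integral_fst'[symmetric]) (rule L.integrable_const_bound[where B=1], auto)
      also have "\<dots> = (\<integral>x. iexp (\<tau> n i * (x \<bullet> u)) \<partial>LX)"
        using i nz by (simp add: g_def weight_def \<tau>_def L.M2.prob_space mult.assoc)
      also have "\<dots> = char F (\<tau> n i)"
        unfolding char_def F_def by (subst integral_distr) auto
      finally show ?thesis using charZ[OF i'] by simp
    qed
    have large: "char (distr (M n) borel (Z i)) 1 = char H (c n)" if i: "i \<in> {s1 n + 1..n}" for i
    proof -
      have i': "i \<in> {1..n}" using i by auto
      have "(\<integral>p. iexp (g i p) \<partial>(LX \<Otimes>\<^sub>M Leps)) = char H (c n)"
        unfolding char_def H_def using i by (subst integral_distr) (auto simp: g_def weight_def case_prod_beta mult_ac)
      then show ?thesis using charZ[OF i'] by simp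
    qed
    have "mchar (distr (M n) borel (\<lambda>\<omega>. c n *\<^sub>R U n \<omega>)) u = (\<integral>\<omega>. iexp (u \<bullet> (c n *\<^sub>R U n \<omega>)) \<partial>M n)"
      unfolding mchar_def by (subst integral_distr) auto
    also have "\<dots> = (\<integral>\<omega>. iexp (1 * (\<Sum>i=1..n. Z i \<omega>)) \<partial>M n)"
      by (simp add: U_def Z_def g_def inner_sum_right sum_distrib_left inner_commute mult_ac)
    also have "\<dots> = char (distr (M n) borel (\<lambda>\<omega>. \<Sum>i=1..n. Z i \<omega>)) 1"
      unfolding char_def using Zm by (subst integral_distr) (auto intro!: borel_measurable_sum)
    also have "\<dots> = (\<Prod>i=1..n. char (distr (M n) borel (Z i)) 1)"
    proof (rule Mn.char_distr_sum)
      show "Mn.indep_vars (\<lambda>_. borel) Z {1..n}"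
        unfolding Z_def[abs_def] by (rule Mn.indep_vars_compose2[OF pair_props(1), where Y=g]) (rule g)
    qed
    also have "\<dots> = (\<Prod>i\<in>{1..s1 n} \<union> {s1 n + 1..n}. char (distr (M n) borel (Z i)) 1)"
      using s_le[of n] by (intro prod.cong) auto
    also have "\<dots> = (\<Prod>i\<in>{1..s1 n}. char (distr (M n) borel (Z i)) 1) * (\<Prod>i\<in>{s1 n + 1..n}. char (distr (M n) borel (Z i)) 1)"
      by (rule prod.union_disjoint) auto
    also have "\<dots> = (\<Prod>i\<in>{1..s1 n}. char F (\<tau> n i)) * (\<Prod>i\<in>{s1 n + 1..n}. char H (c n))"
      by (intro arg_cong2[where f="(*)"] prod.cong refl small large)
    finally show "(\<Prod>i\<in>{1..s1 n}. char F (\<tau> n i)) * (\<Prod>i\<in>{s1 n + 1..n}. char H (c n))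
      = mchar (distr (M n) borel (\<lambda>\<omega>. c n *\<^sub>R U n \<omega>)) u" by (rule sym)
  qed
  from Lim_transform_eventually[OF lim this] show ?thesis by (simp only: q_def)
qed

section \<open>Bounds holding with probability tending to one\<close>

lemma X_bounded: "with_high_prob M (\<lambda>n \<omega>. \<forall>i\<in>{1..n}. norm (X n i \<omega>) \<le> kap n)"
proof (rule with_high_prob_Max[OF prob_M])
  show "(\<lambda>\<omega>. norm (X n i \<omega>)) \<in> borel_measurable (M n)" if "i \<in> {1..n}" for n i
    using X_measurable[OF that] by measurable
qed (use A in \<open>simp add: assumption_A_def\<close>)

lemma eps_bounded: "with_high_prob M (\<lambda>n \<omega>. \<forall>i\<in>{1..n}. \<bar>eps n i \<omega>\<bar> \<le> gam n)"
proof (rule with_high_prob_Max[OF prob_M])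
  show "(\<lambda>\<omega>. \<bar>eps n i \<omega>\<bar>) \<in> borel_measurable (M n)" if "i \<in> {1..n}" for n i
    using eps_measurable[OF that] by measurable
qed (use A in \<open>simp add: assumption_A_def\<close>)

text \<open>Since \<open>real n * (c n)\<^sup>2\<close> converges, \<open>c n\<close> is O(1/sqrt
  n), so \<open>V\<close> has to be o(sqrt n) in probability. Under the first alternative this is a
  deterministic bound: at most \<open>s2 n\<close> terms of norm \<open>gam n * kap n\<close> on the
  event of Assumption (A). Under the second it follows from Markov's inequality for the squared
  norm.\<close>

lemma V_small:
  assumes w2: "(\<lambda>n. real n * (c n)\<^sup>2) \<longlonglongrightarrow> w2" and r: "r > 0"
  shows "with_high_prob M (\<lambda>n \<omega>. norm (c n *\<^sub>R V n \<omega>) \<le> r)"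
  using small_mu
proof
  assume "(\<lambda>n. real (s2 n)) \<in> o(\<lambda>n. sqrt (real n) / (kap n * gam n))"
  then have "(\<lambda>n. real (s2 n) / (sqrt (real n) / (kap n * gam n))) \<longlonglongrightarrow> 0" by (rule smalloD_tendsto)
  then have "(\<lambda>n. sqrt (real n * (c n)\<^sup>2) * (real (s2 n) / (sqrt (real n) / (kap n * gam n)))) \<longlonglongrightarrow> sqrt w2 * 0"
    by (intro tendsto_mult tendsto_real_sqrt w2)
  then have "\<forall>\<^sub>F n in sequentially. sqrt (real n * (c n)\<^sup>2) * (real (s2 n) / (sqrt (real n) / (kap n * gam n))) < r"
    using r by (intro order_tendstoD(2)[of _ "sqrt w2 * 0"]) auto
  then have ev: "\<forall>\<^sub>F n in sequentially. \<bar>c n\<bar> * (real (s2 n) * (gam n * kap n)) \<le> r"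
    using eventually_gt_at_top[of 0]
  proof eventually_elim
    case (elim n)
    then show ?case using params(1,2)[of n] by (simp add: real_sqrt_mult field_simps)
  qed
  have Vb: "norm (V n \<omega>) \<le> real (s2 n) * (gam n * kap n)" if b: "\<forall>i\<in>{1..n}. norm (X n i \<omega>) \<le> kap n" for n \<omega>
  proof -
    have "norm (V n \<omega>) \<le> (\<Sum>i=s1 n + 1..s1 n + s2 n. gam n * kap n)"
      unfolding V_def
    proof (rule sum_norm_le)
      fix i assume i: "i \<in> {s1 n + 1..s1 n + s2 n}"
      then have "i \<in> {1..n}" using s_le[of n] by auto
      moreover have "\<bar>mu n i\<bar> \<le> gam n" using mu i by (simp add: incidental_parameters_def)
      ultimately show "norm (mu n i *\<^sub>R X n i \<omega>) \<le> gam n * kap n"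
        using b params(2)[of n] by (auto intro!: mult_mono)
    qed
    then show ?thesis by simp
  qed
  show ?thesis
  proof (rule with_high_prob_mono[OF prob_M X_bounded], rule eventually_mono[OF ev], intro ballI impI)
    fix n \<omega> assume n: "\<bar>c n\<bar> * (real (s2 n) * (gam n * kap n)) \<le> r" "\<forall>i\<in>{1..n}. norm (X n i \<omega>) \<le> kap n"
    have "norm (c n *\<^sub>R V n \<omega>) \<le> \<bar>c n\<bar> * (real (s2 n) * (gam n * kap n))"
      using Vb[OF n(2)] by (simp add: mult_left_mono)
    then show "norm (c n *\<^sub>R V n \<omega>) \<le> r" using n(1) by simp
  qed
next
  assume D: "(\<lambda>n. (mu2_norm s1 s2 mu 2 n)\<^sup>2 / real n) \<longlonglongrightarrow> 0"
  have int: "integrable (M n) (\<lambda>\<omega>. (norm (c n *\<^sub>R V n \<omega>))\<^sup>2)" for n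
    using V_second_moment(1)[of n] by (simp add: power_mult_distrib)
  have "(\<lambda>n. \<integral>\<omega>. (norm (c n *\<^sub>R V n \<omega>))\<^sup>2 \<partial>M n) \<longlonglongrightarrow> 0"
  proof (rule Lim_transform_eventually)
    show "(\<lambda>n. (real n * (c n)\<^sup>2) * ((mu2_norm s1 s2 mu 2 n)\<^sup>2 / real n) * EX2) \<longlonglongrightarrow> 0"
      using tendsto_mult[OF tendsto_mult[OF w2 D] tendsto_const[of EX2]] by simp
    show "\<forall>\<^sub>F n in sequentially. (real n * (c n)\<^sup>2) * ((mu2_norm s1 s2 mu 2 n)\<^sup>2 / real n) * EX2
        = (\<integral>\<omega>. (norm (c n *\<^sub>R V n \<omega>))\<^sup>2 \<partial>M n)"
      using eventually_gt_at_top[of 0]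
      by (rule eventually_mono) (simp add: power_mult_distrib V_second_moment(2))
  qed
  from with_high_prob_markov[OF prob_M int _ this, of "r\<^sup>2"]
  have "with_high_prob M (\<lambda>n \<omega>. (norm (c n *\<^sub>R V n \<omega>))\<^sup>2 \<le> r\<^sup>2)" using r by simp
  then show ?thesis
  proof (rule with_high_prob_mono[OF prob_M], intro always_eventually allI ballI impI)
    fix n \<omega> assume "(norm (c n *\<^sub>R V n \<omega>))\<^sup>2 \<le> r\<^sup>2"
    then show "norm (c n *\<^sub>R V n \<omega>) \<le> r" by (rule power2_le_imp_le) (use r in simp)
  qed
qed

text \<open>Products of two design coordinates are only known to be integrable, hence the law of
  large numbers in mean. The row set is left general for two uses: all rows, to get an invertible
  Gram matrix, and the unclipped rows, to get the matrix of the linear equation.\<close>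

lemma gram_close:
  assumes J: "\<And>n. J n \<subseteq> {1..n}" "(\<lambda>n. card (J n) / n) \<longlonglongrightarrow> 1" and e: "e > 0"
  shows "with_high_prob M (\<lambda>n \<omega>. \<forall>jk\<in>UNIV.
    \<bar>(SigmaX - (1 / real n) *\<^sub>R gram_on (J n) (\<lambda>i. X n i \<omega>)) $ fst jk $ snd jk\<bar> \<le> e)"
proof (rule with_high_prob_ball[OF prob_M])
  fix jk :: "'d \<times> 'd"
  obtain j k where jk: "jk = (j, k)" by (cases jk)
  define D where "D = distr LX borel (\<lambda>x. x $ j * x $ k)"
  have m: "(\<lambda>x. x $ j * x $ k) \<in> borel_measurable LX" by simp
  have D: "prob_space D" "sets D = sets borel" unfolding D_def by (auto intro!: L.M1.prob_space_distr)
  have int: "integrable D (\<lambda>z. z)" "(\<integral>z. z \<partial>D) = SigmaX $ j $ k"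
    using LX_cov[of j k] by (simp_all add: D_def integrable_distr_eq integral_distr)
  have ind: "prob_space.indep_vars (M n) (\<lambda>_. borel) (\<lambda>i \<omega>. X n i \<omega> $ j * X n i \<omega> $ k) (J n)" for n
    by (rule prob_space.indep_vars_compose2[OF prob_M prob_space.indep_vars_subset[OF prob_M X_props(1) J(1)],
          where Y="\<lambda>_ x. x $ j * x $ k"]) measurable
  have dist: "distr (M n) borel (\<lambda>\<omega>. X n i \<omega> $ j * X n i \<omega> $ k) = D" if "i \<in> J n" for n i
  proof -
    have i: "i \<in> {1..n}" using that J(1) by blast
    show ?thesis
      unfolding D_def X_props(2)[OF i, symmetric] using X_measurable[OF i] by (subst distr_distr) (auto simp: o_def)
  qed
  note wl = weak_law_of_large_numbers_L1[OF prob_M J ind dist D int(1), unfolded int(2)]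
  have "with_high_prob M (\<lambda>n \<omega>. \<bar>(\<Sum>i\<in>J n. X n i \<omega> $ j * X n i \<omega> $ k) / n - SigmaX $ j $ k\<bar> \<le> e)"
    by (rule with_high_prob_markov[OF prob_M wl(2) _ wl(1) e]) (assumption | rule abs_ge_zero)+
  then show "with_high_prob M (\<lambda>n \<omega>. \<bar>(SigmaX - (1 / real n) *\<^sub>R gram_on (J n) (\<lambda>i. X n i \<omega>)) $ fst jk $ snd jk\<bar> \<le> e)"
    by (simp add: jk gram_on_def abs_minus_commute)
qed simp

text \<open>Multiplied by \<open>c n\<close>, the score equation says that the scaled error solves a
  system with matrix \<open>gram_on {s1 n + 1..n}\<close> over \<open>n\<close> and right-hand side
  \<open>c n\<close> times \<open>U + V\<close>. Replacing the matrix by \<open>SigmaX\<close> and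
  dropping \<open>V\<close> costs at most \<open>e\<close> on an event of probability at least
  \<open>1 - e\<close>.\<close>

lemma estimator_linearization:
  assumes cl: "(\<lambda>n. c n * lam n) \<longlonglongrightarrow> 0"
    and w1: "(\<lambda>n. real (s1 n) * (c n * lam n)\<^sup>2) \<longlonglongrightarrow> w1" and w2: "(\<lambda>n. real n * (c n)\<^sup>2) \<longlonglongrightarrow> w2"
    and e: "e > 0"
  shows "\<exists>G. \<forall>\<^sub>F n in sequentially. G n \<in> sets (M n) \<and> measure (M n) (G n) \<ge> 1 - e
    \<and> (\<forall>\<omega>\<in>G n. norm ((real n * c n) *\<^sub>R (bhat n \<omega> - \<beta>) - matrix_inv SigmaX *v (c n *\<^sub>R U n \<omega>)) \<le> e)"
proof -
  have invS: "invertible SigmaX" by (rule pos_def_matrix_invertible[OF X0_cov(2)])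
  obtain m where m: "m > 0" "\<And>x. m * norm x \<le> norm (SigmaX *v x)"
    using invertible_bounded_below[OF invS] by auto
  \<comment> \<open>The limit of the second-moment bound of \<open>c n *\<^sub>R U n\<close>, plus 1
    to dominate it eventually.\<close>
  define Bd where "Bd = (w1 + \<sigma>\<^sup>2 * w2) * EX2 + 1"
  have "(\<lambda>n. (real (s1 n) * (c n * lam n)\<^sup>2 + \<sigma>\<^sup>2 * (real n * (c n)\<^sup>2)) * EX2) \<longlonglongrightarrow> (w1 + \<sigma>\<^sup>2 * w2) * EX2"
    by (intro tendsto_intros w1 w2)
  then have evB: "\<forall>\<^sub>F n in sequentially. (real (s1 n) * (c n * lam n)\<^sup>2 + \<sigma>\<^sup>2 * (real n * (c n)\<^sup>2)) * EX2 < Bd"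
    by (rule order_tendstoD) (simp add: Bd_def)
  \<comment> \<open>By Chebyshev, \<open>c n *\<^sub>R U n\<close> exceeds \<open>K\<close> in norm
    with probability at most \<open>e / 2\<close>; the summand 1 keeps \<open>K\<close>
    positive.\<close>
  define K where "K = sqrt (2 * \<bar>Bd\<bar> / e) + 1"
  have K: "K > 0" using e by (simp add: K_def add_nonneg_pos)
  have KB: "Bd / K\<^sup>2 \<le> e / 2"
  proof -
    have "2 * \<bar>Bd\<bar> / e = (sqrt (2 * \<bar>Bd\<bar> / e))\<^sup>2" using e by simp
    also have "\<dots> \<le> K\<^sup>2" using e unfolding K_def by (intro power_mono) auto
    finally have "2 * \<bar>Bd\<bar> \<le> K\<^sup>2 * e" using e by (simp add: pos_divide_le_eq)
    then show ?thesis using K by (simp add: divide_le_eq) (simp add: mult.commute)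
  qed
  \<comment> \<open>The two bounds that \<open>perturbed_solution_close\<close> puts on the matrix
    error: \<open>m / 2\<close> for absorption, the other one against right-hand sides of norm up to
    \<open>K\<close>.\<close>
  define \<eta> where "\<eta> = min (m / 2) (m\<^sup>2 * e / (4 * K))"
  have eta: "\<eta> > 0" "\<eta> \<le> m / 2" "\<eta> * K \<le> m\<^sup>2 * e / 4"
  proof -
    show "\<eta> > 0" "\<eta> \<le> m / 2" using m K e by (auto simp: \<eta>_def)
    have "\<eta> * K \<le> m\<^sup>2 * e / (4 * K) * K" using K by (intro mult_right_mono) (auto simp: \<eta>_def)
    then show "\<eta> * K \<le> m\<^sup>2 * e / 4" using K by simp
  qed
  have r: "m * e / 4 > 0" using m e by simp
  define \<eta>' where "\<eta>' = \<eta> / (real CARD('d))\<^sup>2"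
  have eta': "\<eta>' > 0" using eta by (simp add: \<eta>'_def)
  define R where "R = real CARD('d) * C"
  have n1: "(\<lambda>n. real (card {1..n}) / real n) \<longlonglongrightarrow> 1"
    by (rule tendsto_eventually, rule eventually_mono[OF eventually_gt_at_top[of 0]]) simp
  have n2: "(\<lambda>n. real (card {s1 n + 1..n}) / n) \<longlonglongrightarrow> 1"
  proof (rule Lim_transform_eventually)
    show "(\<lambda>n. 1 - real (s1 n) / n) \<longlonglongrightarrow> 1" using tendsto_diff[OF tendsto_const[of 1] s1_over_n] by simp
    show "\<forall>\<^sub>F n in sequentially. 1 - real (s1 n) / n = real (card {s1 n + 1..n}) / n"
    proof (rule eventually_mono[OF eventually_gt_at_top[of 0]])
      fix n :: nat assume "0 < n"
      moreover have "s1 n \<le> n" using s_le[of n] by simp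
      ultimately show "1 - real (s1 n) / n = real (card {s1 n + 1..n}) / n"
        by (simp add: of_nat_diff diff_divide_distrib)
    qed
  qed
  note g1 = gram_close[of "\<lambda>n. {1..n}", OF _ n1 eta']
  have sub: "{s1 n + 1..n} \<subseteq> {1..n}" for n by auto
  note g2 = gram_close[of "\<lambda>n. {s1 n + 1..n}", OF sub n2 eta']
  define E where "E n \<omega> \<longleftrightarrow> (bhat n \<omega> \<in> coord_box C \<beta> \<and>
          phi n (lam n) (\<lambda>i. X n i \<omega>) (\<lambda>i. Y n i \<omega>) (bhat n \<omega>) = 0) \<and>
      (\<forall>i\<in>{1..n}. norm (X n i \<omega>) \<le> kap n) \<and> (\<forall>i\<in>{1..n}. \<bar>eps n i \<omega>\<bar> \<le> gam n) \<and>
      norm (c n *\<^sub>R V n \<omega>) \<le> m * e / 4 \<and>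
      (\<forall>jk\<in>UNIV. \<bar>(SigmaX - (1 / real n) *\<^sub>R gram_on {1..n} (\<lambda>i. X n i \<omega>)) $ fst jk $ snd jk\<bar> \<le> \<eta>') \<and>
      (\<forall>jk\<in>UNIV. \<bar>(SigmaX - (1 / real n) *\<^sub>R gram_on {s1 n + 1..n} (\<lambda>i. X n i \<omega>)) $ fst jk $ snd jk\<bar> \<le> \<eta>')" for n \<omega>
  have whp: "with_high_prob M E"
    unfolding E_def
    by (intro with_high_prob_conj prob_M bhat_zero X_bounded eps_bounded V_small[OF w2 r] g1 g2) simp_all
  have close: "norm ((SigmaX - S) *v x) \<le> \<eta> * norm x"
    if "\<forall>jk\<in>UNIV. \<bar>(SigmaX - S) $ fst jk $ snd jk\<bar> \<le> \<eta>'" for S :: "real^'d^'d" and x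
    using that unfolding \<eta>'_def by (intro norm_matrix_vector_mult_le) auto
  have evR: "\<forall>\<^sub>F n in sequentially. 2 * gam n + kap n * R \<le> lam n"
  proof -
    \<comment> \<open>Assumption (B) gives \<open>2 * gam n \<le> (2 / \<alpha>) * lam n\<close>, so
      the fraction \<open>1 - 2 / \<alpha>\<close> of \<open>lam n\<close> remains for
      \<open>kap n * R\<close>; the 1 in the denominator prevents division by zero.\<close>
    define \<delta> where "\<delta> = (1 - 2 / \<alpha>) / (\<bar>R\<bar> + 1)"
    have "2 / \<alpha> < 1" using params(4) by simp
    then have \<delta>: "\<delta> > 0" unfolding \<delta>_def by (intro divide_pos_pos) auto
    have R1: "\<bar>R\<bar> + 1 \<noteq> 0" using abs_ge_zero[of R] by linarith
    show ?thesis
    proof (rule eventually_mono[OF kap_small[OF \<delta>]])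
      fix n assume k: "kap n \<le> \<delta> * lam n"
      have "kap n * R \<le> kap n * (\<bar>R\<bar> + 1)" using params(1)[of n] by (intro mult_left_mono) auto
      also have "\<dots> \<le> \<delta> * lam n * (\<bar>R\<bar> + 1)" using k by (intro mult_right_mono) auto
      also have "\<dots> = (1 - 2 / \<alpha>) * lam n" unfolding \<delta>_def using R1 by (simp add: divide_simps)
      finally have "kap n * R \<le> lam n - 2 * (lam n / \<alpha>)" by (simp add: algebra_simps)
      moreover have "gam n \<le> lam n / \<alpha>" using params(4) params(5)[of n] by (simp add: field_simps)
      ultimately show "2 * gam n + kap n * R \<le> lam n" by linarith
    qed
  qed
  \<comment> \<open>The bound \<open>K\<close> on \<open>U\<close> holds only with probability
    \<open>1 - e / 2\<close>, not tending to one. It is therefore kept as a premise here and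
    discharged at the end by removing the event \<open>T n\<close>.\<close>
  have "with_high_prob M (\<lambda>n \<omega>. norm (c n *\<^sub>R U n \<omega>) \<le> K \<longrightarrow>
      norm ((real n * c n) *\<^sub>R (bhat n \<omega> - \<beta>) - matrix_inv SigmaX *v (c n *\<^sub>R U n \<omega>)) \<le> e)"
  proof (rule with_high_prob_mono[OF prob_M whp])
    show "\<forall>\<^sub>F n in sequentially. \<forall>\<omega>\<in>space (M n). E n \<omega>
      \<longrightarrow> (norm (c n *\<^sub>R U n \<omega>) \<le> K \<longrightarrow>
      norm ((real n * c n) *\<^sub>R (bhat n \<omega> - \<beta>) - matrix_inv SigmaX *v (c n *\<^sub>R U n \<omega>)) \<le> e)"
      using evR mu_large eventually_gt_at_top[of 0] unfolding E_def
    proof (eventually_elim, intro ballI impI, elim conjE)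
      fix n \<omega>
      assume R: "2 * gam n + kap n * R \<le> lam n" and large: "\<forall>i\<in>{1..s1 n}. 2 * lam n < \<bar>mu n i\<bar>"
        and n: "0 < n" and \<omega>: "\<omega> \<in> space (M n)"
        and UK: "norm (c n *\<^sub>R U n \<omega>) \<le> K" and box: "bhat n \<omega> \<in> coord_box C \<beta>"
        and phi0: "phi n (lam n) (\<lambda>i. X n i \<omega>) (\<lambda>i. Y n i \<omega>) (bhat n \<omega>) = 0"
        and Xk: "\<forall>i\<in>{1..n}. norm (X n i \<omega>) \<le> kap n" and eg: "\<forall>i\<in>{1..n}. \<bar>eps n i \<omega>\<bar> \<le> gam n"
        and Vr: "norm (c n *\<^sub>R V n \<omega>) \<le> m * e / 4"
        and gr1: "\<forall>jk\<in>UNIV. \<bar>(SigmaX - (1 / real n) *\<^sub>R gram_on {1..n} (\<lambda>i. X n i \<omega>)) $ fst jk $ snd jk\<bar> \<le> \<eta>'"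
        and gr2: "\<forall>jk\<in>UNIV. \<bar>(SigmaX - (1 / real n) *\<^sub>R gram_on {s1 n + 1..n} (\<lambda>i. X n i \<omega>)) $ fst jk $ snd jk\<bar> \<le> \<eta>'"
      \<comment> \<open>Closeness of the full Gram matrix to \<open>SigmaX\<close> is used for its
        invertibility, which gives \<open>phi\<close> its meaning.\<close>
      have "\<eta> < m" using eta(2) m(1) by simp
      from invertible_of_close[OF m(2) close[OF gr1] this]
      have "invertible ((1 / real n) *\<^sub>R gram_on {1..n} (\<lambda>i. X n i \<omega>))" .
      then have "invertible (real n *\<^sub>R ((1 / real n) *\<^sub>R gram_on {1..n} (\<lambda>i. X n i \<omega>)))"
        by (rule scalar_invertible[rotated]) (use n in simp)
      then have inv: "invertible (gram n (\<lambda>i. X n i \<omega>))"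
        using n by (simp add: gram_eq_gram_on)
      have eq: "gram_on {s1 n + 1..n} (\<lambda>i. X n i \<omega>) *v (bhat n \<omega> - \<beta>)
        = (\<Sum>i=1..n. (if i \<le> s1 n then lam n * sgn (mu n i) else eps n i \<omega>) *\<^sub>R X n i \<omega>)
          + (\<Sum>i=s1 n + 1..s1 n + s2 n. mu n i *\<^sub>R X n i \<omega>)"
      proof (rule score_equation[OF inv phi0, where kap="kap n" and gam="gam n" and R=R])
        show "norm (bhat n \<omega> - \<beta>) \<le> R" unfolding R_def by (rule coord_box_norm[OF box])
        show "\<bar>mu n i\<bar> \<le> gam n" if "i \<in> {s1 n + 1..s1 n + s2 n}" for i
          using mu that by (simp add: incidental_parameters_def)
        show "mu n i = 0" if "i \<in> {s1 n + s2 n + 1..n}" for i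
          using mu that by (simp add: incidental_parameters_def)
      qed (use model \<omega> Xk eg R params s_le large in auto)
      show "norm ((real n * c n) *\<^sub>R (bhat n \<omega> - \<beta>) - matrix_inv SigmaX *v (c n *\<^sub>R U n \<omega>)) \<le> e"
      proof (rule perturbed_solution_close[OF m close[OF gr2] less_imp_le[OF eta(1)] eta(2,3) order_refl _ _ UK Vr])
        have "((1 / real n) *\<^sub>R gram_on {s1 n + 1..n} (\<lambda>i. X n i \<omega>)) *v ((real n * c n) *\<^sub>R (bhat n \<omega> - \<beta>))
            = c n *\<^sub>R (gram_on {s1 n + 1..n} (\<lambda>i. X n i \<omega>) *v (bhat n \<omega> - \<beta>))"
          using n by (simp add: matrix_vector_mult_scaleR scaleR_matrix_vector_assoc[symmetric])
        then show "((1 / real n) *\<^sub>R gram_on {s1 n + 1..n} (\<lambda>i. X n i \<omega>)) *v ((real n * c n) *\<^sub>R (bhat n \<omega> - \<beta>))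
            = c n *\<^sub>R U n \<omega> + c n *\<^sub>R V n \<omega>"
          unfolding eq by (simp add: U_def V_def weight_def scaleR_add_right)
        show "SigmaX *v (matrix_inv SigmaX *v (c n *\<^sub>R U n \<omega>)) = c n *\<^sub>R U n \<omega>"
          by (simp add: matrix_vector_mul_assoc matrix_inv_right[OF invS])
      qed
    qed
  qed
  then obtain G where G: "\<And>n. G n \<in> sets (M n)" "(\<lambda>n. measure (M n) (G n)) \<longlonglongrightarrow> 1"
    "\<And>n \<omega>. \<omega> \<in> G n \<Longrightarrow> norm (c n *\<^sub>R U n \<omega>) \<le> K \<Longrightarrow>
      norm ((real n * c n) *\<^sub>R (bhat n \<omega> - \<beta>) - matrix_inv SigmaX *v (c n *\<^sub>R U n \<omega>)) \<le> e"
    unfolding with_high_prob_def by blast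
  define T where "T n = {\<omega> \<in> space (M n). norm (c n *\<^sub>R U n \<omega>) > K}" for n
  have Tm: "T n \<in> sets (M n)" for n unfolding T_def by measurable
  have evG: "\<forall>\<^sub>F n in sequentially. measure (M n) (G n) > 1 - e / 2"
    using G(2) e by (intro order_tendstoD) auto
  show ?thesis
  proof (intro exI[of _ "\<lambda>n. G n - T n"])
    show "\<forall>\<^sub>F n in sequentially. G n - T n \<in> sets (M n) \<and> measure (M n) (G n - T n) \<ge> 1 - e
      \<and> (\<forall>\<omega>\<in>G n - T n. norm ((real n * c n) *\<^sub>R (bhat n \<omega> - \<beta>) - matrix_inv SigmaX *v (c n *\<^sub>R U n \<omega>)) \<le> e)"
      using evG evB
    proof eventually_elim
      case (elim n)
      interpret Mn: prob_space "M n" by (rule prob_M)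
      have i: "integrable (M n) (\<lambda>\<omega>. (norm (c n *\<^sub>R U n \<omega>))\<^sup>2)"
        using U_second_moment(1)[of n] by (simp add: power_mult_distrib)
      have "Mn.prob (T n) \<le> Mn.expectation (\<lambda>\<omega>. (norm (c n *\<^sub>R U n \<omega>))\<^sup>2) / K\<^sup>2"
        unfolding T_def by (rule Mn.prob_norm_gt_le[OF _ i K]) measurable
      also have "Mn.expectation (\<lambda>\<omega>. (norm (c n *\<^sub>R U n \<omega>))\<^sup>2) \<le> Bd"
      proof -
        have "Mn.expectation (\<lambda>\<omega>. (norm (c n *\<^sub>R U n \<omega>))\<^sup>2) = (c n)\<^sup>2 * Mn.expectation (\<lambda>\<omega>. (norm (U n \<omega>))\<^sup>2)"
          by (simp add: power_mult_distrib)
        also have "\<dots> \<le> (c n)\<^sup>2 * ((real (s1 n) * (lam n)\<^sup>2 + real n * \<sigma>\<^sup>2) * EX2)"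
          by (intro mult_left_mono U_second_moment(2)) simp
        also have "\<dots> = (real (s1 n) * (c n * lam n)\<^sup>2 + \<sigma>\<^sup>2 * (real n * (c n)\<^sup>2)) * EX2"
          by (simp add: power_mult_distrib algebra_simps)
        finally show ?thesis using elim(2) by linarith
      qed
      finally have "Mn.prob (T n) \<le> Bd / K\<^sup>2" using K by (simp add: divide_right_mono)
      then have pT: "Mn.prob (T n) \<le> e / 2" using KB by linarith
      have "Mn.prob (G n) \<le> Mn.prob ((G n - T n) \<union> T n)"
        using G(1) Tm by (intro Mn.finite_measure_mono) auto
      also have "\<dots> \<le> Mn.prob (G n - T n) + Mn.prob (T n)"
        using G(1) Tm by (intro measure_Un_le) auto
      finally have "1 - e \<le> Mn.prob (G n - T n)" using pT elim(1) by linarith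
      moreover have "norm ((real n * c n) *\<^sub>R (bhat n \<omega> - \<beta>) - matrix_inv SigmaX *v (c n *\<^sub>R U n \<omega>)) \<le> e"
        if "\<omega> \<in> G n - T n" for \<omega>
      proof -
        have "\<omega> \<in> space (M n)" using that sets.sets_into_space[OF G(1)] by blast
        then show ?thesis using that by (intro G(3)) (auto simp: T_def not_less)
      qed
      ultimately show ?case using G(1) Tm by auto
    qed
  qed
qed

text \<open>The approximating vector is the inverse of \<open>SigmaX\<close> applied to
  \<open>c n *\<^sub>R U n\<close>. Since the limiting covariance of the latter is
  \<open>SigmaX\<close> times \<open>w1 + \<sigma>\<^sup>2 * w2\<close>, sandwiching by the
  symmetric inverse leaves a single inverse.\<close>

lemma estimator_converges_in_distribution:
  assumes cl: "(\<lambda>n. c n * lam n) \<longlonglongrightarrow> 0"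
    and w1: "(\<lambda>n. real (s1 n) * (c n * lam n)\<^sup>2) \<longlonglongrightarrow> w1" and w2: "(\<lambda>n. real n * (c n)\<^sup>2) \<longlonglongrightarrow> w2"
    and v: "w1 + \<sigma>\<^sup>2 * w2 > 0" and r: "\<forall>\<^sub>F n in sequentially. r n = real n * c n"
  shows "converges_in_distribution M (\<lambda>n \<omega>. r n *\<^sub>R (bhat n \<omega> - \<beta>))
    (multivariate_normal 0 ((w1 + \<sigma>\<^sup>2 * w2) *\<^sub>R matrix_inv SigmaX))"
proof -
  define v where "v = w1 + \<sigma>\<^sup>2 * w2"
  define W where "W n \<omega> = matrix_inv SigmaX *v (c n *\<^sub>R U n \<omega>)" for n \<omega>
  have invS: "invertible SigmaX" by (rule pos_def_matrix_invertible[OF X0_cov(2)])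
  have pdi: "pos_def_matrix (matrix_inv SigmaX)" by (rule pos_def_matrix_inv[OF X0_cov(2)])
  then have tr: "transpose (matrix_inv SigmaX) = matrix_inv SigmaX" by (simp add: pos_def_matrix_def)
  have pd: "pos_def_matrix (v *\<^sub>R matrix_inv SigmaX)"
    using v pdi by (intro pos_def_matrix_scaleR) (auto simp: v_def)
  have matm[measurable]: "(*v) (matrix_inv SigmaX) \<in> borel_measurable borel"
    by (rule matrix_vector_mult_measurable)
  have Wm[measurable]: "W n \<in> borel_measurable (M n)" for n
    unfolding W_def[abs_def] by (rule measurable_compose[OF _ matm]) measurable
  note bm[measurable] = bhat_rv
  define Z where "Z n \<omega> = (real n * c n) *\<^sub>R (bhat n \<omega> - \<beta>)" for n \<omega>
  have Zm[measurable]: "Z n \<in> borel_measurable (M n)" for n unfolding Z_def[abs_def] by measurable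
  have limW: "(\<lambda>n. mchar (distr (M n) borel (W n)) u)
      \<longlonglongrightarrow> mchar (multivariate_normal 0 (v *\<^sub>R matrix_inv SigmaX)) u" for u
  proof -
    \<comment> \<open>By symmetry the matrix moves from the random vector to the argument of the
      characteristic function.\<close>
    define u' where "u' = matrix_inv SigmaX *v u"
    have "mchar (distr (M n) borel (W n)) u = mchar (distr (M n) borel (\<lambda>\<omega>. c n *\<^sub>R U n \<omega>)) u'" for n
    proof -
      have "u \<bullet> W n \<omega> = u' \<bullet> (c n *\<^sub>R U n \<omega>)" for \<omega>
        unfolding W_def u'_def by (subst inner_matrix_left) (simp only: tr)
      then show ?thesis unfolding mchar_def by (simp add: integral_distr)
    qed
    moreover have "u' \<bullet> (SigmaX *v u') = u \<bullet> (matrix_inv SigmaX *v u)"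
      unfolding u'_def by (simp add: matrix_vector_mul_assoc matrix_inv_right[OF invS] inner_commute)
    ultimately show ?thesis
      using U_mchar_tendsto[OF cl w1 w2, of u'] multivariate_normal_mchar(2)[OF pd, of u]
      by (simp add: v_def scaleR_matrix_vector_assoc[symmetric])
  qed
  have limZ: "(\<lambda>n. mchar (distr (M n) borel (Z n)) u)
      \<longlonglongrightarrow> mchar (multivariate_normal 0 (v *\<^sub>R matrix_inv SigmaX)) u" for u
    by (rule mchar_tendsto_perturb[OF prob_M Zm Wm _ limW])
       (use estimator_linearization[OF cl w1 w2] in \<open>simp add: Z_def W_def\<close>)
  show ?thesis
    unfolding converges_in_distribution_def v_def[symmetric]
  proof (intro allI impI, elim conjE)
    fix f :: "real^'d \<Rightarrow> real" assume f: "continuous_on UNIV f" "bounded (range f)"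
    have "(\<lambda>n. \<integral>x. f x \<partial>distr (M n) borel (Z n)) \<longlonglongrightarrow> (\<integral>x. f x \<partial>multivariate_normal 0 (v *\<^sub>R matrix_inv SigmaX))"
      by (rule levy_continuity_euclidean[OF prob_space.prob_space_distr[OF prob_M Zm] multivariate_normal_mchar(1)[OF pd] _ _ limZ f]) simp_all
    moreover have "\<forall>\<^sub>F n in sequentially. (\<integral>x. f x \<partial>distr (M n) borel (Z n))
        = (\<integral>x. f x \<partial>distr (M n) borel (\<lambda>\<omega>. r n *\<^sub>R (bhat n \<omega> - \<beta>)))"
      using r by (rule eventually_mono) (simp add: Z_def[abs_def])
    ultimately show "(\<lambda>n. \<integral>x. f x \<partial>distr (M n) borel (\<lambda>\<omega>. r n *\<^sub>R (bhat n \<omega> - \<beta>)))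
        \<longlonglongrightarrow> (\<integral>x. f x \<partial>multivariate_normal 0 (v *\<^sub>R matrix_inv SigmaX))"
      by (rule Lim_transform_eventually)
  qed
qed

section \<open>The two scalings\<close>

lemma lam_over_sqrt: "(\<lambda>n. lam n / sqrt (real n)) \<longlonglongrightarrow> 0"
proof (rule smalloD_tendsto, rule landau_o.smallI)
  fix c :: real assume "c > 0"
  from lam_small[OF this] show "\<forall>\<^sub>F n in sequentially. norm (lam n) \<le> c * norm (sqrt (real n))"
    by (rule eventually_mono) (use params in \<open>simp add: less_imp_le\<close>)
qed

text \<open>The scale \<open>1 / sqrt n\<close> covers two regimes at once, because \<open>w\<close>
  may be zero or positive.\<close>

lemma sqrt_n_rate:
  assumes w: "(\<lambda>n. real (s1 n) / (real n / (lam n)\<^sup>2)) \<longlonglongrightarrow> w" and pos: "w + \<sigma>\<^sup>2 > 0"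
  shows "converges_in_distribution M (\<lambda>n \<omega>. sqrt (real n) *\<^sub>R (bhat n \<omega> - \<beta>))
    (multivariate_normal 0 ((w + \<sigma>\<^sup>2) *\<^sub>R matrix_inv SigmaX))"
proof -
  have "converges_in_distribution M (\<lambda>n \<omega>. sqrt (real n) *\<^sub>R (bhat n \<omega> - \<beta>))
    (multivariate_normal 0 ((w + \<sigma>\<^sup>2 * 1) *\<^sub>R matrix_inv SigmaX))"
  proof (rule estimator_converges_in_distribution[where c="\<lambda>n. 1 / sqrt (real n)"])
    show "(\<lambda>n. 1 / sqrt (real n) * lam n) \<longlonglongrightarrow> 0" using lam_over_sqrt by simp
    show "(\<lambda>n. real (s1 n) * (1 / sqrt (real n) * lam n)\<^sup>2) \<longlonglongrightarrow> w"
      using w by (simp add: power_divide)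
    show "(\<lambda>n. real n * (1 / sqrt (real n))\<^sup>2) \<longlonglongrightarrow> 1"
      by (rule tendsto_eventually, rule eventually_mono[OF eventually_gt_at_top[of 0]]) (simp add: power_divide)
    show "w + \<sigma>\<^sup>2 * 1 > 0" using pos by simp
    show "\<forall>\<^sub>F n in sequentially. sqrt (real n) = real n * (1 / sqrt (real n))"
      by (intro always_eventually allI) (simp add: real_div_sqrt)
  qed
  then show ?thesis by simp
qed

text \<open>At scale \<open>r n / n\<close> the errors \<open>eps\<close> contribute a variance of
  order \<open>(n / (lam n)\<^sup>2) / s1 n\<close>, which vanishes, while the clipped observations
  contribute variance tending to 1.\<close>

lemma clipped_rate:
  assumes big: "(\<lambda>n. real n / (lam n)\<^sup>2) \<in> o(\<lambda>n. real (s1 n))"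
    and r: "r \<sim>[sequentially] (\<lambda>n. real n / (lam n * sqrt (real (s1 n))))"
  shows "converges_in_distribution M (\<lambda>n \<omega>. r n *\<^sub>R (bhat n \<omega> - \<beta>)) (multivariate_normal 0 (matrix_inv SigmaX))"
proof -
  define \<rho> where "\<rho> n = r n / (real n / (lam n * sqrt (real (s1 n))))" for n
  have bl: "(\<lambda>n. (real n / (lam n)\<^sup>2) / real (s1 n)) \<longlonglongrightarrow> 0" using big by (rule smalloD_tendsto)
  \<comment> \<open>If \<open>s1 n\<close> were 0 the Landau relation would force
    \<open>real n / (lam n)\<^sup>2\<close> to be 0; hence the divisions by \<open>s1 n\<close>
    below are eventually genuine.\<close>
  have s1pos: "\<forall>\<^sub>F n in sequentially. s1 n > 0 \<and> n > 0"
    using landau_o.smallD[OF big zero_less_one] eventually_gt_at_top[of 0]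
  proof eventually_elim
    case (elim n)
    then have "0 < real n / (lam n)\<^sup>2" using params(3)[of n] by simp
    then show ?case using elim by (cases "s1 n = 0") auto
  qed
  have \<rho>: "\<rho> \<longlonglongrightarrow> 1"
    unfolding \<rho>_def
  proof (rule asymp_equivD_strong[OF r])
    show "\<forall>\<^sub>F n in sequentially. r n \<noteq> 0 \<or> real n / (lam n * sqrt (real (s1 n))) \<noteq> 0"
      using s1pos
    proof (rule eventually_mono)
      fix n assume "0 < s1 n \<and> 0 < n"
      then show "r n \<noteq> 0 \<or> real n / (lam n * sqrt (real (s1 n))) \<noteq> 0" using params(3)[of n] by simp
    qed
  qed
  \<comment> \<open>The number of clipped observations tends to infinity, since
    \<open>n / (lam n)\<^sup>2\<close> does and is of smaller order. This is what makes each clipped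
    summand negligible.\<close>
  have inv_s1: "(\<lambda>n. 1 / sqrt (real (s1 n))) \<longlonglongrightarrow> 0"
  proof -
    have "(\<lambda>n. sqrt ((real n / (lam n)\<^sup>2) / real (s1 n)) * (lam n / sqrt (real n))) \<longlonglongrightarrow> sqrt 0 * 0"
      by (intro tendsto_mult tendsto_real_sqrt bl lam_over_sqrt)
    moreover have "\<forall>\<^sub>F n in sequentially. sqrt ((real n / (lam n)\<^sup>2) / real (s1 n)) * (lam n / sqrt (real n)) = 1 / sqrt (real (s1 n))"
      using s1pos
    proof (rule eventually_mono)
      fix n assume "0 < s1 n \<and> 0 < n"
      then show "sqrt ((real n / (lam n)\<^sup>2) / real (s1 n)) * (lam n / sqrt (real n)) = 1 / sqrt (real (s1 n))"
        using params(3)[of n] by (simp add: real_sqrt_divide real_sqrt_mult)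
    qed
    ultimately have "(\<lambda>n. 1 / sqrt (real (s1 n))) \<longlonglongrightarrow> sqrt 0 * 0"
      by (rule Lim_transform_eventually)
    then show ?thesis by simp
  qed
  \<comment> \<open>The three quantities controlling the limit, written in terms of
    \<open>\<rho>\<close>, the ratio of \<open>r\<close> to the prescribed rate.\<close>
  have c: "\<forall>\<^sub>F n in sequentially. r n / real n * lam n = \<rho> n * (1 / sqrt (real (s1 n)))
      \<and> real (s1 n) * (r n / real n * lam n)\<^sup>2 = (\<rho> n)\<^sup>2
      \<and> real n * (r n / real n)\<^sup>2 = (\<rho> n)\<^sup>2 * ((real n / (lam n)\<^sup>2) / real (s1 n))"
    using s1pos
  proof eventually_elim
    case (elim n)
    define q where "q = sqrt (real (s1 n))"
    define t where "t = r n / real n"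
    have q: "q > 0" "real (s1 n) = q\<^sup>2" using elim by (auto simp: q_def)
    have l: "lam n > 0" by (rule params)
    have \<rho>t: "\<rho> n = t * lam n * q" by (simp add: \<rho>_def t_def q_def)
    have 1: "t * lam n = \<rho> n * (1 / q)" using q(1) by (simp add: \<rho>t)
    have 2: "q\<^sup>2 * (t * lam n)\<^sup>2 = (\<rho> n)\<^sup>2" by (simp add: \<rho>t power_mult_distrib)
    have 3: "real n * t\<^sup>2 = (\<rho> n)\<^sup>2 * ((real n / (lam n)\<^sup>2) / q\<^sup>2)"
      using q(1) l by (simp add: \<rho>t power_mult_distrib)
    show ?case using 1 2 3 unfolding q_def[symmetric] unfolding q(2) t_def by blast
  qed
  have "converges_in_distribution M (\<lambda>n \<omega>. r n *\<^sub>R (bhat n \<omega> - \<beta>))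
    (multivariate_normal 0 ((1\<^sup>2 + \<sigma>\<^sup>2 * (1\<^sup>2 * 0)) *\<^sub>R matrix_inv SigmaX))"
  proof (rule estimator_converges_in_distribution[where c="\<lambda>n. r n / real n"])
    have "(\<lambda>n. \<rho> n * (1 / sqrt (real (s1 n)))) \<longlonglongrightarrow> 1 * 0" by (intro tendsto_mult \<rho> inv_s1)
    then have "(\<lambda>n. r n / real n * lam n) \<longlonglongrightarrow> 1 * 0"
      by (rule Lim_transform_eventually) (rule eventually_mono[OF c], elim conjE, erule sym)
    then show "(\<lambda>n. r n / real n * lam n) \<longlonglongrightarrow> 0" by simp
    have "(\<lambda>n. (\<rho> n)\<^sup>2) \<longlonglongrightarrow> 1\<^sup>2" by (intro tendsto_power \<rho>)
    then show "(\<lambda>n. real (s1 n) * (r n / real n * lam n)\<^sup>2) \<longlonglongrightarrow> 1\<^sup>2"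
      by (rule Lim_transform_eventually) (rule eventually_mono[OF c], elim conjE, erule sym)
    have "(\<lambda>n. (\<rho> n)\<^sup>2 * ((real n / (lam n)\<^sup>2) / real (s1 n))) \<longlonglongrightarrow> 1\<^sup>2 * 0"
      by (intro tendsto_mult tendsto_power \<rho> bl)
    then show "(\<lambda>n. real n * (r n / real n)\<^sup>2) \<longlonglongrightarrow> 1\<^sup>2 * 0"
      by (rule Lim_transform_eventually) (rule eventually_mono[OF c], elim conjE, erule sym)
    \<comment> \<open>At \<open>n = 0\<close> the right-hand side is 0 whatever \<open>r 0\<close>
      is, so equality is claimed only eventually.\<close>
    show "\<forall>\<^sub>F n in sequentially. r n = real n * (r n / real n)"
      by (rule eventually_mono[OF eventually_gt_at_top[of 0]]) simp
  qed simp
  then show ?thesis by simp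
qed

end

theorem theorem3p3:
  fixes M :: "nat \<Rightarrow> 'a measure" and M0 :: "'b measure"
    and X :: "nat \<Rightarrow> nat \<Rightarrow> 'a \<Rightarrow> real ^ 'd" and X0 :: "'b \<Rightarrow> real ^ 'd"
    and eps :: "nat \<Rightarrow> nat \<Rightarrow> 'a \<Rightarrow> real" and eps0 :: "'b \<Rightarrow> real"
    and Y :: "nat \<Rightarrow> nat \<Rightarrow> 'a \<Rightarrow> real"
    and mu :: "nat \<Rightarrow> nat \<Rightarrow> real" and \<beta> :: "real ^ 'd" and SigmaX :: "real ^ 'd ^ 'd"
    and kap gam lam :: "nat \<Rightarrow> real" and s1 s2 :: "nat \<Rightarrow> nat"
    and \<sigma> a \<alpha> C :: real and bhat :: "nat \<Rightarrow> 'a \<Rightarrow> real ^ 'd"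
  assumes prob_M0: "prob_space M0" and prob_M: "\<And>n. prob_space (M n)"
    and X0_rv: "X0 \<in> borel_measurable M0"
    and X0_sq_int: "integrable M0 (\<lambda>\<omega>. (norm (X0 \<omega>))\<^sup>2)"
    and X0_mean: "(\<integral>\<omega>. X0 \<omega> \<partial>M0) = 0"
    and X0_cov: "SigmaX = cov_matrix M0 X0" "pos_def_matrix SigmaX"
    and eps0_rv: "eps0 \<in> borel_measurable M0"
    and eps0_sq_int: "integrable M0 (\<lambda>\<omega>. (eps0 \<omega>)\<^sup>2)"
    and eps0_mean: "(\<integral>\<omega>. eps0 \<omega> \<partial>M0) = 0"
    and eps0_var: "prob_space.variance M0 eps0 = \<sigma>\<^sup>2" "0 < \<sigma>"
    and X_iid: "\<And>n. iid_copies (M n) {1..n} (X n) M0 X0"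
    and eps_iid: "\<And>n. iid_copies (M n) {1..n} (eps n) M0 eps0"
    and X_eps_indep: "\<And>n. indep_families (M n) {1..n} (X n) (eps n)"
    and model: "\<And>n i \<omega>. i \<in> {1..n} \<Longrightarrow> \<omega> \<in> space (M n) \<Longrightarrow>
                  Y n i \<omega> = mu n i + X n i \<omega> \<bullet> \<beta> + eps n i \<omega>"
    and mu: "incidental_parameters kap gam s1 s2 a mu"
    and A: "assumption_A M X eps kap gam"
    and B: "assumption_B kap gam s1 mu \<alpha> lam"
    and C_pos: "0 < C"
    and bhat_rv: "\<And>n. bhat n \<in> borel_measurable (M n)"
    and bhat_consistent: "consistent_estimator M bhat \<beta>"
    and bhat_zero: "with_high_prob M (\<lambda>n \<omega>.
          bhat n \<omega> \<in> coord_box C \<beta> \<and>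
          phi n (lam n) (\<lambda>i. X n i \<omega>) (\<lambda>i. Y n i \<omega>) (bhat n \<omega>) = 0 \<and>
          (\<forall>b\<in>coord_box C \<beta>. phi n (lam n) (\<lambda>i. X n i \<omega>) (\<lambda>i. Y n i \<omega>) b = 0 \<longrightarrow> b = bhat n \<omega>))"
    and small_mu: "(\<lambda>n. real (s2 n)) \<in> o(\<lambda>n. sqrt (real n) / (kap n * gam n)) \<or>
          (assumption_C M0 X0 s1 s2 mu \<and> (\<lambda>n. (mu2_norm s1 s2 mu 2 n)\<^sup>2 / real n) \<longlonglongrightarrow> 0)"
  shows "((\<lambda>n. real (s1 n)) \<in> o(\<lambda>n. real n / (lam n)\<^sup>2) \<longrightarrow>
            converges_in_distribution M (\<lambda>n \<omega>. sqrt (real n) *\<^sub>R (bhat n \<omega> - \<beta>))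
              (multivariate_normal 0 (\<sigma>\<^sup>2 *\<^sub>R matrix_inv SigmaX)))
       \<and> (\<forall>b>0. (\<lambda>n. real (s1 n)) \<sim>[sequentially] (\<lambda>n. b * real n / (lam n)\<^sup>2) \<longrightarrow>
            converges_in_distribution M (\<lambda>n \<omega>. sqrt (real n) *\<^sub>R (bhat n \<omega> - \<beta>))
              (multivariate_normal 0 ((b + \<sigma>\<^sup>2) *\<^sub>R matrix_inv SigmaX)))
       \<and> (\<forall>r. (\<lambda>n. real n / (lam n)\<^sup>2) \<in> o(\<lambda>n. real (s1 n)) \<and>
              r \<sim>[sequentially] (\<lambda>n. real n / (lam n * sqrt (real (s1 n)))) \<longrightarrow>
            converges_in_distribution M (\<lambda>n \<omega>. r n *\<^sub>R (bhat n \<omega> - \<beta>))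
              (multivariate_normal 0 (matrix_inv SigmaX)))"
proof -
  have \<sigma>: "\<sigma>\<^sup>2 > 0" using eps0_var(2) by simp
  interpret incidental_regression M M0 X X0 eps eps0 Y mu \<beta> SigmaX kap gam lam s1 s2 \<sigma> a \<alpha> C bhat
  proof (rule incidental_regression.intro)
    show "with_high_prob M (\<lambda>n \<omega>. bhat n \<omega> \<in> coord_box C \<beta> \<and>
        phi n (lam n) (\<lambda>i. X n i \<omega>) (\<lambda>i. Y n i \<omega>) (bhat n \<omega>) = 0)"
      by (rule with_high_prob_mono[OF prob_M bhat_zero]) simp
    show "(\<lambda>n. real (s2 n)) \<in> o(\<lambda>n. sqrt (real n) / (kap n * gam n)) \<or>
        (\<lambda>n. (mu2_norm s1 s2 mu 2 n)\<^sup>2 / real n) \<longlonglongrightarrow> 0"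
      using small_mu by blast
  qed (fact prob_M0 prob_M X0_rv X0_sq_int X0_mean X0_cov eps0_rv eps0_sq_int eps0_mean eps0_var(1)
      X_iid eps_iid X_eps_indep model mu A B bhat_rv)+
  show ?thesis
  proof (intro conjI allI impI; (elim conjE)?)
    assume "(\<lambda>n. real (s1 n)) \<in> o(\<lambda>n. real n / (lam n)\<^sup>2)"
    then show "converges_in_distribution M (\<lambda>n \<omega>. sqrt (real n) *\<^sub>R (bhat n \<omega> - \<beta>))
        (multivariate_normal 0 (\<sigma>\<^sup>2 *\<^sub>R matrix_inv SigmaX))"
      \<comment> \<open>The small-o hypothesis is the case of limit 0 of the ratio.\<close>
      using sqrt_n_rate[OF smalloD_tendsto] \<sigma> by simp
  next
    fix b :: real
    assume b: "b > 0" and s1: "(\<lambda>n. real (s1 n)) \<sim>[sequentially] (\<lambda>n. b * real n / (lam n)\<^sup>2)"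
    \<comment> \<open>\<open>asymp_equiv\<close> reads 0/0 as 1, so passing to an honest ratio needs
      the denominator to be eventually nonzero; the factor \<open>b\<close> is then moved to the
      limit.\<close>
    have "(\<lambda>n. real (s1 n) / (b * real n / (lam n)\<^sup>2)) \<longlonglongrightarrow> 1"
    proof (rule asymp_equivD_strong[OF s1])
      show "\<forall>\<^sub>F n in sequentially. real (s1 n) \<noteq> 0 \<or> b * real n / (lam n)\<^sup>2 \<noteq> 0"
        using eventually_gt_at_top[of 0]
      proof (rule eventually_mono)
        fix n :: nat assume "0 < n"
        then show "real (s1 n) \<noteq> 0 \<or> b * real n / (lam n)\<^sup>2 \<noteq> 0" using b params(3)[of n] by simp
      qed
    qed
    then have "(\<lambda>n. b * (real (s1 n) / (b * real n / (lam n)\<^sup>2))) \<longlonglongrightarrow> b * 1"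
      by (intro tendsto_mult tendsto_const)
    then have "(\<lambda>n. real (s1 n) / (real n / (lam n)\<^sup>2)) \<longlonglongrightarrow> b" using b by simp
    then show "converges_in_distribution M (\<lambda>n \<omega>. sqrt (real n) *\<^sub>R (bhat n \<omega> - \<beta>))
        (multivariate_normal 0 ((b + \<sigma>\<^sup>2) *\<^sub>R matrix_inv SigmaX))"
      using sqrt_n_rate[of b] b \<sigma> by simp
  next
    fix r
    assume "(\<lambda>n. real n / (lam n)\<^sup>2) \<in> o(\<lambda>n. real (s1 n))"
      and "r \<sim>[sequentially] (\<lambda>n. real n / (lam n * sqrt (real (s1 n))))"
    then show "converges_in_distribution M (\<lambda>n \<omega>. r n *\<^sub>R (bhat n \<omega> - \<beta>))
        (multivariate_normal 0 (matrix_inv SigmaX))"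
      by (rule clipped_rate)
  qed
qed

end
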